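(* Let $a=(a_1,a_2,a_3,a_4)\in S^3$ with $a_1\ge a_2\ge a_3\ge a_4\ge 0$ and let $t\ge 0$. The $3$-dimensional volume of $\operatorname{slice}(a,t)=B^4_\infty\cap H(a,t)$ and the $4$-dimensional volume of $\operatorname{slab}(a,t)=\{x\in B^4_\infty:|\langle a,x\rangle|\le t/2\}$ are piecewise rational functions of $(a,t)$. Modulo signed permutations of the coordinates, they admit a representation with exactly fourteen distinct rational functions, each representing the volume of the corresponding slices (resp. slabs) for which $(a,t)$ lies in a maximal closed chamber of the hyperplane arrangement associated to $B^4_\infty$.
   Context: $B^4_\infty=[-\tfrac12,\tfrac12]^4$ and $H(a,t)=\{x\in\mathbb{R}^4:\langle a,x\rangle=\tfrac t2\}$. The associated arrangement is the sweep arrangement of $B^4_\infty$: the hyperplanes $(v-w)^\perp$ for distinct vertices $v,w$ of the cube; its regions $R_i$ are the connected components of $S^3$ minus these hyperplanes (on each, $\langle a,\cdot\rangle$ induces a fixed strict ordering of the vertices). The maximal (open) chambers are the sets $C_{i,j}=\{(a,t):a\in R_i,\ t\in I_{i,j}(a)\}$, where the $I_{i,j}(a)$ are the open intervals of $t>0$ on which $t/2$ lies strictly between two consecutive values in the list $0$ and the positive values $\langle a,v\rangle$ over vertices $v$; maximal closed chambers are their Euclidean closures. *)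

theory Defs
  imports "HOL-Analysis.Analysis"
begin

section \<open>The cube, its slices and its slabs\<close>

definition cube :: "(real^4) set" where
  "cube = cbox (\<chi> i. - 1 / 2) (\<chi> i. 1 / 2)"

definition vertices :: "(real^4) set" where
  "vertices = {v. \<forall>i. v $ i = - 1 / 2 \<or> v $ i = 1 / 2}"

definition hyperplane :: "real^4 \<Rightarrow> real \<Rightarrow> (real^4) set" where
  "hyperplane a t = {x. a \<bullet> x = t / 2}"

definition slice :: "real^4 \<Rightarrow> real \<Rightarrow> (real^4) set" where
  "slice a t = cube \<inter> hyperplane a t"

definition slab :: "real^4 \<Rightarrow> real \<Rightarrow> (real^4) set" where
  "slab a t = {x \<in> cube. \<bar>a \<bullet> x\<bar> \<le> t / 2}"

text \<open>The 3-dimensional volume of a subset of an affine hyperplane \<open>H\<close> is its Lebesgue measure in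
  Euclidean coordinates on \<open>H\<close>. Two isometries of 3-space onto \<open>H\<close> differ by an isometry
  of 3-space, which preserves Lebesgue measure, so the choice of coordinates is irrelevant.\<close>

definition isometric_chart :: "(real^4) set \<Rightarrow> (real^3 \<Rightarrow> real^4) \<Rightarrow> bool" where
  "isometric_chart H \<phi> \<longleftrightarrow> range \<phi> = H \<and> (\<forall>x y. dist (\<phi> x) (\<phi> y) = dist x y)"

definition volume3 :: "(real^4) set \<Rightarrow> (real^4) set \<Rightarrow> real" where
  "volume3 H S = measure lebesgue ((SOME \<phi>. isometric_chart H \<phi>) -` S)"

definition slice_volume :: "(real^4) \<times> real \<Rightarrow> real" where
  "slice_volume = (\<lambda>(a, t). volume3 (hyperplane a t) (slice a t))"

definition slab_volume :: "(real^4) \<times> real \<Rightarrow> real" where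
  "slab_volume = (\<lambda>(a, t). measure lebesgue (slab a t))"

section \<open>The sweep arrangement and its chambers\<close>

definition regions :: "(real^4) set set" where
  "regions = components
     (sphere 0 1 - (\<Union>v\<in>vertices. \<Union>w\<in>vertices - {v}. {a. (v - w) \<bullet> a = 0}))"

definition sweep_values :: "real^4 \<Rightarrow> real list" where
  "sweep_values a = sorted_list_of_set (insert 0 {a \<bullet> v | v. v \<in> vertices \<and> a \<bullet> v > 0})"

definition chamber :: "(real^4) set \<Rightarrow> nat \<Rightarrow> ((real^4) \<times> real) set" where
  "chamber R j = {(a, t). a \<in> R \<and> Suc j < length (sweep_values a) \<and>
     sweep_values a ! j < t / 2 \<and> t / 2 < sweep_values a ! Suc j}"

text \<open>The index \<open>j\<close> runs over all natural numbers; indices beyond the last interval give the empty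
  set, which is discarded.\<close>

definition chambers :: "((real^4) \<times> real) set set" where
  "chambers = {chamber R j | R j. R \<in> regions} - {{}}"

definition ordered :: "real^4 \<Rightarrow> bool" where
  "ordered a \<longleftrightarrow> a $ 1 \<ge> a $ 2 \<and> a $ 2 \<ge> a $ 3 \<and> a $ 3 \<ge> a $ 4 \<and> a $ 4 \<ge> 0"

definition parameters :: "((real^4) \<times> real) set" where
  "parameters = {(a, t). a \<in> sphere 0 1 \<and> ordered a \<and> t \<ge> 0}"

definition ordered_chambers :: "((real^4) \<times> real) set set" where
  "ordered_chambers = {C \<in> chambers. C \<subseteq> parameters}"

definition signed_permutation :: "(real^4 \<Rightarrow> real^4) \<Rightarrow> bool" where
  "signed_permutation g \<longleftrightarrow> (\<exists>\<pi> \<epsilon>. \<pi> permutes UNIV \<and> (\<forall>i. \<epsilon> i \<in> {1, - 1}) \<and>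
     g = (\<lambda>a. \<chi> i. \<epsilon> i * a $ \<pi> i))"

section \<open>Rational functions\<close>

text \<open>A rational function of \<open>(a, t)\<close> is given by a numerator and a denominator. Since \<open>a\<close> ranges
  over the unit sphere, two fractions are the same function when they agree there, after
  clearing denominators.\<close>

type_synonym fraction = "((real^4) \<times> real \<Rightarrow> real) \<times> ((real^4) \<times> real \<Rightarrow> real)"

definition rational_fraction :: "fraction \<Rightarrow> bool" where
  "rational_fraction r \<longleftrightarrow> real_polynomial_function (fst r) \<and> real_polynomial_function (snd r) \<and>
     (\<exists>x \<in> sphere 0 1 \<times> UNIV. snd r x \<noteq> 0)"

definition same_rational :: "fraction \<Rightarrow> fraction \<Rightarrow> bool" where
  "same_rational r s \<longleftrightarrow>
     (\<forall>x \<in> sphere 0 1 \<times> UNIV. fst r x * snd s x = fst s x * snd r x)"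

definition substitute :: "(real^4 \<Rightarrow> real^4) \<Rightarrow> fraction \<Rightarrow> fraction" where
  "substitute g r = (\<lambda>(a, t). fst r (g a, t), \<lambda>(a, t). snd r (g a, t))"

text \<open>\<open>f\<close> is given by \<open>r\<close> at every point of \<open>S\<close> where \<open>r\<close> is defined. The
  volume formulas have denominators dividing a product of coordinates of \<open>a\<close>, so a
  denominator may vanish only where some coordinate of \<open>a\<close> does. There it cannot be avoided: the
  rational function of a chamber need not extend to such boundary points of its closure.\<close>

definition represents :: "fraction \<Rightarrow> ((real^4) \<times> real \<Rightarrow> real) \<Rightarrow> ((real^4) \<times> real) set \<Rightarrow> bool" where
  "represents r f S \<longleftrightarrow>
     (\<forall>x \<in> S. snd r x \<noteq> 0 \<longrightarrow> f x = fst r x / snd r x) \<and>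
     (\<forall>(a, t) \<in> S. (\<forall>i. a $ i \<noteq> 0) \<longrightarrow> snd r (a, t) \<noteq> 0)"

text \<open>The third clause extends the representation to all \<open>a\<close> by signed permutations. The fourth
  says that no two members of \<open>F\<close> agree, even up to a signed permutation. The
  last says that every point below the largest vertex value, boundary points with vanishing
  coordinates included, lies in a closed chamber whose rational function is defined there.\<close>

definition chamberwise_representation ::
  "fraction set \<Rightarrow> ((real^4) \<times> real \<Rightarrow> real) \<Rightarrow> bool" where
  "chamberwise_representation F f \<longleftrightarrow>
     (\<forall>r\<in>F. rational_fraction r \<and> (\<exists>C\<in>ordered_chambers. represents r f (closure C))) \<and>
     (\<forall>C\<in>ordered_chambers. \<exists>r\<in>F. represents r f (closure C)) \<and>
     (\<forall>C\<in>chambers. \<exists>r\<in>F. \<exists>g. signed_permutation g \<and>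
        represents (substitute g r) f (closure C)) \<and>
     (\<forall>r\<in>F. \<forall>s\<in>F. \<forall>g. r \<noteq> s \<longrightarrow> signed_permutation g \<longrightarrow> \<not> same_rational (substitute g r) s) \<and>
     (\<forall>(a, t)\<in>parameters. (\<exists>v\<in>vertices. t / 2 \<le> a \<bullet> v) \<longrightarrow>
        (\<exists>C\<in>ordered_chambers. \<exists>r\<in>F. (a, t) \<in> closure C \<and>
           represents r f (closure C) \<and> snd r (a, t) \<noteq> 0))"

definition basic_semialgebraic :: "((real^4) \<times> real) set \<Rightarrow> bool" where
  "basic_semialgebraic S \<longleftrightarrow> (\<exists>E P. finite E \<and> finite P \<and>
     (\<forall>h \<in> E \<union> P. real_polynomial_function h) \<and>
     S = {x. (\<forall>h\<in>E. h x = 0) \<and> (\<forall>h\<in>P. h x > 0)})"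

definition piecewise_rational_on ::
  "((real^4) \<times> real) set \<Rightarrow> ((real^4) \<times> real \<Rightarrow> real) \<Rightarrow> bool" where
  "piecewise_rational_on D f \<longleftrightarrow> (\<exists>\<S>. finite \<S> \<and> D \<subseteq> \<Union>\<S> \<and>
     (\<forall>S\<in>\<S>. basic_semialgebraic S \<and>
        (\<exists>r. rational_fraction r \<and> (\<forall>x \<in> S \<inter> D. snd r x \<noteq> 0 \<and> f x = fst r x / snd r x))))"

end

(* For a with first coordinate positive, the slab volume is 1 - 2 P(a . U > t/2) with U uniform on the
   cube, and the slice volume is the density of a . U at t/2. Both arise from the indicator function of
   an interval by averaging over one coordinate after the other; as long as the coordinates are positive,
   this produces signed sums of truncated powers over the sign vectors w. On a chamber each truncated
   power is either a polynomial or zero, according to the side on which w lies, so the formula depends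
   only on the threshold function w |-> [w . a > t]. A case distinction gives fourteen such functions for
   ordered a. A threshold function which ignores some coordinates yields a polynomial integrand for
   them, and the corresponding fraction has no poles where these coordinates vanish: this covers the
   boundary points of the chambers. A perturbation of (a, t) that breaks all ties moves every parameter
   point into an ordered chamber with a suitable fraction. The fourteen fractions are separated by the
   sum of the fourth powers of their values at (v, 0), respectively (v, 1), over the vertices v, which is
   invariant under signed permutations. *)

theory Submission
  imports Defs
begin

section \<open>Averages over an interval and volumes in the cube\<close>

text \<open>The obstacle is the boundary where coordinates of \<open>a\<close> vanish. A point there
  may lie in several closed chambers, and the fractions of some of them may have a pole at it, so a
  fraction has to be chosen from the point and not from a given chamber. The tie rule of
  \<open>matches\<close> makes this choice. It looks at the first sign only: if
  \<open>a $ i = 0\<close> for some \<open>i\<close> other than 1, flipping the \<open>i\<close>-th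
  sign changes neither \<open>w \<bullet> a\<close> nor the rule, so the resulting type ignores
  coordinate \<open>i\<close> and its denominator has no factor \<open>a $ i\<close>. It also treats
  \<open>w\<close> and \<open>- w\<close> oppositely: at \<open>t = 0\<close> they tie together, and
  a hyperplane with \<open>t > 0\<close> cuts off at most one of them. The closed forms, on the
  other hand, do not see ties: a truncated power of positive exponent is 0 at 0 whether it is read
  as the polynomial or as zero. So a formula found on a chamber persists on its closure wherever its
  denominator is nonzero. Chambers are never listed; the type of a chamber is read off at a single
  one of its points.\<close>

definition signed_diff :: "(real \<Rightarrow> real) \<Rightarrow> real" (binder "\<nabla>" 10) where
  "signed_diff f = f 1 - f (- 1)"

text \<open>The value at 0 is 0 also for \<open>n = 0\<close>, where this is the indicator of the
  open half-line, the starting point of the iterated integration.\<close>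

definition trunc_power :: "nat \<Rightarrow> real \<Rightarrow> real" where
  "trunc_power n x = (if x > 0 then x ^ n else 0)"

text \<open>For \<open>a > 0\<close> this is the convolution of \<open>g\<close> with the uniform
  density on the interval of length \<open>a\<close> around 0. Integrating over the cube coordinate
  itself keeps it meaningful for \<open>a = 0\<close>, where it is the identity.\<close>

definition average :: "real \<Rightarrow> (real \<Rightarrow> real) \<Rightarrow> real \<Rightarrow> real" where
  "average a g s = (LINT x:{- 1/2..1/2}|lborel. g (s - a * x))"

text \<open>A class that contains the Borel indicators, is closed under \<open>average\<close>, and
  lets Tonelli apply without further integrability conditions.\<close>

definition tame :: "(real \<Rightarrow> real) \<Rightarrow> bool" where
  "tame g \<longleftrightarrow> g \<in> borel_measurable borel \<and> (\<forall>x. 0 \<le> g x) \<and>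
    (\<exists>B. \<forall>x. g x \<le> B)"

lemma tame_set_integrable:
  assumes "tame g"
  shows "set_integrable lborel {- 1/2..1/2} (\<lambda>x. g (s - a * x))"
proof -
  obtain B where B: "\<And>x. g x \<le> B" and [measurable]: "g \<in> borel_measurable borel"
    and nn: "\<And>x. 0 \<le> g x"
    using assms by (auto simp: tame_def)
  show ?thesis
    unfolding set_integrable_def
  proof (rule Bochner_Integration.integrable_bound[of lborel "\<lambda>x. indicator {- 1/2..1/2::real} x
    *\<^sub>R B"])
    show "integrable lborel (\<lambda>x. indicator {- 1/2..1/2::real} x *\<^sub>R B)"
      by (rule integrable_real_indicator[THEN integrable_scaleR_left]) auto
  qed (auto simp: indicator_def nn intro: order_trans[OF B abs_ge_self])
qed

lemma average_eq_integral:
  assumes "tame g" "((\<lambda>x. g (s - a * x)) has_integral I) {- 1/2..1/2}"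
  shows "average a g s = I"
  using set_borel_integral_eq_integral(2)[OF tame_set_integrable[OF assms(1)]] assms(2)
  unfolding average_def by (metis integral_unique)

lemma nn_integral_average:
  assumes "tame g"
  shows "(\<integral>\<^sup>+x. indicator {- 1/2..1/2} x * ennreal (g (s - a * x)) \<partial>lborel) =
    ennreal (average a g s)"
proof -
  have nn: "\<And>x. 0 \<le> g x" using assms by (auto simp: tame_def)
  have "(\<integral>\<^sup>+x. indicator {- 1/2..1/2} x * ennreal (g (s - a * x)) \<partial>lborel)
      = (\<integral>\<^sup>+x. ennreal (indicator {- 1/2..1/2} x *\<^sub>R g (s - a * x)) \<partial>lborel)"
    by (intro nn_integral_cong) (auto simp: indicator_def)
  also have "\<dots> = ennreal (average a g s)"
    unfolding average_def set_lebesgue_integral_def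
    by (rule nn_integral_eq_integral)
      (use tame_set_integrable[OF assms] in \<open>auto simp: set_integrable_def nn\<close>)
  finally show ?thesis .
qed

lemma tame_average:
  assumes "tame g"
  shows "tame (average a g)"
proof -
  obtain B where B: "\<And>x. g x \<le> B" and [measurable]: "g \<in> borel_measurable borel"
    and nn: "\<And>x. 0 \<le> g x"
    using assms by (auto simp: tame_def)
  have "average a g s \<le> B" for s
  proof -
    have "average a g s \<le> (LINT x:{- 1/2..1/2::real}|lborel. B)"
      unfolding average_def
      by (rule set_integral_mono[OF tame_set_integrable[OF assms]]) (auto simp: set_integrable_def B)
    also have "\<dots> = B" by (simp add: set_lebesgue_integral_def)
    finally show ?thesis .
  qed
  moreover have "0 \<le> average a g s" for s
    unfolding average_def set_lebesgue_integral_def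
    by (rule Bochner_Integration.integral_nonneg) (auto simp: nn)
  moreover have "average a g \<in> borel_measurable borel"
    unfolding average_def set_lebesgue_integral_def by measurable
  ultimately show ?thesis by (auto simp: tame_def)
qed

section \<open>Lebesgue measure in coordinates and iterated integrals over the cube\<close>

lemma vector_4 [simp]:
  "(vector [x, y, z, w] :: ('a::zero)^4) $ 1 = x" "(vector [x, y, z, w] :: ('a::zero)^4) $ 2 = y"
  "(vector [x, y, z, w] :: ('a::zero)^4) $ 3 = z" "(vector [x, y, z, w] :: ('a::zero)^4) $ 4 = w"
  unfolding vector_def by simp_all

lemma emeasure_lborel_Times:
  fixes A :: "'a::euclidean_space set" and B :: "'b::euclidean_space set"
  assumes "A \<in> sets borel" "B \<in> sets borel"
  shows "emeasure lborel (A \<times> B) = emeasure lborel A * emeasure lborel B"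
  unfolding lborel_prod[symmetric] using assms by (simp add: lborel.emeasure_pair_measure_Times)

lemma vector_3_eq: "vector [x, y, z] = (x *\<^sub>R axis 1 1 + y *\<^sub>R axis 2 1 + z *\<^sub>R axis 3 1
  :: real^3)"
  by (simp add: vec_eq_iff forall_3 axis_def)

lemma borel_measurable_vector_3 [measurable]:
  "(\<lambda>(z, y, x). vector [x, y, z] :: real^3) \<in> borel \<rightarrow>\<^sub>M borel"
  unfolding vector_3_eq case_prod_unfold
  by (rule borel_measurable_continuous_onI) (intro continuous_intros)

lemma Basis_real_3: "(Basis :: (real^3) set) = {axis 1 1, axis 2 1, axis 3 1}"
  unfolding Basis_vec_def UNIV_3 by auto

text \<open>Both measures agree on boxes. The coordinates are listed in reverse, so that the first
  one becomes the innermost integral, which is how the averages are nested later.\<close>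

lemma lborel_vector_3:
  "lborel = distr (lborel :: (real \<times> real \<times> real) measure) borel (\<lambda>(z, y, x). vector
    [x, y, z] :: real^3)"
proof (rule lborel_eqI)
  fix l u :: "real^3"
  assume le: "\<And>b. b \<in> Basis \<Longrightarrow> l \<bullet> b \<le> u \<bullet> b"
  have le': "l $ i \<le> u $ i" for i
    using le[of "axis i 1"] by (simp add: inner_axis axis_in_Basis_iff)
  have "(\<lambda>(z, y, x). vector [x, y, z] :: real^3) -` box l u = box (l$3) (u$3) \<times> box (l$2)
    (u$2) \<times> box (l$1) (u$1)"
    by (auto simp: mem_box_cart forall_3)
  then have "emeasure (distr (lborel :: (real \<times> real \<times> real) measure) borel (\<lambda>(z, y,
    x). vector [x, y, z] :: real^3)) (box l u)
     = emeasure lborel (box (l$3) (u$3) \<times> box (l$2) (u$2) \<times> box (l$1) (u$1))"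
    by (subst emeasure_distr) auto
  also have "\<dots> = ennreal ((u$3 - l$3) * ((u$2 - l$2) * (u$1 - l$1)))"
    by (simp add: emeasure_lborel_Times open_Times le' ennreal_mult)
  also have "(u$3 - l$3) * ((u$2 - l$2) * (u$1 - l$1)) = (\<Prod>b\<in>Basis. (u - l) \<bullet> b)"
    by (simp add: Basis_real_3 inner_axis axis_eq_axis mult_ac)
  finally show "emeasure (distr (lborel :: (real \<times> real \<times> real) measure) borel (\<lambda>(z,
    y, x). vector [x, y, z] :: real^3)) (box l u)
     = (\<Prod>b\<in>Basis. (u - l) \<bullet> b)" .
qed simp

lemma vector_4_eq: "vector [x, y, z, w] = (x *\<^sub>R axis 1 1 + y *\<^sub>R axis 2 1 + z *\<^sub>R axis 3
  1 + w *\<^sub>R axis 4 1 :: real^4)"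
  by (simp add: vec_eq_iff forall_4 axis_def)

lemma borel_measurable_vector_4 [measurable]:
  "(\<lambda>(w, z, y, x). vector [x, y, z, w] :: real^4) \<in> borel \<rightarrow>\<^sub>M borel"
  unfolding vector_4_eq case_prod_unfold
  by (rule borel_measurable_continuous_onI) (intro continuous_intros)

lemma Basis_real_4: "(Basis :: (real^4) set) = {axis 1 1, axis 2 1, axis 3 1, axis 4 1}"
  unfolding Basis_vec_def UNIV_4 by auto

lemma lborel_vector_4:
  "lborel = distr (lborel :: (real \<times> real \<times> real \<times> real) measure) borel (\<lambda>(w,
    z, y, x). vector [x, y, z, w] :: real^4)"
proof (rule lborel_eqI)
  fix l u :: "real^4"
  assume le: "\<And>b. b \<in> Basis \<Longrightarrow> l \<bullet> b \<le> u \<bullet> b"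
  have le': "l $ i \<le> u $ i" for i
    using le[of "axis i 1"] by (simp add: inner_axis axis_in_Basis_iff)
  have "(\<lambda>(w, z, y, x). vector [x, y, z, w] :: real^4) -` box l u = box (l$4) (u$4) \<times> box
    (l$3) (u$3) \<times> box (l$2) (u$2) \<times> box (l$1) (u$1)"
    by (auto simp: mem_box_cart forall_4)
  then have "emeasure (distr (lborel :: (real \<times> real \<times> real \<times> real) measure) borel
    (\<lambda>(w, z, y, x). vector [x, y, z, w] :: real^4)) (box l u)
     = emeasure lborel (box (l$4) (u$4) \<times> box (l$3) (u$3) \<times> box (l$2) (u$2) \<times> box
       (l$1) (u$1))"
    by (subst emeasure_distr) auto
  also have "\<dots> = ennreal ((u$4 - l$4) * ((u$3 - l$3) * ((u$2 - l$2) * (u$1 - l$1))))"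
    by (simp add: emeasure_lborel_Times open_Times le' ennreal_mult)
  also have "(u$4 - l$4) * ((u$3 - l$3) * ((u$2 - l$2) * (u$1 - l$1))) = (\<Prod>b\<in>Basis. (u - l)
    \<bullet> b)"
    by (simp add: Basis_real_4 inner_axis axis_eq_axis mult_ac)
  finally show "emeasure (distr (lborel :: (real \<times> real \<times> real \<times> real) measure) borel
    (\<lambda>(w, z, y, x). vector [x, y, z, w] :: real^4)) (box l u)
     = (\<Prod>b\<in>Basis. (u - l) \<bullet> b)" .
qed simp

lemma nn_integral_lborel_pair:
  fixes f :: "'a::euclidean_space \<times> 'b::euclidean_space \<Rightarrow> ennreal"
  assumes "f \<in> borel_measurable borel"
  shows "(\<integral>\<^sup>+p. f p \<partial>lborel) = (\<integral>\<^sup>+x. \<integral>\<^sup>+y. f (x,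
    y) \<partial>lborel \<partial>lborel)"
  using lborel.nn_integral_fst[of f lborel] assms by (simp add: lborel_prod)

lemma nn_integral_lborel_triple:
  fixes f :: "'a::euclidean_space \<times> 'b::euclidean_space \<times> 'c::euclidean_space \<Rightarrow>
    ennreal"
  assumes "f \<in> borel_measurable borel"
  shows "(\<integral>\<^sup>+p. f p \<partial>lborel) = (\<integral>\<^sup>+x. \<integral>\<^sup>+y.
    \<integral>\<^sup>+z. f (x, y, z) \<partial>lborel \<partial>lborel \<partial>lborel)"
proof -
  have "(\<lambda>p. f (x, p)) \<in> borel_measurable borel" for x
    by (rule measurable_compose[OF _ assms], rule borel_measurable_continuous_onI)
      (intro continuous_intros)
  then show ?thesis
    by (simp add: nn_integral_lborel_pair[OF assms] nn_integral_lborel_pair)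
qed

lemma nn_integral_lborel_quadruple:
  fixes f :: "'a::euclidean_space \<times> 'b::euclidean_space \<times> 'c::euclidean_space \<times>
    'd::euclidean_space \<Rightarrow> ennreal"
  assumes "f \<in> borel_measurable borel"
  shows "(\<integral>\<^sup>+p. f p \<partial>lborel)
    = (\<integral>\<^sup>+x. \<integral>\<^sup>+y. \<integral>\<^sup>+z. \<integral>\<^sup>+w. f (x, y, z,
      w) \<partial>lborel \<partial>lborel \<partial>lborel \<partial>lborel)"
proof -
  have "(\<lambda>p. f (x, p)) \<in> borel_measurable borel" for x
    by (rule measurable_compose[OF _ assms], rule borel_measurable_continuous_onI)
      (intro continuous_intros)
  then show ?thesis
    by (simp add: nn_integral_lborel_pair[OF assms] nn_integral_lborel_triple)
qed

text \<open>Tonelli peels off one coordinate after the other; integrating over one of them is an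
  \<open>average\<close>, evaluated at a point shifted by the coordinates further out.\<close>

lemma nn_integral_cube_3:
  fixes b :: "real^3"
  assumes "tame g"
  shows "(\<integral>\<^sup>+y. indicator (cbox (\<chi> i. - 1/2) (\<chi> i. 1/2)) y * ennreal (g (s - b
    \<bullet> y)) \<partial>lborel)
    = ennreal (average (b $ 3) (average (b $ 2) (average (b $ 1) g)) s)"
proof -
  have [measurable]: "g \<in> borel_measurable borel"
    using assms by (auto simp: tame_def)
  have "(\<integral>\<^sup>+y. indicator (cbox (\<chi> i. - 1/2) (\<chi> i. 1/2)) y * ennreal (g (s - b
    \<bullet> y)) \<partial>lborel)
    = (\<integral>\<^sup>+y. indicator (cbox (\<chi> i. - 1/2) (\<chi> i. 1/2)) y * ennreal (g (s - b
      \<bullet> y))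
        \<partial>(distr (lborel :: (real \<times> real \<times> real) measure) borel (\<lambda>(z, y, x).
          vector [x, y, z])))"
    using lborel_vector_3 by simp
  also have "\<dots> = (\<integral>\<^sup>+p. (case p of (z, y, x) \<Rightarrow> indicator (cbox (\<chi> i.
    - 1/2) (\<chi> i. 1/2)) (vector [x, y, z] :: real^3) * ennreal (g (s - b \<bullet> (vector [x, y, z] ::
      real^3)))) \<partial>lborel)"
    by (subst nn_integral_distr) (measurable, simp add: case_prod_unfold)
  also have "\<dots> = (\<integral>\<^sup>+p. (case p of (z, y, x) \<Rightarrow> (indicator {- 1/2..1/2} z)
    * (indicator {- 1/2..1/2} y) * (indicator {- 1/2..1/2} x) * ennreal (g (s - b $ 3 * z - b $ 2 * y - b $
      1 * x))) \<partial>lborel)"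
    by (intro nn_integral_cong)
      (auto simp: indicator_def mem_box_cart forall_3 inner_vec_def sum_3 algebra_simps split: prod.splits)
  also have "\<dots> = (\<integral>\<^sup>+z. indicator {- 1/2..1/2} z * (\<integral>\<^sup>+y. indicator
    {- 1/2..1/2} y * (\<integral>\<^sup>+x. indicator {- 1/2..1/2} x * ennreal (g (s - b $ 3 * z - b $ 2 *
      y - b $ 1 * x)) \<partial>lborel) \<partial>lborel) \<partial>lborel)"
    by (subst nn_integral_lborel_triple, unfold borel_prod[symmetric])
      (measurable, simp add: nn_integral_cmult mult.assoc)
  also have "\<dots> = ennreal (average (b $ 3) (average (b $ 2) (average (b $ 1) g)) s)"
    by (simp only: nn_integral_average tame_average assms)
  finally show ?thesis .
qed

lemma measure_cube_3:
  fixes b :: "real^3"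
  assumes S: "S \<in> sets borel"
  shows "measure lebesgue {y \<in> cbox (\<chi> i. - 1/2) (\<chi> i. 1/2). s - b \<bullet> y \<in> S}
    = average (b $ 3) (average (b $ 2) (average (b $ 1) (indicator S))) s"
    (is "measure _ ?Z = ?A s")
    and "{y \<in> cbox (\<chi> i. - 1/2) (\<chi> i. 1/2). s - b \<bullet> y \<in> S} \<in> lmeasurable"
proof -
  have tame: "tame (indicator S)"
    using S by (auto simp: tame_def indicator_def)
  then have "tame ?A" by (intro tame_average)
  then have nn: "0 \<le> ?A s" by (auto simp: tame_def)
  have "(\<lambda>y. s - b \<bullet> y) \<in> borel \<rightarrow>\<^sub>M borel" by measurable
  then have "(\<lambda>y. s - b \<bullet> y) -` S \<in> sets borel"
    using S by (metis measurable_sets_borel)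
  moreover have "?Z = cbox (\<chi> i. - 1/2) (\<chi> i. 1/2) \<inter> (\<lambda>y. s - b \<bullet> y) -` S"
    by auto
  ultimately have Z: "?Z \<in> sets borel" by simp
  have "emeasure lebesgue ?Z = (\<integral>\<^sup>+y. indicator ?Z y \<partial>lborel)"
    using Z by simp
  also have "\<dots> = (\<integral>\<^sup>+y. indicator (cbox (\<chi> i. - 1/2) (\<chi> i. 1/2)) y *
    ennreal (indicator S (s - b \<bullet> y)) \<partial>lborel)"
    by (intro nn_integral_cong) (auto simp: indicator_def)
  also have "\<dots> = ennreal (?A s)" by (rule nn_integral_cube_3[OF tame])
  finally have e: "emeasure lebesgue ?Z = ennreal (?A s)" .
  then show "measure lebesgue ?Z = ?A s" using nn by (simp add: measure_def)
  show "?Z \<in> lmeasurable" using Z e by (intro fmeasurableI) auto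
qed

lemma nn_integral_cube_4:
  fixes b :: "real^4"
  assumes "tame g"
  shows "(\<integral>\<^sup>+y. indicator (cbox (\<chi> i. - 1/2) (\<chi> i. 1/2)) y * ennreal (g (s - b
    \<bullet> y)) \<partial>lborel)
    = ennreal (average (b $ 4) (average (b $ 3) (average (b $ 2) (average (b $ 1) g))) s)"
proof -
  have [measurable]: "g \<in> borel_measurable borel"
    using assms by (auto simp: tame_def)
  have "(\<integral>\<^sup>+y. indicator (cbox (\<chi> i. - 1/2) (\<chi> i. 1/2)) y * ennreal (g (s - b
    \<bullet> y)) \<partial>lborel)
    = (\<integral>\<^sup>+y. indicator (cbox (\<chi> i. - 1/2) (\<chi> i. 1/2)) y * ennreal (g (s - b
      \<bullet> y))
        \<partial>(distr (lborel :: (real \<times> real \<times> real \<times> real) measure) borel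
          (\<lambda>(w, z, y, x). vector [x, y, z, w])))"
    using lborel_vector_4 by simp
  also have "\<dots> = (\<integral>\<^sup>+p. (case p of (w, z, y, x) \<Rightarrow> indicator (cbox (\<chi>
    i. - 1/2) (\<chi> i. 1/2)) (vector [x, y, z, w] :: real^4) * ennreal (g (s - b \<bullet> (vector [x, y,
      z, w] :: real^4)))) \<partial>lborel)"
    by (subst nn_integral_distr) (measurable, simp add: case_prod_unfold)
  also have "\<dots> = (\<integral>\<^sup>+p. (case p of (w, z, y, x) \<Rightarrow> (indicator {- 1/2..1/2}
    w) * (indicator {- 1/2..1/2} z) * (indicator {- 1/2..1/2} y) * (indicator {- 1/2..1/2} x) * ennreal (g
      (s - b $ 4 * w - b $ 3 * z - b $ 2 * y - b $ 1 * x))) \<partial>lborel)"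
    by (intro nn_integral_cong)
      (auto simp: indicator_def mem_box_cart forall_4 inner_vec_def sum_4 algebra_simps split: prod.splits)
  also have "\<dots> = (\<integral>\<^sup>+w. indicator {- 1/2..1/2} w * (\<integral>\<^sup>+z. indicator
    {- 1/2..1/2} z * (\<integral>\<^sup>+y. indicator {- 1/2..1/2} y * (\<integral>\<^sup>+x. indicator {-
      1/2..1/2} x * ennreal (g (s - b $ 4 * w - b $ 3 * z - b $ 2 * y - b $ 1 * x)) \<partial>lborel)
        \<partial>lborel) \<partial>lborel) \<partial>lborel)"
    by (subst nn_integral_lborel_quadruple, unfold borel_prod[symmetric])
      (measurable, simp add: nn_integral_cmult mult.assoc)
  also have "\<dots> = ennreal (average (b $ 4) (average (b $ 3) (average (b $ 2) (average (b $ 1) g))) s)"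
    by (simp only: nn_integral_average tame_average assms)
  finally show ?thesis .
qed

lemma measure_cube_4:
  fixes b :: "real^4"
  assumes S: "S \<in> sets borel"
  shows "measure lebesgue {y \<in> cbox (\<chi> i. - 1/2) (\<chi> i. 1/2). s - b \<bullet> y \<in> S}
    = average (b $ 4) (average (b $ 3) (average (b $ 2) (average (b $ 1) (indicator S)))) s"
    (is "measure _ ?Z = ?A s")
    and "{y \<in> cbox (\<chi> i. - 1/2) (\<chi> i. 1/2). s - b \<bullet> y \<in> S} \<in> lmeasurable"
proof -
  have tame: "tame (indicator S)"
    using S by (auto simp: tame_def indicator_def)
  then have "tame ?A" by (intro tame_average)
  then have nn: "0 \<le> ?A s" by (auto simp: tame_def)
  have "(\<lambda>y. s - b \<bullet> y) \<in> borel \<rightarrow>\<^sub>M borel" by measurable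
  then have "(\<lambda>y. s - b \<bullet> y) -` S \<in> sets borel"
    using S by (metis measurable_sets_borel)
  moreover have "?Z = cbox (\<chi> i. - 1/2) (\<chi> i. 1/2) \<inter> (\<lambda>y. s - b \<bullet> y) -` S"
    by auto
  ultimately have Z: "?Z \<in> sets borel" by simp
  have "emeasure lebesgue ?Z = (\<integral>\<^sup>+y. indicator ?Z y \<partial>lborel)"
    using Z by simp
  also have "\<dots> = (\<integral>\<^sup>+y. indicator (cbox (\<chi> i. - 1/2) (\<chi> i. 1/2)) y *
    ennreal (indicator S (s - b \<bullet> y)) \<partial>lborel)"
    by (intro nn_integral_cong) (auto simp: indicator_def)
  also have "\<dots> = ennreal (?A s)" by (rule nn_integral_cube_4[OF tame])
  finally have e: "emeasure lebesgue ?Z = ennreal (?A s)" .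
  then show "measure lebesgue ?Z = ?A s" using nn by (simp add: measure_def)
  show "?Z \<in> lmeasurable" using Z e by (intro fmeasurableI) auto
qed

section \<open>Integrals of truncated and of ordinary powers\<close>

lemma has_integral_signed_diff:
  assumes "\<And>w. w = 1 \<or> w = - 1 \<Longrightarrow> (f w has_integral I w) S"
  shows "((\<lambda>x. (\<nabla>w. f w x)) has_integral signed_diff I) S"
  unfolding signed_diff_def by (intro has_integral_diff assms) auto

lemma trunc_power_Suc: "trunc_power (Suc n) x = max 0 x ^ Suc n"
  by (auto simp: trunc_power_def max_def)

lemma has_integral_trunc_power:
  assumes "a \<noteq> 0"
  shows "((\<lambda>x. trunc_power n (c + a * x)) has_integral
    (trunc_power (Suc n) (c + a / 2) - trunc_power (Suc n) (c - a / 2)) / (real (Suc n) * a)) {- 1/2..1/2}"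
proof -
  let ?F = "\<lambda>x. trunc_power (Suc n) (c + a * x) / (real (Suc n) * a)"
  have "((\<lambda>x. trunc_power n (c + a * x)) has_integral ?F (1/2) - ?F (- 1/2)) {- 1/2..1/2}"
  \<comment> \<open>For \<open>n = 0\<close> the antiderivative has a kink at
    \<open>- c / a\<close>, the one point excepted here.\<close>
  proof (rule fundamental_theorem_of_calculus_interior_strong[where S="{- c / a}"])
    show "continuous_on {- 1/2..1/2} ?F"
      unfolding trunc_power_Suc using assms by (intro continuous_intros) auto
    fix x assume x: "x \<in> {- 1/2<..<1/2} - {- c / a}"
    then have "c + a * x \<noteq> 0" using assms by (auto simp: field_simps)
    then consider "c + a * x > 0" | "c + a * x < 0" by linarith
    then have "(?F has_real_derivative trunc_power n (c + a * x)) (at x)"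
    proof cases
      case 1
      have "((\<lambda>x. (c + a * x) ^ Suc n / (real (Suc n) * a)) has_real_derivative (c + a * x) ^ n) (at x)"
        using assms by (auto intro!: derivative_eq_intros simp del: power_Suc)
      moreover have "eventually (\<lambda>y. y \<in> {y. c + a * y > 0}) (nhds x)"
        by (rule eventually_nhds_in_open) (use 1 in \<open>auto intro!: open_Collect_less
          continuous_intros\<close>)
      then have "eventually (\<lambda>y. (c + a * y) ^ Suc n / (real (Suc n) * a) = ?F y) (nhds x)"
        by eventually_elim (simp add: trunc_power_def)
      ultimately show ?thesis
        using 1 by (subst (asm) DERIV_cong_ev) (auto simp: trunc_power_def)
    next
      case 2
      have "eventually (\<lambda>y. y \<in> {y. c + a * y < 0}) (nhds x)"
        by (rule eventually_nhds_in_open) (use 2 in \<open>auto intro!: open_Collect_less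
          continuous_intros\<close>)
      then have "eventually (\<lambda>y. 0 = ?F y) (nhds x)"
        by eventually_elim (simp add: trunc_power_def)
      then show ?thesis
        using 2 DERIV_const[of 0 "at x"] by (subst (asm) DERIV_cong_ev) (auto simp: trunc_power_def)
    qed
    then show "(?F has_vector_derivative trunc_power n (c + a * x)) (at x)"
      by (simp add: has_real_derivative_iff_has_vector_derivative)
  qed auto
  then show ?thesis by (simp add: diff_divide_distrib)
qed

text \<open>Only even powers of \<open>x\<close> survive on the symmetric interval. The second
  moment of the uniform law contributes \<open>a\<^sup>2 / 12\<close>, and in the cubic case it
  enters with the factor \<open>3 * y\<close>.\<close>

lemma has_integral_power:
  "((\<lambda>x. 1::real) has_integral 1) {- 1/2..1/2::real}"
  "((\<lambda>x. y + a * x) has_integral y) {- 1/2..1/2::real}"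
  "((\<lambda>x. (y + a * x)\<^sup>2) has_integral y\<^sup>2 + a\<^sup>2 / 12) {- 1/2..1/2::real}"
  "((\<lambda>x. (y + a * x) ^ 3) has_integral y ^ 3 + y * a\<^sup>2 / 4) {- 1/2..1/2::real}"
proof -
  have ftc: "(f has_integral F (1/2) - F (- 1/2)) {- 1/2..1/2::real}"
    if "\<And>x. (F has_real_derivative f x) (at x)" for f F :: "real \<Rightarrow> real"
    by (rule fundamental_theorem_of_calculus)
      (use that in \<open>auto simp: has_real_derivative_iff_has_vector_derivative intro:
        has_vector_derivative_at_within\<close>)
  have "((\<lambda>x. x) has_real_derivative 1) (at x)" for x :: real
    by (auto intro!: derivative_eq_intros simp: algebra_simps power2_eq_square power3_eq_cube)
  from ftc[OF this] show "((\<lambda>x. 1::real) has_integral 1) {- 1/2..1/2::real}"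
    by (simp add: algebra_simps power2_eq_square power3_eq_cube power4_eq_xxxx)
  have "((\<lambda>x. y * x + a * x\<^sup>2 / 2) has_real_derivative y + a * x) (at x)" for x :: real
    by (auto intro!: derivative_eq_intros simp: algebra_simps power2_eq_square power3_eq_cube)
  from ftc[OF this] show "((\<lambda>x. y + a * x) has_integral y) {- 1/2..1/2::real}"
    by (simp add: algebra_simps power2_eq_square power3_eq_cube power4_eq_xxxx)
  have "((\<lambda>x. y\<^sup>2 * x + y * a * x\<^sup>2 + a\<^sup>2 * x ^ 3 / 3) has_real_derivative (y + a
    * x)\<^sup>2) (at x)" for x :: real
    by (auto intro!: derivative_eq_intros simp: algebra_simps power2_eq_square power3_eq_cube)
  from ftc[OF this] show "((\<lambda>x. (y + a * x)\<^sup>2) has_integral y\<^sup>2 + a\<^sup>2 / 12) {-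
    1/2..1/2::real}"
    by (simp add: algebra_simps power2_eq_square power3_eq_cube power4_eq_xxxx)
  have "((\<lambda>x. y ^ 3 * x + 3 * y\<^sup>2 * a * x\<^sup>2 / 2 + y * a\<^sup>2 * x ^ 3 + a ^ 3 * x ^ 4
    / 4) has_real_derivative (y + a * x) ^ 3) (at x)" for x :: real
    by (auto intro!: derivative_eq_intros simp: algebra_simps power2_eq_square power3_eq_cube)
  from ftc[OF this] show "((\<lambda>x. (y + a * x) ^ 3) has_integral y ^ 3 + y * a\<^sup>2 / 4) {-
    1/2..1/2::real}"
    by (simp add: algebra_simps power2_eq_square power3_eq_cube power4_eq_xxxx)
qed

section \<open>Closed forms\<close>

lemma tame_indicator: "S \<in> sets borel \<Longrightarrow> tame (indicator S)"
  by (auto simp: tame_def indicator_def)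

lemma average_indicator_Icc:
  assumes "a > 0" "b > 0"
  shows "average b (indicator {- a / 2..a / 2}) s
    = (\<nabla>w1 w2. trunc_power 1 (w1 * a / 2 + w2 * b / 2 - s)) / b"
proof (rule average_eq_integral)
  have "((\<lambda>x. trunc_power 0 (a / 2 - s + b * x) - trunc_power 0 (- a / 2 - s + b * x)) has_integral
     (\<nabla>w1 w2. trunc_power 1 (w1 * a / 2 + w2 * b / 2 - s)) / b) {- 1/2..1/2}"
    using has_integral_diff[OF has_integral_trunc_power[of b 0 "a / 2 - s"] has_integral_trunc_power[of b 0
      "- a / 2 - s"]] assms
    by (simp add: signed_diff_def algebra_simps diff_divide_distrib add_divide_distrib)
  \<comment> \<open>The difference of two strict half-line indicators is the indicator of an
    interval open at \<open>a / 2\<close>. The closed interval differs from it only at the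
    \<open>x\<close> with \<open>s - b * x = a / 2\<close>.\<close>
  moreover have "finite {(s - a / 2) / b}" by simp
  ultimately show "((\<lambda>x. indicator {- a / 2..a / 2} (s - b * x)) has_integral
     (\<nabla>w1 w2. trunc_power 1 (w1 * a / 2 + w2 * b / 2 - s)) / b) {- 1/2..1/2}"
    by (rule has_integral_spike_finite[rotated 2])
      (use assms in \<open>auto simp: indicator_def trunc_power_def field_simps\<close>)
qed (simp add: tame_indicator)

lemma average_indicator_lessThan:
  assumes "a > 0"
  shows "average a (indicator {..<0}) s = (\<nabla>w1. trunc_power 1 (w1 * a / 2 - s)) / a"
proof (rule average_eq_integral)
  have "((\<lambda>x. trunc_power 0 (- s + a * x)) has_integral
     (\<nabla>w1. trunc_power 1 (w1 * a / 2 - s)) / a) {- 1/2..1/2}"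
    using has_integral_trunc_power[of a 0 "- s"] assms
    by (simp add: signed_diff_def algebra_simps) (metis minus_diff_commute)
  then show "((\<lambda>x. indicator {..<0} (s - a * x)) has_integral
     (\<nabla>w1. trunc_power 1 (w1 * a / 2 - s)) / a) {- 1/2..1/2}"
    by (rule has_integral_eq[rotated]) (auto simp: indicator_def trunc_power_def)
qed (simp add: tame_indicator)

lemma has_integral_trunc_power_diff:
  assumes "a > 0"
  shows "((\<lambda>x. trunc_power n (c - (s - a * x))) has_integral
    (\<nabla>w. trunc_power (Suc n) (c + w * a / 2 - s)) / (real (Suc n) * a)) {- 1/2..1/2}"
  using has_integral_trunc_power[of a n "c - s"] assms by (simp add: signed_diff_def algebra_simps)

lemma signed_diff_divide: "(\<nabla>w. f w / c) = signed_diff f / c"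
  by (simp add: signed_diff_def diff_divide_distrib)

text \<open>One more averaging raises the exponent by one, divides by the new coordinate and appends
  one more sign to the signed sum. This and its two companions for more signs are the steps of the
  iteration that leads to the closed forms.\<close>

lemma average_signed_diff_1:
  assumes "tame g" "a > 0" "k > 0"
    and g: "\<And>s. g s = (\<nabla>w1. trunc_power n (c w1 - s)) / k"
  shows "average a g s = (\<nabla>w1 w. trunc_power (Suc n) (c w1 + w * a / 2 - s)) / (real (Suc n) * k * a)"
proof (rule average_eq_integral[OF assms(1)])
  have "((\<lambda>x. (\<nabla>w1. trunc_power n (c w1 - (s - a * x))) / k) has_integral
    (\<nabla>w1. (\<nabla>w. trunc_power (Suc n) (c w1 + w * a / 2 - s)) / (real (Suc n) * a)) / k)
    {- 1/2..1/2}"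
    by (intro has_integral_divide has_integral_signed_diff has_integral_trunc_power_diff assms)
  then show "((\<lambda>x. g (s - a * x)) has_integral (\<nabla>w1 w. trunc_power (Suc n) (c w1 + w * a / 2
    - s)) / (real (Suc n) * k * a)) {- 1/2..1/2}"
    unfolding g signed_diff_divide by (simp add: mult_ac)
qed

lemma average_signed_diff_2:
  assumes "tame g" "a > 0" "k > 0"
    and g: "\<And>s. g s = (\<nabla>w1 w2. trunc_power n (c w1 w2 - s)) / k"
  shows "average a g s = (\<nabla>w1 w2 w. trunc_power (Suc n) (c w1 w2 + w * a / 2 - s)) / (real (Suc n) *
    k * a)"
proof (rule average_eq_integral[OF assms(1)])
  have "((\<lambda>x. (\<nabla>w1 w2. trunc_power n (c w1 w2 - (s - a * x))) / k) has_integral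
    (\<nabla>w1 w2. (\<nabla>w. trunc_power (Suc n) (c w1 w2 + w * a / 2 - s)) / (real (Suc n) * a)) / k)
    {- 1/2..1/2}"
    by (intro has_integral_divide has_integral_signed_diff has_integral_trunc_power_diff assms)
  then show "((\<lambda>x. g (s - a * x)) has_integral (\<nabla>w1 w2 w. trunc_power (Suc n) (c w1 w2 + w *
    a / 2 - s)) / (real (Suc n) * k * a)) {- 1/2..1/2}"
    unfolding g signed_diff_divide by (simp add: mult_ac)
qed

lemma average_signed_diff_3:
  assumes "tame g" "a > 0" "k > 0"
    and g: "\<And>s. g s = (\<nabla>w1 w2 w3. trunc_power n (c w1 w2 w3 - s)) / k"
  shows "average a g s = (\<nabla>w1 w2 w3 w. trunc_power (Suc n) (c w1 w2 w3 + w * a / 2 - s)) / (real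
    (Suc n) * k * a)"
proof (rule average_eq_integral[OF assms(1)])
  have "((\<lambda>x. (\<nabla>w1 w2 w3. trunc_power n (c w1 w2 w3 - (s - a * x))) / k) has_integral
    (\<nabla>w1 w2 w3. (\<nabla>w. trunc_power (Suc n) (c w1 w2 w3 + w * a / 2 - s)) / (real (Suc n) * a)) / k)
    {- 1/2..1/2}"
    by (intro has_integral_divide has_integral_signed_diff has_integral_trunc_power_diff assms)
  then show "((\<lambda>x. g (s - a * x)) has_integral (\<nabla>w1 w2 w3 w. trunc_power (Suc n) (c w1 w2 w3
    + w * a / 2 - s)) / (real (Suc n) * k * a)) {- 1/2..1/2}"
    unfolding g signed_diff_divide by (simp add: mult_ac)
qed

text \<open>This is \<open>a1\<close> times the density of \<open>a \<bullet> U\<close>: the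
  indicator is \<open>a1\<close> times the density of the first summand, so only three averages
  remain.\<close>

definition slice_density :: "real \<Rightarrow> real \<Rightarrow> real \<Rightarrow> real \<Rightarrow>
  real \<Rightarrow> real" where
  "slice_density a1 a2 a3 a4 = average a4 (average a3 (average a2 (indicator {- a1 / 2..a1 / 2})))"

text \<open>The probability of \<open>a \<bullet> U > s\<close> for \<open>U\<close> uniform on the
  cube, since the innermost indicator tests \<open>s - a \<bullet> x < 0\<close>.\<close>

definition tail :: "real \<Rightarrow> real \<Rightarrow> real \<Rightarrow> real \<Rightarrow> real
  \<Rightarrow> real" where
  "tail a1 a2 a3 a4 = average a4 (average a3 (average a2 (average a1 (indicator {..<0}))))"

lemma average_Icc_2:
  assumes "a1 > 0" "a2 > 0" "a3 > 0"
  shows "average a3 (average a2 (indicator {- a1 / 2..a1 / 2})) s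
    = (\<nabla>w1 w2 w3. trunc_power 2 (w1 * a1 / 2 + w2 * a2 / 2 + w3 * a3 / 2 - s)) / (2 * a2 * a3)"
proof -
  have "average a3 (average a2 (indicator {- a1 / 2..a1 / 2})) s
    = (\<nabla>w1 w2 w3. trunc_power (Suc 1) (w1 * a1 / 2 + w2 * a2 / 2 + w3 * a3 / 2 - s)) / (real (Suc 1)
      * a2 * a3)"
    by (rule average_signed_diff_2[OF tame_average[OF tame_indicator]]) (use assms average_indicator_Icc in
      auto)
  then show ?thesis by (simp add: numeral_2_eq_2 mult_ac)
qed

lemma slice_density_eq:
  assumes "a1 > 0" "a2 > 0" "a3 > 0" "a4 > 0"
  shows "slice_density a1 a2 a3 a4 s
    = (\<nabla>w1 w2 w3 w4. trunc_power 3 (w1 * a1 / 2 + w2 * a2 / 2 + w3 * a3 / 2 + w4 * a4 / 2 - s)) / (6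
      * a2 * a3 * a4)"
proof -
  have "average a4 (average a3 (average a2 (indicator {- a1 / 2..a1 / 2}))) s
    = (\<nabla>w1 w2 w3 w4. trunc_power (Suc 2) (w1 * a1 / 2 + w2 * a2 / 2 + w3 * a3 / 2 + w4 * a4 / 2 -
      s)) / (real (Suc 2) * (2 * a2 * a3) * a4)"
    by (rule average_signed_diff_3[OF tame_average[OF tame_average[OF tame_indicator]]]) (use assms
      average_Icc_2 in auto)
  then show ?thesis by (simp add: slice_density_def numeral_3_eq_3 mult_ac)
qed

lemma average_lessThan_2:
  assumes "a1 > 0" "a2 > 0"
  shows "average a2 (average a1 (indicator {..<0})) s
    = (\<nabla>w1 w2. trunc_power 2 (w1 * a1 / 2 + w2 * a2 / 2 - s)) / (2 * a1 * a2)"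
proof -
  have "average a2 (average a1 (indicator {..<0})) s
    = (\<nabla>w1 w2. trunc_power (Suc 1) (w1 * a1 / 2 + w2 * a2 / 2 - s)) / (real (Suc 1) * a1 * a2)"
    by (rule average_signed_diff_1[OF tame_average[OF tame_indicator]]) (use assms
      average_indicator_lessThan in auto)
  then show ?thesis by (simp add: numeral_2_eq_2 mult_ac)
qed

lemma average_lessThan_3:
  assumes "a1 > 0" "a2 > 0" "a3 > 0"
  shows "average a3 (average a2 (average a1 (indicator {..<0}))) s
    = (\<nabla>w1 w2 w3. trunc_power 3 (w1 * a1 / 2 + w2 * a2 / 2 + w3 * a3 / 2 - s)) / (6 * a1 * a2 * a3)"
proof -
  have "average a3 (average a2 (average a1 (indicator {..<0}))) s
    = (\<nabla>w1 w2 w3. trunc_power (Suc 2) (w1 * a1 / 2 + w2 * a2 / 2 + w3 * a3 / 2 - s)) / (real (Suc 2)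
      * (2 * a1 * a2) * a3)"
    by (rule average_signed_diff_2[OF tame_average[OF tame_average[OF tame_indicator]]]) (use assms
      average_lessThan_2 in auto)
  then show ?thesis by (simp add: numeral_3_eq_3 mult_ac)
qed

lemma tail_eq:
  assumes "a1 > 0" "a2 > 0" "a3 > 0" "a4 > 0"
  shows "tail a1 a2 a3 a4 s
    = (\<nabla>w1 w2 w3 w4. trunc_power 4 (w1 * a1 / 2 + w2 * a2 / 2 + w3 * a3 / 2 + w4 * a4 / 2 - s)) /
      (24 * a1 * a2 * a3 * a4)"
proof -
  have "average a4 (average a3 (average a2 (average a1 (indicator {..<0})))) s
    = (\<nabla>w1 w2 w3 w4. trunc_power (Suc 3) (w1 * a1 / 2 + w2 * a2 / 2 + w3 * a3 / 2 + w4 * a4 / 2 -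
      s)) / (real (Suc 3) * (6 * a1 * a2 * a3) * a4)"
    by (rule average_signed_diff_3[OF tame_average[OF tame_average[OF tame_average[OF tame_indicator]]]])
      (use assms average_lessThan_3 in auto)
  then show ?thesis by (simp add: tail_def eval_nat_numeral mult_ac)
qed

section \<open>Closed forms determined by a threshold function\<close>

lemma signed_diff_cong:
  assumes "\<And>w. w \<in> {1, - 1} \<Longrightarrow> f w = g w"
  shows "signed_diff f = signed_diff g"
  using assms by (simp add: signed_diff_def)

text \<open>At \<open>x = 0\<close> both readings give 0 because the exponent is positive. This is
  why \<open>P\<close> may be arbitrary there and why the formulas extend to closed
  chambers.\<close>

lemma trunc_power_select:
  assumes "x > 0 \<longrightarrow> P" "x < 0 \<longrightarrow> \<not> P"
  shows "trunc_power (Suc n) x = (if P then x ^ Suc n else 0)"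
  using assms by (cases x "0::real" rule: linorder_cases) (auto simp: trunc_power_def)

lemma average_eqI:
  assumes "tame g" "\<And>x. - 1/2 \<le> x \<Longrightarrow> x \<le> 1/2 \<Longrightarrow> g (s - a * x) = h x"
    and "(h has_integral I) {- 1/2..1/2}"
  shows "average a g s = I"
  by (rule average_eq_integral[OF assms(1) has_integral_eq[OF _ assms(3)]]) (use assms(2) in auto)

lemma has_integral_const_unit: "((\<lambda>x. c::real) has_integral c) {- 1/2..1/2::real}"
  using has_integral_const_real[of c "- 1/2" "1/2"] by simp

lemma has_integral_if_zero:
  "(P \<Longrightarrow> (f has_integral I) S) \<Longrightarrow> ((\<lambda>x. if P then f x else 0)
    has_integral (if P then I else 0)) S"
  by auto

lemma mult_half_bounds:
  fixes a x :: real
  assumes "a \<ge> 0" "- 1/2 \<le> x" "x \<le> 1/2"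
  shows "a * x \<le> a / 2" "- (a / 2) \<le> a * x"
  using mult_left_mono[of x "1/2" a] mult_left_mono[of "- 1/2" x a] assms by auto

text \<open>Ties are left open on purpose: for fixed \<open>W\<close> this is a system of weak
  inequalities, so it passes from a chamber to its closure.\<close>

definition compatible :: "(real \<Rightarrow> real \<Rightarrow> real \<Rightarrow> real \<Rightarrow>
  bool) \<Rightarrow> real \<Rightarrow> real \<Rightarrow> real \<Rightarrow> real \<Rightarrow> real
    \<Rightarrow> bool" where
  "compatible W a1 a2 a3 a4 t \<longleftrightarrow> (\<forall>w1\<in>{1, - 1}. \<forall>w2\<in>{1, - 1}.
    \<forall>w3\<in>{1, - 1}. \<forall>w4\<in>{1, - 1}.
    (w1 * a1 + w2 * a2 + w3 * a3 + w4 * a4 > t \<longrightarrow> W w1 w2 w3 w4) \<and>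
    (w1 * a1 + w2 * a2 + w3 * a3 + w4 * a4 < t \<longrightarrow> \<not> W w1 w2 w3 w4))"

lemma compatibleD:
  assumes "compatible W a1 a2 a3 a4 t" "w1 \<in> {1, - 1}" "w2 \<in> {1, - 1}" "w3 \<in> {1, - 1}" "w4
    \<in> {1, - 1}"
  shows "w1 * a1 + w2 * a2 + w3 * a3 + w4 * a4 > t \<longrightarrow> W w1 w2 w3 w4"
    and "w1 * a1 + w2 * a2 + w3 * a3 + w4 * a4 < t \<longrightarrow> \<not> W w1 w2 w3 w4"
  using assms unfolding compatible_def by blast+

text \<open>If the selection ignores the fourth sign, the values for both extreme positions of the
  fourth coordinate lie weakly on the same side of \<open>t\<close>, and hence so does everything
  between them. On the whole unit interval the truncated power is then a single polynomial or
  zero.\<close>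

lemma compatible_3D:
  assumes "compatible (\<lambda>w1 w2 w3 w4. W w1 w2 w3) a1 a2 a3 a4 t" "a4 \<ge> 0" "- 1/2 \<le> x" "x
    \<le> 1/2"
    and "w1 \<in> {1, - 1}" "w2 \<in> {1, - 1}" "w3 \<in> {1, - 1}"
  shows "(w1 * a1 + w2 * a2 + w3 * a3 - t) / 2 + a4 * x > 0 \<longrightarrow> W w1 w2 w3"
    and "(w1 * a1 + w2 * a2 + w3 * a3 - t) / 2 + a4 * x < 0 \<longrightarrow> \<not> W w1 w2 w3"
proof -
  have "w1 * a1 + w2 * a2 + w3 * a3 + a4 > t \<longrightarrow> W w1 w2 w3"
    "w1 * a1 + w2 * a2 + w3 * a3 - a4 < t \<longrightarrow> \<not> W w1 w2 w3"
    using compatibleD(1)[OF assms(1,5-7), of 1] compatibleD(2)[OF assms(1,5-7), of "- 1"] by simp_all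
  then show "(w1 * a1 + w2 * a2 + w3 * a3 - t) / 2 + a4 * x > 0 \<longrightarrow> W w1 w2 w3"
    "(w1 * a1 + w2 * a2 + w3 * a3 - t) / 2 + a4 * x < 0 \<longrightarrow> \<not> W w1 w2 w3"
    using mult_half_bounds[OF assms(2-4)] by (auto simp: field_simps)
qed

lemma compatible_2D:
  assumes "compatible (\<lambda>w1 w2 w3 w4. W w1 w2) a1 a2 a3 a4 t"
    and "a3 \<ge> 0" "- 1/2 \<le> y" "y \<le> 1/2" "a4 \<ge> 0" "- 1/2 \<le> x" "x \<le> 1/2"
    and "w1 \<in> {1, - 1}" "w2 \<in> {1, - 1}"
  shows "(w1 * a1 + w2 * a2 - t) / 2 + a4 * x + a3 * y > 0 \<longrightarrow> W w1 w2"
    and "(w1 * a1 + w2 * a2 - t) / 2 + a4 * x + a3 * y < 0 \<longrightarrow> \<not> W w1 w2"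
proof -
  have "w1 * a1 + w2 * a2 + a3 + a4 > t \<longrightarrow> W w1 w2"
    "w1 * a1 + w2 * a2 - a3 - a4 < t \<longrightarrow> \<not> W w1 w2"
    using compatibleD(1)[OF assms(1,8,9), of 1 1] compatibleD(2)[OF assms(1,8,9), of "- 1" "- 1"] by simp_all
  then show "(w1 * a1 + w2 * a2 - t) / 2 + a4 * x + a3 * y > 0 \<longrightarrow> W w1 w2"
    "(w1 * a1 + w2 * a2 - t) / 2 + a4 * x + a3 * y < 0 \<longrightarrow> \<not> W w1 w2"
    using mult_half_bounds[OF assms(2-4)] mult_half_bounds[OF assms(5-7)] by (auto simp: field_simps)
qed

text \<open>The arguments of the truncated powers are halves of \<open>w \<bullet> a - t\<close>;
  pulling out the cube of 1/2 turns the factor 6 into 48.\<close>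

lemma slice_density_4:
  assumes "a1 > 0" "a2 > 0" "a3 > 0" "a4 > 0" "compatible W a1 a2 a3 a4 t"
  shows "slice_density a1 a2 a3 a4 (t / 2)
    = (\<nabla>w1 w2 w3 w4. if W w1 w2 w3 w4 then (w1 * a1 + w2 * a2 + w3 * a3 + w4 * a4 - t) ^ 3 else 0) /
      (48 * a2 * a3 * a4)"
proof -
  have "slice_density a1 a2 a3 a4 (t / 2)
    = (\<nabla>w1 w2 w3 w4. trunc_power 3 (w1 * a1 / 2 + w2 * a2 / 2 + w3 * a3 / 2 + w4 * a4 / 2 - t / 2))
      / (6 * a2 * a3 * a4)"
    by (rule slice_density_eq) fact+
  also have "(\<nabla>w1 w2 w3 w4. trunc_power 3 (w1 * a1 / 2 + w2 * a2 / 2 + w3 * a3 / 2 + w4 * a4 / 2 - t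
    / 2))
    = (\<nabla>w1 w2 w3 w4. (if W w1 w2 w3 w4 then (w1 * a1 + w2 * a2 + w3 * a3 + w4 * a4 - t) ^ 3 else 0) / 8)"
  proof (intro signed_diff_cong)
    fix w1 w2 w3 w4 :: real
    assume w: "w1 \<in> {1, - 1}" "w2 \<in> {1, - 1}" "w3 \<in> {1, - 1}" "w4 \<in> {1, - 1}"
    have e: "w1 * a1 / 2 + w2 * a2 / 2 + w3 * a3 / 2 + w4 * a4 / 2 - t / 2 = (w1 * a1 + w2 * a2 + w3 * a3 +
      w4 * a4 - t) / 2"
      by (simp add: field_simps)
    have "trunc_power (Suc 2) ((w1 * a1 + w2 * a2 + w3 * a3 + w4 * a4 - t) / 2)
      = (if W w1 w2 w3 w4 then ((w1 * a1 + w2 * a2 + w3 * a3 + w4 * a4 - t) / 2) ^ Suc 2 else 0)"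
      using compatibleD[OF assms(5) w] by (intro trunc_power_select) simp_all
    then show "trunc_power 3 (w1 * a1 / 2 + w2 * a2 / 2 + w3 * a3 / 2 + w4 * a4 / 2 - t / 2) = (if W w1 w2
      w3 w4 then (w1 * a1 + w2 * a2 + w3 * a3 + w4 * a4 - t) ^ 3 else 0) / 8"
      unfolding e by (simp add: power_divide del: power_Suc)
  qed
  finally show ?thesis by (simp add: signed_diff_divide mult_ac)
qed

lemma tail_4:
  assumes "a1 > 0" "a2 > 0" "a3 > 0" "a4 > 0" "compatible W a1 a2 a3 a4 t"
  shows "tail a1 a2 a3 a4 (t / 2)
    = (\<nabla>w1 w2 w3 w4. if W w1 w2 w3 w4 then (w1 * a1 + w2 * a2 + w3 * a3 + w4 * a4 - t) ^ 4 else 0) /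
      (384 * a1 * a2 * a3 * a4)"
proof -
  have "tail a1 a2 a3 a4 (t / 2)
    = (\<nabla>w1 w2 w3 w4. trunc_power 4 (w1 * a1 / 2 + w2 * a2 / 2 + w3 * a3 / 2 + w4 * a4 / 2 - t / 2))
      / (24 * a1 * a2 * a3 * a4)"
    by (rule tail_eq) fact+
  also have "(\<nabla>w1 w2 w3 w4. trunc_power 4 (w1 * a1 / 2 + w2 * a2 / 2 + w3 * a3 / 2 + w4 * a4 / 2 - t
    / 2))
    = (\<nabla>w1 w2 w3 w4. (if W w1 w2 w3 w4 then (w1 * a1 + w2 * a2 + w3 * a3 + w4 * a4 - t) ^ 4 else 0)
      / 16)"
  proof (intro signed_diff_cong)
    fix w1 w2 w3 w4 :: real
    assume w: "w1 \<in> {1, - 1}" "w2 \<in> {1, - 1}" "w3 \<in> {1, - 1}" "w4 \<in> {1, - 1}"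
    have e: "w1 * a1 / 2 + w2 * a2 / 2 + w3 * a3 / 2 + w4 * a4 / 2 - t / 2 = (w1 * a1 + w2 * a2 + w3 * a3 +
      w4 * a4 - t) / 2"
      by (simp add: field_simps)
    have "trunc_power (Suc 3) ((w1 * a1 + w2 * a2 + w3 * a3 + w4 * a4 - t) / 2)
      = (if W w1 w2 w3 w4 then ((w1 * a1 + w2 * a2 + w3 * a3 + w4 * a4 - t) / 2) ^ Suc 3 else 0)"
      using compatibleD[OF assms(5) w] by (intro trunc_power_select) simp_all
    then show "trunc_power 4 (w1 * a1 / 2 + w2 * a2 / 2 + w3 * a3 / 2 + w4 * a4 / 2 - t / 2) = (if W w1 w2
      w3 w4 then (w1 * a1 + w2 * a2 + w3 * a3 + w4 * a4 - t) ^ 4 else 0) / 16"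
      unfolding e by (simp add: power_divide del: power_Suc)
  qed
  finally show ?thesis by (simp add: signed_diff_divide mult_ac)
qed

lemma slice_density_3:
  assumes "a1 > 0" "a2 > 0" "a3 > 0" "a4 \<ge> 0" "compatible (\<lambda>w1 w2 w3 w4. W w1 w2 w3) a1 a2 a3 a4 t"
  shows "slice_density a1 a2 a3 a4 (t / 2)
    = (\<nabla>w1 w2 w3. if W w1 w2 w3 then 3 * (w1 * a1 + w2 * a2 + w3 * a3 - t)\<^sup>2 + a4\<^sup>2 else
      0) / (24 * a2 * a3)"
proof -
  have "slice_density a1 a2 a3 a4 (t / 2)
    = (\<nabla>w1 w2 w3. if W w1 w2 w3 then ((w1 * a1 + w2 * a2 + w3 * a3 - t) / 2)\<^sup>2 + a4\<^sup>2 /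
      12 else 0) / (2 * a2 * a3)"
    unfolding slice_density_def
  proof (rule average_eqI[OF tame_average[OF tame_average[OF tame_indicator]]])
    fix x :: real assume x: "- 1/2 \<le> x" "x \<le> 1/2"
    have "average a3 (average a2 (indicator {- a1 / 2..a1 / 2})) (t / 2 - a4 * x)
      = (\<nabla>w1 w2 w3. trunc_power 2 (w1 * a1 / 2 + w2 * a2 / 2 + w3 * a3 / 2 - (t / 2 - a4 * x))) / (2
        * a2 * a3)"
      by (rule average_Icc_2) fact+
    also have "(\<nabla>w1 w2 w3. trunc_power 2 (w1 * a1 / 2 + w2 * a2 / 2 + w3 * a3 / 2 - (t / 2 - a4 * x)))
      = (\<nabla>w1 w2 w3. if W w1 w2 w3 then ((w1 * a1 + w2 * a2 + w3 * a3 - t) / 2 + a4 * x)\<^sup>2 else 0)"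
    proof (intro signed_diff_cong)
      fix w1 w2 w3 :: real
      assume w: "w1 \<in> {1, - 1}" "w2 \<in> {1, - 1}" "w3 \<in> {1, - 1}"
      have e: "w1 * a1 / 2 + w2 * a2 / 2 + w3 * a3 / 2 - (t / 2 - a4 * x) = (w1 * a1 + w2 * a2 + w3 * a3 -
        t) / 2 + a4 * x"
        by (simp add: field_simps)
      have "trunc_power (Suc 1) ((w1 * a1 + w2 * a2 + w3 * a3 - t) / 2 + a4 * x) = (if W w1 w2 w3 then ((w1
        * a1 + w2 * a2 + w3 * a3 - t) / 2 + a4 * x) ^ Suc 1 else 0)"
        by (intro trunc_power_select compatible_3D[OF assms(5,4) x w])
      then show "trunc_power 2 (w1 * a1 / 2 + w2 * a2 / 2 + w3 * a3 / 2 - (t / 2 - a4 * x)) = (if W w1 w2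
        w3 then ((w1 * a1 + w2 * a2 + w3 * a3 - t) / 2 + a4 * x)\<^sup>2 else 0)"
        unfolding e by (simp add: numeral_2_eq_2 numeral_3_eq_3)
    qed
    finally show "average a3 (average a2 (indicator {- a1 / 2..a1 / 2})) (t / 2 - a4 * x) = (\<nabla>w1 w2
      w3. if W w1 w2 w3 then ((w1 * a1 + w2 * a2 + w3 * a3 - t) / 2 + a4 * x)\<^sup>2 else 0) / (2 * a2 * a3)" .
  next
    show "((\<lambda>x. (\<nabla>w1 w2 w3. if W w1 w2 w3 then ((w1 * a1 + w2 * a2 + w3 * a3 - t) / 2 + a4 *
      x)\<^sup>2 else 0) / (2 * a2 * a3)) has_integral
       (\<nabla>w1 w2 w3. if W w1 w2 w3 then ((w1 * a1 + w2 * a2 + w3 * a3 - t) / 2)\<^sup>2 + a4\<^sup>2 /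
         12 else 0) / (2 * a2 * a3)) {- 1/2..1/2}"
      by (intro has_integral_divide has_integral_signed_diff has_integral_if_zero has_integral_power)
  qed simp
  also have "(\<nabla>w1 w2 w3. if W w1 w2 w3 then ((w1 * a1 + w2 * a2 + w3 * a3 - t) / 2)\<^sup>2 +
    a4\<^sup>2 / 12 else 0)
    = (\<nabla>w1 w2 w3. (if W w1 w2 w3 then 3 * (w1 * a1 + w2 * a2 + w3 * a3 - t)\<^sup>2 + a4\<^sup>2
      else 0) / 12)"
    by (intro signed_diff_cong) (simp add: power_divide add_divide_distrib)
  finally show ?thesis by (simp add: signed_diff_divide mult_ac)
qed

lemma tail_3:
  assumes "a1 > 0" "a2 > 0" "a3 > 0" "a4 \<ge> 0" "compatible (\<lambda>w1 w2 w3 w4. W w1 w2 w3) a1 a2 a3 a4 t"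
  shows "tail a1 a2 a3 a4 (t / 2)
    = (\<nabla>w1 w2 w3. if W w1 w2 w3 then (w1 * a1 + w2 * a2 + w3 * a3 - t) ^ 3 + (w1 * a1 + w2 * a2 + w3
      * a3 - t) * a4\<^sup>2 else 0) / (48 * a1 * a2 * a3)"
proof -
  have "tail a1 a2 a3 a4 (t / 2)
    = (\<nabla>w1 w2 w3. if W w1 w2 w3 then ((w1 * a1 + w2 * a2 + w3 * a3 - t) / 2) ^ 3 + ((w1 * a1 + w2 *
      a2 + w3 * a3 - t) / 2) * a4\<^sup>2 / 4 else 0) / (6 * a1 * a2 * a3)"
    unfolding tail_def
  proof (rule average_eqI[OF tame_average[OF tame_average[OF tame_average[OF tame_indicator]]]])
    fix x :: real assume x: "- 1/2 \<le> x" "x \<le> 1/2"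
    have "average a3 (average a2 (average a1 (indicator {..<0}))) (t / 2 - a4 * x)
      = (\<nabla>w1 w2 w3. trunc_power 3 (w1 * a1 / 2 + w2 * a2 / 2 + w3 * a3 / 2 - (t / 2 - a4 * x))) / (6
        * a1 * a2 * a3)"
      by (rule average_lessThan_3) fact+
    also have "(\<nabla>w1 w2 w3. trunc_power 3 (w1 * a1 / 2 + w2 * a2 / 2 + w3 * a3 / 2 - (t / 2 - a4 * x)))
      = (\<nabla>w1 w2 w3. if W w1 w2 w3 then ((w1 * a1 + w2 * a2 + w3 * a3 - t) / 2 + a4 * x) ^ 3 else 0)"
    proof (intro signed_diff_cong)
      fix w1 w2 w3 :: real
      assume w: "w1 \<in> {1, - 1}" "w2 \<in> {1, - 1}" "w3 \<in> {1, - 1}"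
      have e: "w1 * a1 / 2 + w2 * a2 / 2 + w3 * a3 / 2 - (t / 2 - a4 * x) = (w1 * a1 + w2 * a2 + w3 * a3 -
        t) / 2 + a4 * x"
        by (simp add: field_simps)
      have "trunc_power (Suc 2) ((w1 * a1 + w2 * a2 + w3 * a3 - t) / 2 + a4 * x) = (if W w1 w2 w3 then ((w1
        * a1 + w2 * a2 + w3 * a3 - t) / 2 + a4 * x) ^ Suc 2 else 0)"
        by (intro trunc_power_select compatible_3D[OF assms(5,4) x w])
      then show "trunc_power 3 (w1 * a1 / 2 + w2 * a2 / 2 + w3 * a3 / 2 - (t / 2 - a4 * x)) = (if W w1 w2
        w3 then ((w1 * a1 + w2 * a2 + w3 * a3 - t) / 2 + a4 * x) ^ 3 else 0)"
        unfolding e by (simp add: numeral_2_eq_2 numeral_3_eq_3)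
    qed
    finally show "average a3 (average a2 (average a1 (indicator {..<0}))) (t / 2 - a4 * x) = (\<nabla>w1 w2
      w3. if W w1 w2 w3 then ((w1 * a1 + w2 * a2 + w3 * a3 - t) / 2 + a4 * x) ^ 3 else 0) / (6 * a1 * a2 *
        a3)" .
  next
    show "((\<lambda>x. (\<nabla>w1 w2 w3. if W w1 w2 w3 then ((w1 * a1 + w2 * a2 + w3 * a3 - t) / 2 + a4 *
      x) ^ 3 else 0) / (6 * a1 * a2 * a3)) has_integral
       (\<nabla>w1 w2 w3. if W w1 w2 w3 then ((w1 * a1 + w2 * a2 + w3 * a3 - t) / 2) ^ 3 + ((w1 * a1 + w2 *
         a2 + w3 * a3 - t) / 2) * a4\<^sup>2 / 4 else 0) / (6 * a1 * a2 * a3)) {- 1/2..1/2}"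
      by (intro has_integral_divide has_integral_signed_diff has_integral_if_zero has_integral_power)
  qed simp
  also have "(\<nabla>w1 w2 w3. if W w1 w2 w3 then ((w1 * a1 + w2 * a2 + w3 * a3 - t) / 2) ^ 3 + ((w1 * a1
    + w2 * a2 + w3 * a3 - t) / 2) * a4\<^sup>2 / 4 else 0)
    = (\<nabla>w1 w2 w3. (if W w1 w2 w3 then (w1 * a1 + w2 * a2 + w3 * a3 - t) ^ 3 + (w1 * a1 + w2 * a2 +
      w3 * a3 - t) * a4\<^sup>2 else 0) / 8)"
    by (intro signed_diff_cong) (simp add: power_divide add_divide_distrib)
  finally show ?thesis by (simp add: signed_diff_divide mult_ac)
qed

lemma slice_density_2:
  assumes "a1 > 0" "a2 > 0" "a3 \<ge> 0" "a4 \<ge> 0" "compatible (\<lambda>w1 w2 w3 w4. W w1 w2) a1 a2 a3 a4 t"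
  shows "slice_density a1 a2 a3 a4 (t / 2)
    = (\<nabla>w1 w2. if W w1 w2 then w1 * a1 + w2 * a2 - t else 0) / (2 * a2)"
proof -
  have "slice_density a1 a2 a3 a4 (t / 2)
    = (\<nabla>w1 w2. if W w1 w2 then (w1 * a1 + w2 * a2 - t) / 2 else 0) / a2"
    unfolding slice_density_def
  proof (rule average_eqI[OF tame_average[OF tame_average[OF tame_indicator]]])
    fix x :: real assume x: "- 1/2 \<le> x" "x \<le> 1/2"
    show "average a3 (average a2 (indicator {- a1 / 2..a1 / 2})) (t / 2 - a4 * x)
      = (\<nabla>w1 w2. if W w1 w2 then (w1 * a1 + w2 * a2 - t) / 2 + a4 * x else 0) / a2"
    proof (rule average_eqI[OF tame_average[OF tame_indicator]])
      fix y :: real assume y: "- 1/2 \<le> y" "y \<le> 1/2"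
      have "average a2 (indicator {- a1 / 2..a1 / 2}) (t / 2 - a4 * x - a3 * y)
        = (\<nabla>w1 w2. trunc_power 1 (w1 * a1 / 2 + w2 * a2 / 2 - (t / 2 - a4 * x - a3 * y))) / a2"
        by (rule average_indicator_Icc) fact+
      also have "(\<nabla>w1 w2. trunc_power 1 (w1 * a1 / 2 + w2 * a2 / 2 - (t / 2 - a4 * x - a3 * y)))
        = (\<nabla>w1 w2. if W w1 w2 then (w1 * a1 + w2 * a2 - t) / 2 + a4 * x + a3 * y else 0)"
      proof (intro signed_diff_cong)
        fix w1 w2 :: real
        assume w: "w1 \<in> {1, - 1}" "w2 \<in> {1, - 1}"
        have e: "w1 * a1 / 2 + w2 * a2 / 2 - (t / 2 - a4 * x - a3 * y) = (w1 * a1 + w2 * a2 - t) / 2 + a4 *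
          x + a3 * y"
          by (simp add: field_simps)
        have "trunc_power (Suc 0) ((w1 * a1 + w2 * a2 - t) / 2 + a4 * x + a3 * y) = (if W w1 w2 then ((w1 *
          a1 + w2 * a2 - t) / 2 + a4 * x + a3 * y) ^ Suc 0 else 0)"
          by (intro trunc_power_select compatible_2D[OF assms(5,3) y assms(4) x w])
        then show "trunc_power 1 (w1 * a1 / 2 + w2 * a2 / 2 - (t / 2 - a4 * x - a3 * y)) = (if W w1 w2 then
          (w1 * a1 + w2 * a2 - t) / 2 + a4 * x + a3 * y else 0)"
          unfolding e by (simp add: numeral_2_eq_2)
      qed
      finally show "average a2 (indicator {- a1 / 2..a1 / 2}) (t / 2 - a4 * x - a3 * y) = (\<nabla>w1 w2.
        if W w1 w2 then (w1 * a1 + w2 * a2 - t) / 2 + a4 * x + a3 * y else 0) / a2" .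
    next
      show "((\<lambda>y. (\<nabla>w1 w2. if W w1 w2 then (w1 * a1 + w2 * a2 - t) / 2 + a4 * x + a3 * y
        else 0) / a2) has_integral
        (\<nabla>w1 w2. if W w1 w2 then (w1 * a1 + w2 * a2 - t) / 2 + a4 * x else 0) / a2) {- 1/2..1/2}"
        by (intro has_integral_divide has_integral_signed_diff has_integral_if_zero has_integral_power)
    qed simp
  next
    show "((\<lambda>x. (\<nabla>w1 w2. if W w1 w2 then (w1 * a1 + w2 * a2 - t) / 2 + a4 * x else 0) / a2)
      has_integral
       (\<nabla>w1 w2. if W w1 w2 then (w1 * a1 + w2 * a2 - t) / 2 else 0) / a2) {- 1/2..1/2}"
      by (intro has_integral_divide has_integral_signed_diff has_integral_if_zero has_integral_power
          has_integral_add has_integral_const_unit)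
  qed simp
  also have "(\<nabla>w1 w2. if W w1 w2 then (w1 * a1 + w2 * a2 - t) / 2 else 0)
    = (\<nabla>w1 w2. (if W w1 w2 then w1 * a1 + w2 * a2 - t else 0) / 2)"
    by (intro signed_diff_cong) (simp add: power_divide add_divide_distrib)
  finally show ?thesis by (simp add: signed_diff_divide mult_ac)
qed

lemma tail_2:
  assumes "a1 > 0" "a2 > 0" "a3 \<ge> 0" "a4 \<ge> 0" "compatible (\<lambda>w1 w2 w3 w4. W w1 w2) a1 a2 a3 a4 t"
  shows "tail a1 a2 a3 a4 (t / 2)
    = (\<nabla>w1 w2. if W w1 w2 then 3 * (w1 * a1 + w2 * a2 - t)\<^sup>2 + a3\<^sup>2 + a4\<^sup>2 else 0)
      / (24 * a1 * a2)"
proof -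
  have "tail a1 a2 a3 a4 (t / 2)
    = (\<nabla>w1 w2. if W w1 w2 then ((w1 * a1 + w2 * a2 - t) / 2)\<^sup>2 + a4\<^sup>2 / 12 + a3\<^sup>2
      / 12 else 0) / (2 * a1 * a2)"
    unfolding tail_def
  proof (rule average_eqI[OF tame_average[OF tame_average[OF tame_average[OF tame_indicator]]]])
    fix x :: real assume x: "- 1/2 \<le> x" "x \<le> 1/2"
    show "average a3 (average a2 (average a1 (indicator {..<0}))) (t / 2 - a4 * x)
      = (\<nabla>w1 w2. if W w1 w2 then ((w1 * a1 + w2 * a2 - t) / 2 + a4 * x)\<^sup>2 + a3\<^sup>2 / 12
        else 0) / (2 * a1 * a2)"
    proof (rule average_eqI[OF tame_average[OF tame_average[OF tame_indicator]]])
      fix y :: real assume y: "- 1/2 \<le> y" "y \<le> 1/2"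
      have "average a2 (average a1 (indicator {..<0})) (t / 2 - a4 * x - a3 * y)
        = (\<nabla>w1 w2. trunc_power 2 (w1 * a1 / 2 + w2 * a2 / 2 - (t / 2 - a4 * x - a3 * y))) / (2 * a1
          * a2)"
        by (rule average_lessThan_2) fact+
      also have "(\<nabla>w1 w2. trunc_power 2 (w1 * a1 / 2 + w2 * a2 / 2 - (t / 2 - a4 * x - a3 * y)))
        = (\<nabla>w1 w2. if W w1 w2 then ((w1 * a1 + w2 * a2 - t) / 2 + a4 * x + a3 * y)\<^sup>2 else 0)"
      proof (intro signed_diff_cong)
        fix w1 w2 :: real
        assume w: "w1 \<in> {1, - 1}" "w2 \<in> {1, - 1}"
        have e: "w1 * a1 / 2 + w2 * a2 / 2 - (t / 2 - a4 * x - a3 * y) = (w1 * a1 + w2 * a2 - t) / 2 + a4 *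
          x + a3 * y"
          by (simp add: field_simps)
        have "trunc_power (Suc 1) ((w1 * a1 + w2 * a2 - t) / 2 + a4 * x + a3 * y) = (if W w1 w2 then ((w1 *
          a1 + w2 * a2 - t) / 2 + a4 * x + a3 * y) ^ Suc 1 else 0)"
          by (intro trunc_power_select compatible_2D[OF assms(5,3) y assms(4) x w])
        then show "trunc_power 2 (w1 * a1 / 2 + w2 * a2 / 2 - (t / 2 - a4 * x - a3 * y)) = (if W w1 w2 then
          ((w1 * a1 + w2 * a2 - t) / 2 + a4 * x + a3 * y)\<^sup>2 else 0)"
          unfolding e by (simp add: numeral_2_eq_2)
      qed
      finally show "average a2 (average a1 (indicator {..<0})) (t / 2 - a4 * x - a3 * y) = (\<nabla>w1 w2.
        if W w1 w2 then ((w1 * a1 + w2 * a2 - t) / 2 + a4 * x + a3 * y)\<^sup>2 else 0) / (2 * a1 * a2)" .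
    next
      show "((\<lambda>y. (\<nabla>w1 w2. if W w1 w2 then ((w1 * a1 + w2 * a2 - t) / 2 + a4 * x + a3 *
        y)\<^sup>2 else 0) / (2 * a1 * a2)) has_integral
        (\<nabla>w1 w2. if W w1 w2 then ((w1 * a1 + w2 * a2 - t) / 2 + a4 * x)\<^sup>2 + a3\<^sup>2 / 12
          else 0) / (2 * a1 * a2)) {- 1/2..1/2}"
        by (intro has_integral_divide has_integral_signed_diff has_integral_if_zero has_integral_power)
    qed simp
  next
    show "((\<lambda>x. (\<nabla>w1 w2. if W w1 w2 then ((w1 * a1 + w2 * a2 - t) / 2 + a4 * x)\<^sup>2 +
      a3\<^sup>2 / 12 else 0) / (2 * a1 * a2)) has_integral
       (\<nabla>w1 w2. if W w1 w2 then ((w1 * a1 + w2 * a2 - t) / 2)\<^sup>2 + a4\<^sup>2 / 12 + a3\<^sup>2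
         / 12 else 0) / (2 * a1 * a2)) {- 1/2..1/2}"
      by (intro has_integral_divide has_integral_signed_diff has_integral_if_zero has_integral_power
          has_integral_add has_integral_const_unit)
  qed simp
  also have "(\<nabla>w1 w2. if W w1 w2 then ((w1 * a1 + w2 * a2 - t) / 2)\<^sup>2 + a4\<^sup>2 / 12 +
    a3\<^sup>2 / 12 else 0)
    = (\<nabla>w1 w2. (if W w1 w2 then 3 * (w1 * a1 + w2 * a2 - t)\<^sup>2 + a3\<^sup>2 + a4\<^sup>2 else
      0) / 12)"
    by (intro signed_diff_cong) (simp add: power_divide add_divide_distrib)
  finally show ?thesis by (simp add: signed_diff_divide mult_ac)
qed

lemma compatible_1D:
  assumes "compatible (\<lambda>w1 w2 w3 w4. w1 > 0) a1 a2 a3 a4 t"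
  shows "a2 + a3 + a4 - a1 \<le> t" "t \<le> a1 - a2 - a3 - a4"
  using compatibleD(1)[OF assms, of "- 1" 1 1 1] compatibleD(2)[OF assms, of 1 "- 1" "- 1" "- 1"] by auto

text \<open>The two bounds on \<open>t\<close> keep \<open>t / 2\<close> minus the contributions of
  the last three coordinates inside the closed interval, so every average is taken of the constant
  1.\<close>

lemma slice_density_1:
  assumes "a1 > 0" "a2 \<ge> 0" "a3 \<ge> 0" "a4 \<ge> 0" "compatible (\<lambda>w1 w2 w3 w4. w1 > 0) a1 a2
    a3 a4 t"
  shows "slice_density a1 a2 a3 a4 (t / 2) = 1"
  unfolding slice_density_def
proof (rule average_eqI[OF _ _ has_integral_const_unit])
  fix x :: real assume x: "- 1/2 \<le> x" "x \<le> 1/2"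
  show "average a3 (average a2 (indicator {- a1 / 2..a1 / 2})) (t / 2 - a4 * x) = 1"
  proof (rule average_eqI[OF _ _ has_integral_const_unit])
    fix y :: real assume y: "- 1/2 \<le> y" "y \<le> 1/2"
    show "average a2 (indicator {- a1 / 2..a1 / 2}) (t / 2 - a4 * x - a3 * y) = 1"
    proof (rule average_eqI[OF _ _ has_integral_const_unit])
      fix z :: real assume z: "- 1/2 \<le> z" "z \<le> 1/2"
      show "indicator {- a1 / 2..a1 / 2} (t / 2 - a4 * x - a3 * y - a2 * z) = (1::real)"
        using compatible_1D[OF assms(5)] mult_half_bounds[OF assms(4) x] mult_half_bounds[OF assms(3) y]
          mult_half_bounds[OF assms(2) z] by (auto simp: indicator_def)
    qed (simp add: tame_indicator)
  qed (simp add: tame_indicator tame_average)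
qed (simp add: tame_indicator tame_average)

lemma tail_1:
  assumes "a1 > 0" "a2 \<ge> 0" "a3 \<ge> 0" "a4 \<ge> 0" "compatible (\<lambda>w1 w2 w3 w4. w1 > 0) a1 a2
    a3 a4 t"
  shows "tail a1 a2 a3 a4 (t / 2) = (a1 - t) / (2 * a1)"
  unfolding tail_def
proof (rule average_eqI)
  fix x :: real assume x: "- 1/2 \<le> x" "x \<le> 1/2"
  show "average a3 (average a2 (average a1 (indicator {..<0}))) (t / 2 - a4 * x) = ((a1 - t) / 2 + a4 * x) / a1"
  proof (rule average_eqI)
    fix y :: real assume y: "- 1/2 \<le> y" "y \<le> 1/2"
    show "average a2 (average a1 (indicator {..<0})) (t / 2 - a4 * x - a3 * y) = ((a1 - t) / 2 + a4 * x +
      a3 * y) / a1"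
    proof (rule average_eqI)
      fix z :: real assume z: "- 1/2 \<le> z" "z \<le> 1/2"
      have "- (a1 / 2) \<le> t / 2 - a4 * x - a3 * y - a2 * z" "t / 2 - a4 * x - a3 * y - a2 * z \<le> a1 / 2"
        using compatible_1D[OF assms(5)] mult_half_bounds[OF assms(4) x] mult_half_bounds[OF assms(3) y]
          mult_half_bounds[OF assms(2) z] by linarith+
      then show "average a1 (indicator {..<0}) (t / 2 - a4 * x - a3 * y - a2 * z)
          = ((a1 - t) / 2 + a4 * x + a3 * y + a2 * z) / a1"
        by (simp add: average_indicator_lessThan[OF assms(1)] signed_diff_def trunc_power_def field_simps)
    next
      show "((\<lambda>z. ((a1 - t) / 2 + a4 * x + a3 * y + a2 * z) / a1) has_integral
        ((a1 - t) / 2 + a4 * x + a3 * y) / a1) {- 1/2..1/2}"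
        by (intro has_integral_divide has_integral_power)
    qed (simp add: tame_indicator tame_average)
  next
    show "((\<lambda>y. ((a1 - t) / 2 + a4 * x + a3 * y) / a1) has_integral ((a1 - t) / 2 + a4 * x) / a1)
      {- 1/2..1/2}"
      by (intro has_integral_divide has_integral_power)
  qed (simp add: tame_indicator tame_average)
next
  have "((\<lambda>x. ((a1 - t) / 2 + a4 * x) / a1) has_integral (a1 - t) / 2 / a1) {- 1/2..1/2}"
    by (intro has_integral_divide has_integral_power)
  then show "((\<lambda>x. ((a1 - t) / 2 + a4 * x) / a1) has_integral (a1 - t) / (2 * a1)) {- 1/2..1/2}"
    by simp
qed (simp add: tame_indicator tame_average)

section \<open>Slices and slabs\<close>

lemma compact_isometric_vimage:
  assumes \<phi>: "isometric_chart H \<phi>" and S: "compact S"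
  shows "compact (\<phi> -` S)"
proof -
  have d: "dist (\<phi> x) (\<phi> y) = dist x y" for x y
    using \<phi> by (auto simp: isometric_chart_def)
  then have "continuous_on UNIV \<phi>"
    unfolding continuous_on_iff by metis
  then have "closed (\<phi> -` S)"
    using compact_imp_closed[OF S] by (metis closed_vimage continuous_on_closed_vimage closed_UNIV
      Int_UNIV_right)
  moreover have "bounded (\<phi> -` S)"
  proof (cases "\<phi> -` S = {}")
    case False
    then obtain x where "\<phi> x \<in> S" by auto
    obtain e where "\<forall>y\<in>S. dist (\<phi> x) y \<le> e"
      using compact_imp_bounded[OF S] bounded_any_center[of S "\<phi> x"] by auto
    then show ?thesis unfolding bounded_def using d by (metis vimageE)
  qed auto
  ultimately show ?thesis by (simp add: compact_eq_bounded_closed)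
qed

text \<open>The transition map between two charts is an isometry of 3-space, that is, an orthogonal
  map followed by a translation. This frees \<open>volume3\<close> from the unspecified chart picked
  by \<open>SOME\<close>.\<close>

lemma measure_vimage_isometric_chart:
  assumes \<phi>: "isometric_chart H \<phi>" and \<psi>: "isometric_chart H \<psi>" and S: "compact S"
  shows "measure lebesgue (\<phi> -` S) = measure lebesgue (\<psi> -` S)"
proof -
  have d: "dist (\<phi> x) (\<phi> y) = dist x y" "dist (\<psi> x) (\<psi> y) = dist x y" for x y
    using \<phi> \<psi> by (auto simp: isometric_chart_def)
  have "\<forall>y. \<exists>x. \<psi> x = \<phi> y"
    using \<phi> \<psi> unfolding isometric_chart_def by (metis rangeI imageE)
  then obtain h where h: "\<And>y. \<psi> (h y) = \<phi> y" by metis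
  have dh: "dist (h x) (h y) = dist x y" for x y
    by (metis d h)
  define k where "k x = h x - h 0" for x
  have k: "orthogonal_transformation k"
    unfolding orthogonal_transformation_isometry k_def using dh by (simp add: dist_norm)
  have "\<psi> -` S = h ` (\<phi> -` S)"
  proof (intro set_eqI iffI)
    fix z assume z: "z \<in> \<psi> -` S"
    have "\<psi> z \<in> range \<phi>" using \<phi> \<psi> by (auto simp: isometric_chart_def)
    then obtain y where y: "\<psi> z = \<phi> y" by auto
    then have "h y = z" using d(2)[of "h y" z] h by simp
    then show "z \<in> h ` (\<phi> -` S)" using y z by auto
  qed (auto simp: h)
  also have "\<dots> = (+) (h 0) ` k ` (\<phi> -` S)"
    by (auto simp: k_def image_image)
  finally have "measure lebesgue (\<psi> -` S) = measure lebesgue (k ` (\<phi> -` S))"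
    by (simp only: measure_translation)
  also have "\<dots> = measure lebesgue (\<phi> -` S)"
    by (rule measure_orthogonal_image[OF k]) (simp add: lmeasurable_compact compact_isometric_vimage[OF
      \<phi> S])
  finally show ?thesis by simp
qed

lemma volume3_eq:
  assumes "isometric_chart H \<phi>" "compact S"
  shows "volume3 H S = measure lebesgue (\<phi> -` S)"
  unfolding volume3_def
  by (rule measure_vimage_isometric_chart[OF someI[of "isometric_chart H"] assms]) (rule assms(1))

lemma compact_slice: "compact (slice a t)"
  unfolding slice_def cube_def hyperplane_def
  by (intro compact_Int_closed compact_cbox closed_Collect_eq continuous_intros)

text \<open>The columns of the linear part of the chart are the quaternion products of \<open>a\<close> with the three
  imaginary units, which form an orthonormal basis of the orthogonal complement of \<open>a\<close>.\<close>

definition quaternion_chart :: "real^4 \<Rightarrow> real \<Rightarrow> real^3 \<Rightarrow> real^4" where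
  "quaternion_chart a t y = vector
    [t / 2 * a $ 1 - a $ 2 * y $ 1 - a $ 3 * y $ 2 - a $ 4 * y $ 3,
     t / 2 * a $ 2 + a $ 1 * y $ 1 + a $ 4 * y $ 2 - a $ 3 * y $ 3,
     t / 2 * a $ 3 - a $ 4 * y $ 1 + a $ 1 * y $ 2 + a $ 2 * y $ 3,
     t / 2 * a $ 4 + a $ 3 * y $ 1 - a $ 2 * y $ 2 + a $ 1 * y $ 3]"

lemma norm_1_iff_4: "norm (a :: real^4) = 1 \<longleftrightarrow> (a $ 1)\<^sup>2 + (a $ 2)\<^sup>2 + (a $
  3)\<^sup>2 + (a $ 4)\<^sup>2 = 1"
  by (simp add: norm_eq_sqrt_inner inner_vec_def sum_4 power2_eq_square)

lemma isometric_quaternion_chart: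
  assumes "norm a = 1"
  shows "isometric_chart (hyperplane a t) (quaternion_chart a t)"
proof -
  have n: "(a $ 1)\<^sup>2 + (a $ 2)\<^sup>2 + (a $ 3)\<^sup>2 + (a $ 4)\<^sup>2 = 1"
    using assms norm_1_iff_4 by simp
  have "a \<bullet> quaternion_chart a t y = t / 2" for y
  proof -
    have "a \<bullet> quaternion_chart a t y = t / 2 * ((a $ 1)\<^sup>2 + (a $ 2)\<^sup>2 + (a $ 3)\<^sup>2
      + (a $ 4)\<^sup>2)"
      by (simp add: quaternion_chart_def inner_vec_def sum_4 algebra_simps power2_eq_square)
    then show ?thesis using n by simp
  qed
  moreover have "x \<in> range (quaternion_chart a t)" if x: "a \<bullet> x = t / 2" for x
  proof -
    \<comment> \<open>The coordinates of \<open>x\<close> in the orthonormal basis formed by the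
      columns of the linear part of the chart.\<close>
    define y :: "real^3" where "y = vector
      [- a $ 2 * x $ 1 + a $ 1 * x $ 2 - a $ 4 * x $ 3 + a $ 3 * x $ 4,
       - a $ 3 * x $ 1 + a $ 4 * x $ 2 + a $ 1 * x $ 3 - a $ 2 * x $ 4,
       - a $ 4 * x $ 1 - a $ 3 * x $ 2 + a $ 2 * x $ 3 + a $ 1 * x $ 4]"
    have t: "t / 2 = a $ 1 * x $ 1 + a $ 2 * x $ 2 + a $ 3 * x $ 3 + a $ 4 * x $ 4"
      using x by (simp add: inner_vec_def sum_4)
    have "quaternion_chart a t y $ i = ((a $ 1)\<^sup>2 + (a $ 2)\<^sup>2 + (a $ 3)\<^sup>2 + (a $
      4)\<^sup>2) * x $ i" for i
      using exhaust_4[of i] unfolding quaternion_chart_def t y_def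
      by (elim disjE; simp add: algebra_simps power2_eq_square)
    then have "quaternion_chart a t y = x" using n by (simp add: vec_eq_iff)
    then show ?thesis by auto
  qed
  ultimately have "range (quaternion_chart a t) = hyperplane a t"
    by (auto simp: hyperplane_def)
  moreover have "dist (quaternion_chart a t y) (quaternion_chart a t z) = dist y z" for y z
  proof -
    have "(quaternion_chart a t y - quaternion_chart a t z) \<bullet> (quaternion_chart a t y -
      quaternion_chart a t z)
      = ((a $ 1)\<^sup>2 + (a $ 2)\<^sup>2 + (a $ 3)\<^sup>2 + (a $ 4)\<^sup>2) * ((y - z) \<bullet> (y - z))"
      by (simp add: quaternion_chart_def inner_vec_def sum_4 sum_3 algebra_simps power2_eq_square)
    then show ?thesis using n by (simp add: dist_norm norm_eq_sqrt_inner)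
  qed
  ultimately show ?thesis by (simp add: isometric_chart_def)
qed

text \<open>Dropping the first coordinate maps the hyperplane bijectively onto 3-space and
  multiplies volumes by \<open>a $ 1\<close>, the cosine of the angle between \<open>a\<close> and
  the first axis. The image of the slice is a subset of the 3-cube measured by
  \<open>measure_cube_3\<close>.\<close>

lemma slice_volume_eq_density:
  assumes n: "norm a = 1" and pos: "a $ 1 > 0"
  shows "slice_volume (a, t) = slice_density (a $ 1) (a $ 2) (a $ 3) (a $ 4) (t / 2) / a $ 1"
proof -
  let ?P = "quaternion_chart a t -` slice a t"
  \<comment> \<open>The map \<open>c + M *v y\<close> is the chart without its first coordinate. The
    set \<open>?Z\<close> is the projected slice: \<open>(t / 2 - b \<bullet> z) / a $ 1\<close>
    recovers the first coordinate from the other three and must lie in the unit interval around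
    0.\<close>
  define b :: "real^3" where "b = vector [a $ 2, a $ 3, a $ 4]"
  define c :: "real^3" where "c = (t / 2) *\<^sub>R b"
  define M :: "real^3^3" where "M = vector [vector [a $ 1, a $ 4, - a $ 3],
    vector [- a $ 4, a $ 1, a $ 2], vector [a $ 3, - a $ 2, a $ 1]]"
  let ?Z = "{z \<in> cbox (\<chi> i. - 1/2) (\<chi> i. 1/2). t / 2 - b \<bullet> z \<in> {- (a $ 1) / 2..a
    $ 1 / 2}}"
  have comp: "(c + M *v y) $ 1 = quaternion_chart a t y $ 2" "(c + M *v y) $ 2 = quaternion_chart a t y $ 3"
    "(c + M *v y) $ 3 = quaternion_chart a t y $ 4" for y
    by (simp_all add: quaternion_chart_def c_def b_def M_def matrix_vector_mult_def sum_3 algebra_simps)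
  have first: "t / 2 - b \<bullet> (c + M *v y) = a $ 1 * quaternion_chart a t y $ 1" for y
  proof -
    have "quaternion_chart a t y \<in> hyperplane a t"
      using isometric_quaternion_chart[OF n] unfolding isometric_chart_def by auto
    then have "a $ 1 * quaternion_chart a t y $ 1 + b \<bullet> (c + M *v y) = t / 2"
      unfolding hyperplane_def inner_vec_def sum_3 comp by (simp add: sum_4 b_def)
    then show ?thesis by simp
  qed
  have sl: "y \<in> ?P \<longleftrightarrow> c + M *v y \<in> ?Z" for y
  proof -
    have "y \<in> ?P \<longleftrightarrow> quaternion_chart a t y \<in> cube"
      using isometric_quaternion_chart[OF n] unfolding isometric_chart_def slice_def by auto
    also have "\<dots> \<longleftrightarrow> c + M *v y \<in> ?Z"
    proof -
      have "- (a $ 1) / 2 \<le> a $ 1 * q \<longleftrightarrow> - 1/2 \<le> q" "a $ 1 * q \<le> a $ 1 / 2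
        \<longleftrightarrow> q \<le> 1/2" for q
        using mult_le_cancel_left_pos[OF pos, of "- 1/2" q] mult_le_cancel_left_pos[OF pos, of q "1/2"] by auto
      then show ?thesis
        unfolding cube_def mem_Collect_eq first mem_box_cart forall_4 forall_3 comp by auto
    qed
    finally show ?thesis .
  qed
  have "?Z = (+) c ` (*v) M ` ?P"
  proof (intro set_eqI iffI)
    fix z assume z: "z \<in> ?Z"
    define x :: "real^4" where "x = vector [(t / 2 - b \<bullet> z) / a $ 1, z $ 1, z $ 2, z $ 3]"
    have "x \<in> hyperplane a t"
      using pos by (simp add: hyperplane_def x_def inner_vec_def sum_4 sum_3 b_def)
    then obtain y where y: "x = quaternion_chart a t y"
      using isometric_quaternion_chart[OF n] unfolding isometric_chart_def by (metis imageE)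
    then have "c + M *v y = z"
      unfolding vec_eq_iff forall_3 comp by (simp add: y[symmetric] x_def)
    then show "z \<in> (+) c ` (*v) M ` ?P" using z sl by auto
  qed (use sl in auto)
  then have "measure lebesgue ?Z = measure lebesgue ((*v) M ` ?P)"
    by (simp only: measure_translation)
  also have "\<dots> = \<bar>det (matrix ((*v) M))\<bar> * measure lebesgue ?P"
    by (rule measure_linear_image)
      (simp_all add: lmeasurable_compact compact_isometric_vimage[OF isometric_quaternion_chart[OF n]
        compact_slice])
  also have "det (matrix ((*v) M)) = a $ 1 * ((a $ 1)\<^sup>2 + (a $ 2)\<^sup>2 + (a $ 3)\<^sup>2 + (a $
    4)\<^sup>2)"
    by (simp add: M_def det_3 algebra_simps power2_eq_square)
  also have "\<dots> = a $ 1" using n norm_1_iff_4 by simp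
  finally have "measure lebesgue ?Z = a $ 1 * measure lebesgue ?P" using pos by simp
  moreover have "measure lebesgue ?Z = slice_density (a $ 1) (a $ 2) (a $ 3) (a $ 4) (t / 2)"
    using measure_cube_3(1)[of "{- (a $ 1) / 2..a $ 1 / 2}" "t / 2" b] by (simp add: slice_density_def b_def)
  moreover have "slice_volume (a, t) = measure lebesgue ?P"
    by (simp add: slice_volume_def volume3_eq[OF isometric_quaternion_chart[OF n] compact_slice])
  ultimately show ?thesis using pos by (simp add: field_simps)
qed

lemma measure_cube: "measure lebesgue cube = 1"
proof -
  have "cbox (\<chi> i. - 1/2) (\<chi> i. 1/2) \<noteq> ({} :: (real^4) set)"
    by (simp add: interval_ne_empty_cart)
  then show ?thesis unfolding cube_def by (simp add: content_cbox_cart del: minus_divide_left)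
qed

text \<open>Negation exchanges the two caps that the slab leaves in the cube, and
  \<open>t \<ge> 0\<close> makes them disjoint.\<close>

lemma slab_volume_eq_tail:
  assumes "t \<ge> 0"
  shows "slab_volume (a, t) = 1 - 2 * tail (a $ 1) (a $ 2) (a $ 3) (a $ 4) (t / 2)"
proof -
  let ?U = "{x \<in> cube. t / 2 - a \<bullet> x \<in> {..<0}}"
  have U: "measure lebesgue ?U = tail (a $ 1) (a $ 2) (a $ 3) (a $ 4) (t / 2)" "?U \<in> lmeasurable"
    unfolding cube_def tail_def by (rule measure_cube_4; simp)+
  have neg: "orthogonal_transformation (uminus :: real^4 \<Rightarrow> real^4)"
    by (simp add: orthogonal_transformation_neg orthogonal_transformation_id[unfolded id_def])
  have V: "measure lebesgue (uminus ` ?U) = measure lebesgue ?U" "uminus ` ?U \<in> lmeasurable"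
    using measure_orthogonal_image[OF neg U(2)] measurable_orthogonal_image[OF neg U(2)] by auto
  have "compact (cube \<inter> {x. \<bar>a \<bullet> x\<bar> \<le> t / 2})"
    unfolding cube_def by (intro compact_Int_closed compact_cbox closed_Collect_le continuous_intros)
  moreover have "slab a t = cube \<inter> {x. \<bar>a \<bullet> x\<bar> \<le> t / 2}"
    by (auto simp: slab_def)
  ultimately have S: "slab a t \<in> lmeasurable"
    by (simp add: lmeasurable_compact)
  have m: "- x \<in> cube \<longleftrightarrow> x \<in> cube" for x
    unfolding cube_def mem_box_cart forall_4 by auto
  have W: "uminus ` ?U = {x \<in> cube. a \<bullet> x < - t / 2}"
  proof (intro set_eqI iffI)
    fix x assume "x \<in> {x \<in> cube. a \<bullet> x < - t / 2}"
    then have "- x \<in> ?U" by (simp add: m)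
    then show "x \<in> uminus ` ?U" by (rule image_eqI[rotated]) simp
  qed (auto simp: m)
  have c: "cube = slab a t \<union> (?U \<union> uminus ` ?U)"
    unfolding W slab_def by auto
  have d: "?U \<inter> uminus ` ?U = {}" "slab a t \<inter> (?U \<union> uminus ` ?U) = {}"
    unfolding W slab_def using assms by auto
  have UV: "?U \<union> uminus ` ?U \<in> lmeasurable"
    by (rule fmeasurable.Un[OF U(2) V(2)])
  have "1 = measure lebesgue (slab a t \<union> (?U \<union> uminus ` ?U))"
    using measure_cube by (simp only: c[symmetric])
  also have "\<dots> = measure lebesgue (slab a t) + measure lebesgue (?U \<union> uminus ` ?U)"
    using fmeasurableD2[OF S] fmeasurableD2[OF UV] fmeasurableD[OF S] fmeasurableD[OF UV] d(2)
    by (intro measure_Union) simp_all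
  also have "measure lebesgue (?U \<union> uminus ` ?U) = measure lebesgue ?U + measure lebesgue (uminus ` ?U)"
    using fmeasurableD2[OF U(2)] fmeasurableD2[OF V(2)] fmeasurableD[OF U(2)] fmeasurableD[OF V(2)] d(1)
    by (intro measure_Union) simp_all
  finally show ?thesis using V(1) U(1) by (simp add: slab_volume_def)
qed

section \<open>Hyperplanes beyond the cube, and invariance under signed permutations\<close>

lemma cube_iff: "x \<in> cube \<longleftrightarrow> (\<forall>i. \<bar>x $ i\<bar> \<le> 1/2)"
proof -
  have "- 1/2 \<le> r \<and> r \<le> 1/2 \<longleftrightarrow> \<bar>r\<bar> \<le> 1/2" for r :: real by auto
  then show ?thesis unfolding cube_def mem_box_cart by simp
qed

lemma inner_le_half_sum_abs:
  assumes "x \<in> cube"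
  shows "\<bar>a \<bullet> x\<bar> \<le> (\<Sum>i\<in>UNIV. \<bar>a $ i\<bar>) / 2"
proof -
  have "\<bar>a \<bullet> x\<bar> \<le> (\<Sum>i\<in>UNIV. \<bar>a $ i * x $ i\<bar>)"
    by (simp add: inner_vec_def sum_abs)
  also have "\<dots> \<le> (\<Sum>i\<in>UNIV. \<bar>a $ i\<bar> * (1/2))"
    using assms unfolding cube_iff abs_mult by (intro sum_mono mult_left_mono) auto
  finally show ?thesis by (simp add: sum_divide_distrib)
qed

lemma slice_volume_eq_0:
  assumes "(\<Sum>i\<in>UNIV. \<bar>a $ i\<bar>) < t"
  shows "slice_volume (a, t) = 0"
proof -
  have "a \<bullet> x \<noteq> t / 2" if "x \<in> cube" for x
    using inner_le_half_sum_abs[OF that, of a] assms by auto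
  then have "slice a t = {}" by (auto simp: slice_def hyperplane_def)
  then show ?thesis by (simp add: slice_volume_def volume3_def)
qed

lemma slab_volume_eq_1:
  assumes "(\<Sum>i\<in>UNIV. \<bar>a $ i\<bar>) \<le> t"
  shows "slab_volume (a, t) = 1"
proof -
  have "\<bar>a \<bullet> x\<bar> \<le> t / 2" if "x \<in> cube" for x
    using inner_le_half_sum_abs[OF that, of a] assms by auto
  then have "slab a t = cube" by (auto simp: slab_def)
  then show ?thesis by (simp add: slab_volume_def measure_cube)
qed

lemma signed_permutation_orthogonal:
  assumes "signed_permutation g"
  shows "orthogonal_transformation g"
proof -
  obtain \<pi> \<epsilon> where \<pi>: "\<pi> permutes UNIV" and \<epsilon>: "\<And>i. \<epsilon> i \<in>
    {1, - 1 :: real}"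
    and g: "g = (\<lambda>a. \<chi> i. \<epsilon> i * a $ \<pi> i)"
    using assms by (auto simp: signed_permutation_def)
  have "linear g"
    unfolding g by (rule linearI) (simp_all add: vec_eq_iff algebra_simps)
  moreover have "g x \<bullet> g y = x \<bullet> y" for x y
  proof -
    have "\<epsilon> i * \<epsilon> i = 1" for i using \<epsilon>[of i] by auto
    then have e: "\<epsilon> i * x $ \<pi> i * (\<epsilon> i * y $ \<pi> i) = x $ \<pi> i * y $ \<pi> i" for i
      by (metis mult.assoc mult.left_commute mult_1)
    have "g x \<bullet> g y = (\<Sum>i\<in>UNIV. x $ \<pi> i * y $ \<pi> i)"
      unfolding g inner_vec_def by (simp only: vec_lambda_beta inner_real_def e)
    also have "\<dots> = x \<bullet> y"
      using sum.permute[OF \<pi>, of "\<lambda>i. x $ i * y $ i"] by (simp add: inner_vec_def o_def)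
    finally show ?thesis .
  qed
  ultimately show ?thesis by (simp add: orthogonal_transformation_def)
qed

lemma signed_permutation_cube:
  assumes "signed_permutation g"
  shows "g x \<in> cube \<longleftrightarrow> x \<in> cube"
proof -
  obtain \<pi> \<epsilon> where \<pi>: "\<pi> permutes UNIV" and \<epsilon>: "\<And>i. \<epsilon> i \<in>
    {1, - 1 :: real}"
    and g: "g = (\<lambda>a. \<chi> i. \<epsilon> i * a $ \<pi> i)"
    using assms by (auto simp: signed_permutation_def)
  have "\<bar>\<epsilon> i\<bar> = 1" for i using \<epsilon>[of i] by auto
  then have "g x \<in> cube \<longleftrightarrow> (\<forall>i. \<bar>x $ \<pi> i\<bar> \<le> 1/2)"
    by (simp add: cube_iff g abs_mult)
  also have "\<dots> \<longleftrightarrow> x \<in> cube"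
    using permutes_surj[OF \<pi>] unfolding cube_iff by (metis surjD)
  finally show ?thesis .
qed

lemma slab_volume_signed_permutation:
  assumes "signed_permutation g"
  shows "slab_volume (g a, t) = slab_volume (a, t)"
proof -
  note o = signed_permutation_orthogonal[OF assms]
  have i: "g a \<bullet> g x = a \<bullet> x" for a x
    using o by (auto simp: orthogonal_transformation_def)
  have "slab (g a) t = g ` slab a t"
  proof (intro set_eqI iffI)
    fix y assume y: "y \<in> slab (g a) t"
    obtain x where x: "y = g x"
      using orthogonal_transformation_surj[OF o] by (metis surjD)
    then have "x \<in> slab a t"
      using y by (simp add: slab_def i signed_permutation_cube[OF assms])
    then show "y \<in> g ` slab a t" using x by auto
  qed (auto simp: slab_def i signed_permutation_cube[OF assms])
  moreover have "slab a t = cube \<inter> {x. \<bar>a \<bullet> x\<bar> \<le> t / 2}"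
    by (auto simp: slab_def)
  then have "slab a t \<in> lmeasurable"
    unfolding cube_def by (simp add: lmeasurable_compact compact_Int_closed closed_Collect_le continuous_intros)
  ultimately show ?thesis
    by (simp add: slab_volume_def measure_orthogonal_image[OF o])
qed

text \<open>Composing a chart of the hyperplane with \<open>g\<close> gives a chart of the image
  hyperplane in which the image slice has the same preimage. The assumption
  \<open>norm a = 1\<close> supplies the first chart.\<close>

lemma slice_volume_signed_permutation:
  assumes g: "signed_permutation g" and n: "norm a = 1"
  shows "slice_volume (g a, t) = slice_volume (a, t)"
proof -
  note o = signed_permutation_orthogonal[OF g]
  have i: "g a \<bullet> g x = a \<bullet> x" for a x
    using o by (auto simp: orthogonal_transformation_def)
  let ?\<phi> = "quaternion_chart a t"
  have \<phi>: "isometric_chart (hyperplane a t) ?\<phi>" by (rule isometric_quaternion_chart[OF n])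
  have mem: "g x \<in> hyperplane (g a) t \<longleftrightarrow> x \<in> hyperplane a t" for x
    by (simp add: hyperplane_def i)
  have "hyperplane (g a) t \<subseteq> g ` hyperplane a t"
  proof
    fix y assume y: "y \<in> hyperplane (g a) t"
    obtain x where x: "y = g x"
      using orthogonal_transformation_surj[OF o] by (metis surjD)
    then show "y \<in> g ` hyperplane a t" using y mem by auto
  qed
  then have "range (g \<circ> ?\<phi>) = hyperplane (g a) t"
    using \<phi> mem unfolding isometric_chart_def image_comp[symmetric] by auto
  moreover have "dist (g x) (g y) = dist x y" for x y
    using o by (simp add: orthogonal_transformation_isometry)
  ultimately have \<psi>: "isometric_chart (hyperplane (g a) t) (g \<circ> ?\<phi>)"
    using \<phi> by (simp add: isometric_chart_def)
  have "(g \<circ> ?\<phi>) -` slice (g a) t = ?\<phi> -` slice a t"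
    by (auto simp: slice_def mem signed_permutation_cube[OF g])
  then show ?thesis
    by (simp add: slice_volume_def volume3_eq[OF \<psi> compact_slice] volume3_eq[OF \<phi> compact_slice])
qed

section \<open>The fourteen types\<close>

text \<open>Each combinatorial type of chambers is encoded by an integer reference point \<open>(c, \<theta>)\<close>: the type is
  the set of sign vectors \<open>w\<close> with \<open>c \<bullet> w > \<theta>\<close>, that is, of the
    vertices cut off by the
  hyperplane. The vanishing entries of \<open>c\<close> are the coordinates on which this set does not
    depend.\<close>

definition references :: "(real \<times> real \<times> real \<times> real \<times> real) set" where
  "references = {(1, 0, 0, 0, 0), (1, 1, 0, 0, 1), (1, 1, 1, 0, 2), (2, 1, 1, 0, 1), (1, 1, 1, 0, 0), (1,
    1, 1, 1, 3), (2, 2, 1, 1, 3), (2, 1, 1, 1, 2), (1, 1, 1, 1, 1), (3, 2, 1, 1, 2), (2, 2, 1, 1, 1), (3,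
      2, 2, 1, 1), (3, 1, 1, 1, 1), (2, 1, 1, 1, 0)}"

definition wins :: "real \<times> real \<times> real \<times> real \<times> real \<Rightarrow> real
  \<Rightarrow> real \<Rightarrow> real \<Rightarrow> real \<Rightarrow> bool" where
  "wins = (\<lambda>(c1, c2, c3, c4, \<theta>) w1 w2 w3 w4. c1 * w1 + c2 * w2 + c3 * w3 + c4 * w4 > \<theta>)"

text \<open>The last nonvanishing entry of \<open>c\<close> decides which of the closed forms
  \<open>slice_density_4\<close> to \<open>slice_density_1\<close> is used; ignored signs are set to
  1. The additional factor \<open>a $ 1\<close> in the denominators comes from the projection along
  the first axis.\<close>

definition slice_fraction :: "real \<times> real \<times> real \<times> real \<times> real \<Rightarrow>
  fraction" where
  "slice_fraction = (\<lambda>(c1, c2, c3, c4, \<theta>).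
    if c4 \<noteq> 0 then (\<lambda>(a, t). (\<nabla>w1 w2 w3 w4. if wins (c1, c2, c3, c4, \<theta>) w1 w2
      w3 w4 then (w1 * a $ 1 + w2 * a $ 2 + w3 * a $ 3 + w4 * a $ 4 - t) ^ 3 else 0), \<lambda>(a, t). 48 *
        a $ 1 * a $ 2 * a $ 3 * a $ 4)
    else if c3 \<noteq> 0 then (\<lambda>(a, t). (\<nabla>w1 w2 w3. if wins (c1, c2, c3, c4, \<theta>) w1
      w2 w3 1 then 3 * (w1 * a $ 1 + w2 * a $ 2 + w3 * a $ 3 - t)\<^sup>2 + (a $ 4)\<^sup>2 else 0),
        \<lambda>(a, t). 24 * a $ 1 * a $ 2 * a $ 3)
    else if c2 \<noteq> 0 then (\<lambda>(a, t). (\<nabla>w1 w2. if wins (c1, c2, c3, c4, \<theta>) w1 w2 1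
      1 then (w1 * a $ 1 + w2 * a $ 2 - t) else 0), \<lambda>(a, t). 2 * a $ 1 * a $ 2)
    else (\<lambda>(a, t). 1, \<lambda>(a, t). a $ 1))"

text \<open>In each branch this is \<open>1 - 2 * tail\<close> with the corresponding closed form of
  \<open>tail\<close>, brought to one denominator; the factor 2 halves the constants 384, 48 and
  24.\<close>

definition slab_fraction :: "real \<times> real \<times> real \<times> real \<times> real \<Rightarrow>
  fraction" where
  "slab_fraction = (\<lambda>(c1, c2, c3, c4, \<theta>).
    if c4 \<noteq> 0 then (\<lambda>(a, t). 192 * a $ 1 * a $ 2 * a $ 3 * a $ 4 - (\<nabla>w1 w2 w3 w4. if
      wins (c1, c2, c3, c4, \<theta>) w1 w2 w3 w4 then (w1 * a $ 1 + w2 * a $ 2 + w3 * a $ 3 + w4 * a $ 4 -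
        t) ^ 4 else 0), \<lambda>(a, t). 192 * a $ 1 * a $ 2 * a $ 3 * a $ 4)
    else if c3 \<noteq> 0 then (\<lambda>(a, t). 24 * a $ 1 * a $ 2 * a $ 3 - (\<nabla>w1 w2 w3. if wins
      (c1, c2, c3, c4, \<theta>) w1 w2 w3 1 then (w1 * a $ 1 + w2 * a $ 2 + w3 * a $ 3 - t) ^ 3 + (w1 * a $
        1 + w2 * a $ 2 + w3 * a $ 3 - t) * (a $ 4)\<^sup>2 else 0), \<lambda>(a, t). 24 * a $ 1 * a $ 2 * a $ 3)
    else if c2 \<noteq> 0 then (\<lambda>(a, t). 12 * a $ 1 * a $ 2 - (\<nabla>w1 w2. if wins (c1, c2, c3,
      c4, \<theta>) w1 w2 1 1 then 3 * (w1 * a $ 1 + w2 * a $ 2 - t)\<^sup>2 + (a $ 3)\<^sup>2 + (a $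
        4)\<^sup>2 else 0), \<lambda>(a, t). 12 * a $ 1 * a $ 2)
    else (\<lambda>(a, t). t, \<lambda>(a, t). a $ 1))"

text \<open>Together with \<open>a $ i \<ge> 0\<close>, a nonzero denominator supplies exactly the
  strict positivity that the closed form of the same branch asks for.\<close>

lemma slice_fraction_correct:
  assumes r: "r \<in> references" and n: "norm a = 1" and nn: "\<And>i. a $ i \<ge> 0" and t: "t \<ge> 0"
    and W: "compatible (wins r) (a $ 1) (a $ 2) (a $ 3) (a $ 4) t"
    and den: "snd (slice_fraction r) (a, t) \<noteq> 0"
  shows "slice_volume (a, t) = fst (slice_fraction r) (a, t) / snd (slice_fraction r) (a, t)"
proof -
  obtain c1 c2 c3 c4 \<theta> where c: "r = (c1, c2, c3, c4, \<theta>)" by (metis prod_cases5)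
  have pos: "a $ i > 0" if "a $ i \<noteq> 0" for i
    using nn[of i] that by simp
  consider "c4 \<noteq> 0" | "c4 = 0" "c3 \<noteq> 0" | "c4 = 0" "c3 = 0" "c2 \<noteq> 0" | "r = (1, 0, 0,
    0, 0)"
    using r c unfolding references_def by auto
  then show ?thesis
  proof cases
    case 1
    have p: "a $ 1 > 0" "a $ 2 > 0" "a $ 3 > 0" "a $ 4 > 0"
      using den 1 pos by (auto simp: c slice_fraction_def)
    have "compatible (\<lambda>w1 w2 w3 w4. wins (c1, c2, c3, c4, \<theta>) w1 w2 w3 w4) (a $ 1) (a $ 2) (a
      $ 3) (a $ 4) t"
      using W 1 by (simp add: c wins_def)
    from slice_density_4[OF p this]
    show ?thesis
      using 1 p n t by (simp add: c slice_fraction_def slice_volume_eq_density field_simps)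
  next
    case 2
    have p: "a $ 1 > 0" "a $ 2 > 0" "a $ 3 > 0"
      using den 2 pos by (auto simp: c slice_fraction_def)
    have "compatible (\<lambda>w1 w2 w3 w4. wins (c1, c2, c3, c4, \<theta>) w1 w2 w3 1) (a $ 1) (a $ 2) (a
      $ 3) (a $ 4) t"
      using W 2 by (simp add: c wins_def)
    from slice_density_3[OF p(1) p(2) p(3) nn this]
    show ?thesis
      using 2 p n t by (simp add: c slice_fraction_def slice_volume_eq_density field_simps)
  next
    case 3
    have p: "a $ 1 > 0" "a $ 2 > 0"
      using den 3 pos by (auto simp: c slice_fraction_def)
    have "compatible (\<lambda>w1 w2 w3 w4. wins (c1, c2, c3, c4, \<theta>) w1 w2 1 1) (a $ 1) (a $ 2) (a $
      3) (a $ 4) t"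
      using W 3 by (simp add: c wins_def)
    from slice_density_2[OF p(1) p(2) nn nn this]
    show ?thesis
      using 3 p n t by (simp add: c slice_fraction_def slice_volume_eq_density field_simps)
  next
    case 4
    have p: "a $ 1 > 0"
      using den 4 pos by (auto simp: slice_fraction_def)
    have "compatible (\<lambda>w1 w2 w3 w4. w1 > 0) (a $ 1) (a $ 2) (a $ 3) (a $ 4) t"
      using W 4 by (simp add: wins_def)
    from slice_density_1[OF p nn nn nn this]
    show ?thesis
      using 4 p n t by (simp add: slice_fraction_def slice_volume_eq_density field_simps)
  qed
qed

lemma slab_fraction_correct:
  assumes r: "r \<in> references" and n: "norm a = 1" and nn: "\<And>i. a $ i \<ge> 0" and t: "t \<ge> 0"
    and W: "compatible (wins r) (a $ 1) (a $ 2) (a $ 3) (a $ 4) t"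
    and den: "snd (slab_fraction r) (a, t) \<noteq> 0"
  shows "slab_volume (a, t) = fst (slab_fraction r) (a, t) / snd (slab_fraction r) (a, t)"
proof -
  obtain c1 c2 c3 c4 \<theta> where c: "r = (c1, c2, c3, c4, \<theta>)" by (metis prod_cases5)
  have pos: "a $ i > 0" if "a $ i \<noteq> 0" for i
    using nn[of i] that by simp
  consider "c4 \<noteq> 0" | "c4 = 0" "c3 \<noteq> 0" | "c4 = 0" "c3 = 0" "c2 \<noteq> 0" | "r = (1, 0, 0,
    0, 0)"
    using r c unfolding references_def by auto
  then show ?thesis
  proof cases
    case 1
    have p: "a $ 1 > 0" "a $ 2 > 0" "a $ 3 > 0" "a $ 4 > 0"
      using den 1 pos by (auto simp: c slab_fraction_def)
    have "compatible (\<lambda>w1 w2 w3 w4. wins (c1, c2, c3, c4, \<theta>) w1 w2 w3 w4) (a $ 1) (a $ 2) (a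
      $ 3) (a $ 4) t"
      using W 1 by (simp add: c wins_def)
    from tail_4[OF p this]
    show ?thesis
      using 1 p n t by (simp add: c slab_fraction_def slab_volume_eq_tail field_simps)
  next
    case 2
    have p: "a $ 1 > 0" "a $ 2 > 0" "a $ 3 > 0"
      using den 2 pos by (auto simp: c slab_fraction_def)
    have "compatible (\<lambda>w1 w2 w3 w4. wins (c1, c2, c3, c4, \<theta>) w1 w2 w3 1) (a $ 1) (a $ 2) (a
      $ 3) (a $ 4) t"
      using W 2 by (simp add: c wins_def)
    from tail_3[OF p(1) p(2) p(3) nn this]
    show ?thesis
      using 2 p n t by (simp add: c slab_fraction_def slab_volume_eq_tail field_simps)
  next
    case 3
    have p: "a $ 1 > 0" "a $ 2 > 0"
      using den 3 pos by (auto simp: c slab_fraction_def)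
    have "compatible (\<lambda>w1 w2 w3 w4. wins (c1, c2, c3, c4, \<theta>) w1 w2 1 1) (a $ 1) (a $ 2) (a $
      3) (a $ 4) t"
      using W 3 by (simp add: c wins_def)
    from tail_2[OF p(1) p(2) nn nn this]
    show ?thesis
      using 3 p n t by (simp add: c slab_fraction_def slab_volume_eq_tail field_simps)
  next
    case 4
    have p: "a $ 1 > 0"
      using den 4 pos by (auto simp: slab_fraction_def)
    have "compatible (\<lambda>w1 w2 w3 w4. w1 > 0) (a $ 1) (a $ 2) (a $ 3) (a $ 4) t"
      using W 4 by (simp add: wins_def)
    from tail_1[OF p nn nn nn this]
    show ?thesis
      using 4 p n t by (simp add: slab_fraction_def slab_volume_eq_tail field_simps)
  qed
qed

text \<open>Ties \<open>w \<bullet> a = t\<close> are broken by the first sign, which is what remains true when \<open>(a, t)\<close> is moved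
  into a chamber by a perturbation that is dominated by an increase of \<open>a $ 1\<close>.\<close>

definition matches :: "real \<times> real \<times> real \<times> real \<times> real \<Rightarrow> real^4
  \<Rightarrow> real \<Rightarrow> bool" where
  "matches r a t \<longleftrightarrow> (\<forall>w1\<in>{1, - 1}. \<forall>w2\<in>{1, - 1}.
    \<forall>w3\<in>{1, - 1}. \<forall>w4\<in>{1, - 1}.
    wins r w1 w2 w3 w4 \<longleftrightarrow> (if w1 = 1 then t \<le> w1 * a $ 1 + w2 * a $ 2 + w3 * a $ 3 +
      w4 * a $ 4 else t < w1 * a $ 1 + w2 * a $ 2 + w3 * a $ 3 + w4 * a $ 4))"

definition supports :: "real^4 \<Rightarrow> real \<times> real \<times> real \<times> real \<times> real
  \<Rightarrow> bool" where
  "supports a = (\<lambda>(c1, c2, c3, c4, \<theta>). (c1 \<noteq> 0 \<longrightarrow> a $ 1 > 0) \<and>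
    (c2 \<noteq> 0 \<longrightarrow> a $ 2 > 0) \<and>
    (c3 \<noteq> 0 \<longrightarrow> a $ 3 > 0) \<and> (c4 \<noteq> 0 \<longrightarrow> a $ 4 > 0))"

lemma supports_imp_denominator:
  assumes "r \<in> references" "supports a r"
  shows "snd (slice_fraction r) (a, t) \<noteq> 0" "snd (slab_fraction r) (a, t) \<noteq> 0"
  using assms unfolding references_def supports_def slice_fraction_def slab_fraction_def by auto

lemma nonzero_imp_denominator:
  assumes "\<And>i. a $ i \<noteq> 0"
  shows "snd (slice_fraction r) (a, t) \<noteq> 0" "snd (slab_fraction r) (a, t) \<noteq> 0"
  using assms unfolding slice_fraction_def slab_fraction_def by (auto split: prod.splits)

text \<open>For ordered \<open>a\<close> and \<open>0 \<le> t\<close>, the sign vector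
  \<open>(1, 1, 1, 1)\<close> always wins, and six vectors with first sign \<open>- 1\<close> have
  value at most 0 and never do. The other nine are tested by \<open>?A\<close> to \<open>?K\<close>;
  a test is strict exactly when the first sign is negative, as the tie rule demands.\<close>

lemma ex_matching_reference:
  assumes o: "ordered a" and pos: "a $ 1 > 0" and t: "0 \<le> t" "t \<le> a $ 1 + a $ 2 + a $ 3 + a $ 4"
  shows "\<exists>r\<in>references. matches r a t \<and> supports a r"
proof -
  have o': "a $ 1 \<ge> a $ 2" "a $ 2 \<ge> a $ 3" "a $ 3 \<ge> a $ 4" "a $ 4 \<ge> 0"
    using o by (auto simp: ordered_def)
  have m: "\<exists>r\<in>references. matches r a t \<and> supports a r" if "r \<in> references" "matches r
    a t" "supports a r" for r
    using that by blast
  note defs = matches_def wins_def supports_def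
  let ?A = "t \<le> a $ 1 + a $ 2 + a $ 3 - a $ 4"
  let ?B = "t \<le> a $ 1 + a $ 2 - a $ 3 + a $ 4"
  let ?C = "t \<le> a $ 1 - a $ 2 + a $ 3 + a $ 4"
  let ?D = "t < a $ 2 + a $ 3 + a $ 4 - a $ 1"
  let ?E = "t \<le> a $ 1 + a $ 2 - a $ 3 - a $ 4"
  let ?F = "t \<le> a $ 1 - a $ 2 + a $ 3 - a $ 4"
  let ?G = "t \<le> a $ 1 - a $ 2 - a $ 3 + a $ 4"
  let ?H = "t \<le> a $ 1 - a $ 2 - a $ 3 - a $ 4"
  let ?K = "t < a $ 2 + a $ 3 - a $ 1 - a $ 4"
  have l1: ?thesis if "\<not> ?A"
  proof (rule m[of "(1, 1, 1, 1, 3)"])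
    show "matches (1, 1, 1, 1, 3) a t"
      unfolding defs using that o' pos t by (simp; (intro conjI)?; linarith)
    show "supports a (1, 1, 1, 1, 3)"
      unfolding defs using that o' pos t by (simp; (intro conjI)?; linarith)
  qed (simp add: references_def)
  have l2: ?thesis if "?A" "\<not> ?B"
  proof (rule m[of "(1, 1, 1, 0, 2)"])
    show "matches (1, 1, 1, 0, 2) a t"
      unfolding defs using that o' pos t by (simp; (intro conjI)?; linarith)
    show "supports a (1, 1, 1, 0, 2)"
      unfolding defs using that o' pos t by (simp; (intro conjI)?; linarith)
  qed (simp add: references_def)
  have l3: ?thesis if "?B" "\<not> ?C" "\<not> ?E"
  proof (rule m[of "(2, 2, 1, 1, 3)"])
    show "matches (2, 2, 1, 1, 3) a t"
      unfolding defs using that o' pos t by (simp; (intro conjI)?; linarith)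
    show "supports a (2, 2, 1, 1, 3)"
      unfolding defs using that o' pos t by (simp; (intro conjI)?; linarith)
  qed (simp add: references_def)
  have l4: ?thesis if "?B" "\<not> ?C" "?E"
  proof (rule m[of "(1, 1, 0, 0, 1)"])
    show "matches (1, 1, 0, 0, 1) a t"
      unfolding defs using that o' pos t by (simp; (intro conjI)?; linarith)
    show "supports a (1, 1, 0, 0, 1)"
      unfolding defs using that o' pos t by (simp; (intro conjI)?; linarith)
  qed (simp add: references_def)
  have l5: ?thesis if "?C" "\<not> ?D" "\<not> ?E"
  proof (rule m[of "(2, 1, 1, 1, 2)"])
    show "matches (2, 1, 1, 1, 2) a t"
      unfolding defs using that o' pos t by (simp; (intro conjI)?; linarith)
    show "supports a (2, 1, 1, 1, 2)"
      unfolding defs using that o' pos t by (simp; (intro conjI)?; linarith)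
  qed (simp add: references_def)
  have l6: ?thesis if "?C" "?D" "\<not> ?E"
  proof (rule m[of "(1, 1, 1, 1, 1)"])
    show "matches (1, 1, 1, 1, 1) a t"
      unfolding defs using that o' pos t by (simp; (intro conjI)?; linarith)
    show "supports a (1, 1, 1, 1, 1)"
      unfolding defs using that o' pos t by (simp; (intro conjI)?; linarith)
  qed (simp add: references_def)
  have l7: ?thesis if "?C" "\<not> ?D" "?E" "\<not> ?F"
  proof (rule m[of "(3, 2, 1, 1, 2)"])
    show "matches (3, 2, 1, 1, 2) a t"
      unfolding defs using that o' pos t by (simp; (intro conjI)?; linarith)
    show "supports a (3, 2, 1, 1, 2)"
      unfolding defs using that o' pos t by (simp; (intro conjI)?; linarith)
  qed (simp add: references_def)
  have l8: ?thesis if "?C" "?D" "?E" "\<not> ?F"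
  proof (rule m[of "(2, 2, 1, 1, 1)"])
    show "matches (2, 2, 1, 1, 1) a t"
      unfolding defs using that o' pos t by (simp; (intro conjI)?; linarith)
    show "supports a (2, 2, 1, 1, 1)"
      unfolding defs using that o' pos t by (simp; (intro conjI)?; linarith)
  qed (simp add: references_def)
  have l9: ?thesis if "?C" "\<not> ?D" "?F" "\<not> ?G"
  proof (rule m[of "(2, 1, 1, 0, 1)"])
    show "matches (2, 1, 1, 0, 1) a t"
      unfolding defs using that o' pos t by (simp; (intro conjI)?; linarith)
    show "supports a (2, 1, 1, 0, 1)"
      unfolding defs using that o' pos t by (simp; (intro conjI)?; linarith)
  qed (simp add: references_def)
  have l10: ?thesis if "?C" "?D" "?F" "\<not> ?G" "\<not> ?K"
  proof (rule m[of "(3, 2, 2, 1, 1)"])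
    show "matches (3, 2, 2, 1, 1) a t"
      unfolding defs using that o' pos t by (simp; (intro conjI)?; linarith)
    show "supports a (3, 2, 2, 1, 1)"
      unfolding defs using that o' pos t by (simp; (intro conjI)?; linarith)
  qed (simp add: references_def)
  have l11: ?thesis if "?D" "?F" "?K"
  proof (rule m[of "(1, 1, 1, 0, 0)"])
    show "matches (1, 1, 1, 0, 0) a t"
      unfolding defs using that o' pos t by (simp; (intro conjI)?; linarith)
    show "supports a (1, 1, 1, 0, 0)"
      unfolding defs using that o' pos t by (simp; (intro conjI)?; linarith)
  qed (simp add: references_def)
  have l12: ?thesis if "?C" "\<not> ?D" "?G" "\<not> ?H"
  proof (rule m[of "(3, 1, 1, 1, 1)"])
    show "matches (3, 1, 1, 1, 1) a t"
      unfolding defs using that o' pos t by (simp; (intro conjI)?; linarith)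
    show "supports a (3, 1, 1, 1, 1)"
      unfolding defs using that o' pos t by (simp; (intro conjI)?; linarith)
  qed (simp add: references_def)
  have l13: ?thesis if "?D" "?G"
  proof (rule m[of "(2, 1, 1, 1, 0)"])
    show "matches (2, 1, 1, 1, 0) a t"
      unfolding defs using that o' pos t by (simp; (intro conjI)?; linarith)
    show "supports a (2, 1, 1, 1, 0)"
      unfolding defs using that o' pos t by (simp; (intro conjI)?; linarith)
  qed (simp add: references_def)
  have l14: ?thesis if "\<not> ?D" "?H"
  proof (rule m[of "(1, 0, 0, 0, 0)"])
    show "matches (1, 0, 0, 0, 0) a t"
      unfolding defs using that o' pos t by (simp; (intro conjI)?; linarith)
    show "supports a (1, 0, 0, 0, 0)"
      unfolding defs using that o' pos t by (simp; (intro conjI)?; linarith)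
  qed (simp add: references_def)
  show ?thesis
    \<comment> \<open>Turning a minus into a plus, or moving a plus to an earlier coordinate, cannot
      decrease the value, so many tests imply others. Moreover \<open>?D\<close> excludes
      \<open>?H\<close> and \<open>?K\<close> excludes \<open>?G\<close>, these being pairs of
      opposite vectors. Fourteen combinations remain.\<close>
    using o' l1 l2 l3 l4 l5 l6 l7 l8 l9 l10 l11 l12 l13 l14 by argo
qed

section \<open>Distinctness\<close>

lemma signed_permutation_vertices:
  assumes "signed_permutation g"
  shows "bij_betw g vertices vertices"
proof -
  obtain \<pi> \<epsilon> where \<pi>: "\<pi> permutes UNIV" and \<epsilon>: "\<And>i. \<epsilon> i \<in>
    {1, - 1 :: real}"
    and g: "g = (\<lambda>a. \<chi> i. \<epsilon> i * a $ \<pi> i)"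
    using assms by (auto simp: signed_permutation_def)
  have h: "r = - 1/2 \<or> r = 1/2 \<longleftrightarrow> \<bar>r\<bar> = 1/2" for r :: real by auto
  have v: "v \<in> vertices \<longleftrightarrow> (\<forall>i. \<bar>v $ i\<bar> = 1/2)" for v
    unfolding vertices_def h by simp
  have "\<bar>\<epsilon> i\<bar> = 1" for i using \<epsilon>[of i] by auto
  then have "g x \<in> vertices \<longleftrightarrow> (\<forall>i. \<bar>x $ \<pi> i\<bar> = 1/2)" for x
    by (simp add: v g abs_mult)
  then have m: "g x \<in> vertices \<longleftrightarrow> x \<in> vertices" for x
    using permutes_surj[OF \<pi>] unfolding v by (metis surjD)
  have "inj g" "surj g"
    using signed_permutation_orthogonal[OF assms] orthogonal_transformation_inj
      orthogonal_transformation_surj by auto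
  then show ?thesis
    unfolding bij_betw_def using m by (auto simp: inj_on_def) (metis image_eqI surjD)
qed

lemma sum_vertices:
  "(\<Sum>v\<in>vertices. F v) = (\<Sum>w1\<in>{1, - 1}. \<Sum>w2\<in>{1, - 1}. \<Sum>w3\<in>{1, - 1}.
    \<Sum>w4\<in>{1, - 1}.
    F (vector [w1 / 2, w2 / 2, w3 / 2, w4 / 2]))" for F :: "real^4 \<Rightarrow> real"
proof -
  let ?S = "{1, - 1 :: real}"
  define h where "h = (\<lambda>(w1, w2, w3, w4). vector [w1 / 2, w2 / 2, w3 / 2, w4 / 2] :: real^4)"
  have h: "h (w1, w2, w3, w4) = vector [w1 / 2, w2 / 2, w3 / 2, w4 / 2]" for w1 w2 w3 w4
    by (simp add: h_def)
  have eq: "h (2 * v $ 1, 2 * v $ 2, 2 * v $ 3, 2 * v $ 4) = v" for v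
    by (simp add: h vec_eq_iff forall_4)
  have inv: "2 * h p $ 1 = fst p" "2 * h p $ 2 = fst (snd p)" "2 * h p $ 3 = fst (snd (snd p))"
    "2 * h p $ 4 = snd (snd (snd p))" for p
    by (simp_all add: h_def split_def)
  have "bij_betw h (?S \<times> ?S \<times> ?S \<times> ?S) vertices"
  proof (rule bij_betw_byWitness[where f' = "\<lambda>v. (2 * v $ 1, 2 * v $ 2, 2 * v $ 3, 2 * v $ 4)"])
    show "h ` (?S \<times> ?S \<times> ?S \<times> ?S) \<subseteq> vertices"
      unfolding vertices_def forall_4 by (auto simp: h)
    have m: "2 * v $ i \<in> ?S" if "v \<in> vertices" for v :: "real^4" and i
      using that unfolding vertices_def by (auto dest!: spec[of _ i])
    show "(\<lambda>v. (2 * v $ 1, 2 * v $ 2, 2 * v $ 3, 2 * v $ 4)) ` vertices \<subseteq> ?S \<times> ?S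
      \<times> ?S \<times> ?S"
      by (rule image_subsetI) (simp only: mem_Sigma_iff m simp_thms)
  qed (simp_all only: inv eq prod.collapse ball_simps Ball_def simp_thms)
  then have "(\<Sum>v\<in>vertices. F v) = (\<Sum>p\<in>?S \<times> ?S \<times> ?S \<times> ?S. F (h p))"
    by (rule sum.reindex_bij_betw[symmetric])
  also have "\<dots> = (\<Sum>w1\<in>?S. \<Sum>w2\<in>?S. \<Sum>w3\<in>?S. \<Sum>w4\<in>?S. F (vector [w1 /
    2, w2 / 2, w3 / 2, w4 / 2]))"
    by (simp only: sum.cartesian_product' h)
  finally show ?thesis .
qed

text \<open>Special to dimension four: \<open>4 * (1/2)\<^sup>2 = 1\<close>, so the vertices lie on
  the very sphere on which \<open>same_rational\<close> compares fractions.\<close>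

lemma norm_vertex: "v \<in> vertices \<Longrightarrow> norm v = 1"
proof -
  assume "v \<in> vertices"
  then have "v $ i = - 1/2 \<or> v $ i = 1/2" for i
    unfolding vertices_def by blast
  then have "(v $ i)\<^sup>2 = 1/4" for i
  proof -
    have "v $ i = - 1/2 \<Longrightarrow> ?thesis" "v $ i = 1/2 \<Longrightarrow> ?thesis"
      by (simp_all only: power2_eq_square)
    then show ?thesis using \<open>\<And>i. v $ i = - 1/2 \<or> v $ i = 1/2\<close> by blast
  qed
  from this[of 1] this[of 2] this[of 3] this[of 4] show "norm v = 1"
    unfolding norm_1_iff_4 by linarith
qed

lemma vertex_nonzero: "v \<in> vertices \<Longrightarrow> v $ i \<noteq> 0"
  unfolding vertices_def by (auto dest!: spec[of _ i])

text \<open>The points \<open>(v, t)\<close> with \<open>v\<close> a vertex are permuted by the signed permutations. Fourth powers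
  are the smallest ones separating the fourteen types.\<close>

definition vertex_moment :: "real \<Rightarrow> fraction \<Rightarrow> real" where
  "vertex_moment t r = (\<Sum>v\<in>vertices. (fst r (v, t) / snd r (v, t)) ^ 4)"

text \<open>At a vertex the cross-multiplied identity can be divided by the denominators; the sum
  over all vertices then absorbs \<open>g\<close>, which permutes them.\<close>

lemma same_rational_imp_vertex_moment_eq:
  assumes g: "signed_permutation g" and same: "same_rational (substitute g r) s"
    and den: "\<And>v. v \<in> vertices \<Longrightarrow> snd r (v, t) \<noteq> 0" "\<And>v. v \<in>
      vertices \<Longrightarrow> snd s (v, t) \<noteq> 0"
  shows "vertex_moment t r = vertex_moment t s"
proof -
  have "vertex_moment t r = (\<Sum>v\<in>vertices. (fst r (g v, t) / snd r (g v, t)) ^ 4)"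
    unfolding vertex_moment_def
    by (rule sum.reindex_bij_betw[OF signed_permutation_vertices[OF g], symmetric])
  also have "\<dots> = vertex_moment t s"
    unfolding vertex_moment_def
  proof (rule sum.cong)
    fix v assume v: "v \<in> vertices"
    then have "g v \<in> vertices"
      using bij_betwE[OF signed_permutation_vertices[OF g]] by blast
    moreover have "fst r (g v, t) * snd s (v, t) = fst s (v, t) * snd r (g v, t)"
      using same norm_vertex[OF v] by (auto simp: same_rational_def substitute_def)
    ultimately have "fst r (g v, t) / snd r (g v, t) = fst s (v, t) / snd s (v, t)"
      using den v by (simp add: frac_eq_eq)
    then show "(fst r (g v, t) / snd r (g v, t)) ^ 4 = (fst s (v, t) / snd s (v, t)) ^ 4" by simp
  qed simp
  finally show ?thesis .
qed

lemma vertex_moment_slice_fraction: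
  "vertex_moment 0 (slice_fraction (1, 0, 0, 0, 0)) = 256"
  "vertex_moment 0 (slice_fraction (1, 1, 0, 0, 1)) = 128"
  "vertex_moment 0 (slice_fraction (1, 1, 1, 0, 2)) = 9616 / 81"
  "vertex_moment 0 (slice_fraction (2, 1, 1, 0, 1)) = 21712 / 81"
  "vertex_moment 0 (slice_fraction (1, 1, 1, 0, 0)) = 50176 / 81"
  "vertex_moment 0 (slice_fraction (1, 1, 1, 1, 3)) = 8200 / 81"
  "vertex_moment 0 (slice_fraction (2, 2, 1, 1, 3)) = 12232 / 81"
  "vertex_moment 0 (slice_fraction (2, 1, 1, 1, 2)) = 15664 / 81"
  "vertex_moment 0 (slice_fraction (1, 1, 1, 1, 1)) = 19720 / 81"
  "vertex_moment 0 (slice_fraction (3, 2, 1, 1, 2)) = 19432 / 81"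
  "vertex_moment 0 (slice_fraction (2, 2, 1, 1, 1)) = 30272 / 81"
  "vertex_moment 0 (slice_fraction (3, 2, 2, 1, 1)) = 13624 / 27"
  "vertex_moment 0 (slice_fraction (3, 1, 1, 1, 1)) = 23464 / 81"
  "vertex_moment 0 (slice_fraction (2, 1, 1, 1, 0)) = 52864 / 81"
  unfolding vertex_moment_def sum_vertices slice_fraction_def wins_def signed_diff_def
  by (simp_all add: power_divide)

lemma slice_fraction_not_same_rational:
  assumes "r \<in> references" "s \<in> references" "r \<noteq> s" "signed_permutation g"
  shows "\<not> same_rational (substitute g (slice_fraction r)) (slice_fraction s)"
proof
  assume "same_rational (substitute g (slice_fraction r)) (slice_fraction s)"
  then have "vertex_moment 0 (slice_fraction r) = vertex_moment 0 (slice_fraction s)"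
    by (rule same_rational_imp_vertex_moment_eq[OF assms(4)])
      (rule nonzero_imp_denominator, erule vertex_nonzero)+
  moreover have "inj_on (\<lambda>r. vertex_moment 0 (slice_fraction r)) references"
    unfolding references_def by (simp add: vertex_moment_slice_fraction)
  ultimately show False using assms(1-3) by (auto dest: inj_onD)
qed

text \<open>Here \<open>t = 1\<close> is used: at \<open>t = 0\<close> the numerators of the three
  types with \<open>\<theta> = 0\<close> vanish on the sphere, because chambers of these types reach
  down to slabs of width zero. Their moments would coincide.\<close>

lemma vertex_moment_slab_fraction:
  "vertex_moment 1 (slab_fraction (1, 0, 0, 0, 0)) = 256"
  "vertex_moment 1 (slab_fraction (1, 1, 0, 0, 1)) = 47017 / 81"
  "vertex_moment 1 (slab_fraction (1, 1, 1, 0, 2)) = 1192921 / 1296"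
  "vertex_moment 1 (slab_fraction (2, 1, 1, 0, 1)) = 1113865 / 1296"
  "vertex_moment 1 (slab_fraction (1, 1, 1, 0, 0)) = 120064 / 81"
  "vertex_moment 1 (slab_fraction (1, 1, 1, 1, 3)) = 3163897 / 2592"
  "vertex_moment 1 (slab_fraction (2, 2, 1, 1, 3)) = 3176009 / 2592"
  "vertex_moment 1 (slab_fraction (2, 1, 1, 1, 2)) = 2495537 / 1296"
  "vertex_moment 1 (slab_fraction (1, 1, 1, 1, 1)) = 7485305 / 2592"
  "vertex_moment 1 (slab_fraction (3, 2, 1, 1, 2)) = 3110777 / 2592"
  "vertex_moment 1 (slab_fraction (2, 2, 1, 1, 1)) = 336841 / 162"
  "vertex_moment 1 (slab_fraction (3, 2, 2, 1, 1)) = 4306601 / 2592"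
  "vertex_moment 1 (slab_fraction (3, 1, 1, 1, 1)) = 2746153 / 2592"
  "vertex_moment 1 (slab_fraction (2, 1, 1, 1, 0)) = 144640 / 81"
  unfolding vertex_moment_def sum_vertices slab_fraction_def wins_def signed_diff_def
  by (simp_all add: power_divide)

lemma slab_fraction_not_same_rational:
  assumes "r \<in> references" "s \<in> references" "r \<noteq> s" "signed_permutation g"
  shows "\<not> same_rational (substitute g (slab_fraction r)) (slab_fraction s)"
proof
  assume "same_rational (substitute g (slab_fraction r)) (slab_fraction s)"
  then have "vertex_moment 1 (slab_fraction r) = vertex_moment 1 (slab_fraction s)"
    by (rule same_rational_imp_vertex_moment_eq[OF assms(4)])
      (rule nonzero_imp_denominator, erule vertex_nonzero)+
  moreover have "inj_on (\<lambda>r. vertex_moment 1 (slab_fraction r)) references"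
    unfolding references_def by (simp add: vertex_moment_slab_fraction)
  ultimately show False using assms(1-3) by (auto dest: inj_onD)
qed

lemma signed_permutation_id: "signed_permutation (\<lambda>a. a)"
  unfolding signed_permutation_def by (rule exI[of _ id], rule exI[of _ "\<lambda>i. 1"]) (auto simp:
    vec_eq_iff)

lemma substitute_id: "substitute (\<lambda>a. a) r = r"
  by (simp add: substitute_def)

lemma card_references: "card references = 14"
  unfolding references_def by simp

text \<open>Distinctness up to signed permutations, applied to the identity, makes both maps
  injective on \<open>references\<close>, since equal fractions are trivially
  \<open>same_rational\<close>.\<close>

lemma card_fractions:
  "card (slice_fraction ` references) = 14" "card (slab_fraction ` references) = 14"
proof -
  have "inj_on slice_fraction references" "inj_on slab_fraction references"
    using slice_fraction_not_same_rational[OF _ _ _ signed_permutation_id]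
      slab_fraction_not_same_rational[OF _ _ _ signed_permutation_id]
    unfolding inj_on_def substitute_id same_rational_def by metis+
  then show "card (slice_fraction ` references) = 14" "card (slab_fraction ` references) = 14"
    by (simp_all add: card_image card_references)
qed

section \<open>Chambers\<close>

lemma finite_vertices: "finite vertices"
proof (rule ccontr)
  assume "infinite vertices"
  \<comment> \<open>A sum over an infinite set is 0 by convention, whereas the reindexed sum has the
    value 16.\<close>
  moreover have "(\<Sum>v\<in>vertices. 1 :: real) = 16" by (subst sum_vertices) simp
  ultimately show False by simp
qed

lemma uminus_vertex: "v \<in> vertices \<Longrightarrow> - v \<in> vertices"
proof -
  assume v: "v \<in> vertices"
  have "- r = - 1/2 \<or> - r = 1/2" if "r = - 1/2 \<or> r = 1/2" for r :: real using that by auto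
  with v show ?thesis by (simp add: vertices_def)
qed

lemma inner_diff_left_commute: "(v - w) \<bullet> a = a \<bullet> v - a \<bullet> w" for a :: "'a::real_inner"
  by (simp add: inner_commute inner_diff_right)

definition generic :: "real^4 \<Rightarrow> bool" where
  "generic a \<longleftrightarrow> (\<forall>v\<in>vertices. \<forall>w\<in>vertices. v \<noteq> w
    \<longrightarrow> a \<bullet> v \<noteq> a \<bullet> w)"

lemma regions_eq: "regions = components {a. norm a = 1 \<and> generic a}"
proof -
  have "sphere 0 1 - (\<Union>v\<in>vertices. \<Union>w\<in>vertices - {v}. {a. (v - w) \<bullet> a = 0}) =
    {a. norm a = 1 \<and> generic a}"
    by (auto simp: generic_def inner_diff_left_commute)
  then show ?thesis by (simp add: regions_def)
qed

lemma region_generic: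
  assumes "R \<in> regions" "a \<in> R"
  shows "norm a = 1" "generic a"
  using in_components_subset[of R] assms unfolding regions_eq by auto

text \<open>If the order of two vertices changed within the connected region, the linear functional
  given by their difference would vanish at some point of it, on a hyperplane of the
  arrangement.\<close>

lemma region_same_order:
  assumes R: "R \<in> regions" and a: "a \<in> R" and b: "b \<in> R"
    and v: "v \<in> vertices" "w \<in> vertices" and less: "a \<bullet> v < a \<bullet> w"
  shows "b \<bullet> v < b \<bullet> w"
proof (rule ccontr)
  assume "\<not> b \<bullet> v < b \<bullet> w"
  then have "(w - v) \<bullet> b \<le> 0" "0 \<le> (w - v) \<bullet> a"
    using less by (simp_all add: inner_diff_left_commute)
  moreover have "connected R"
    using R in_components_connected unfolding regions_eq by blast
  ultimately obtain z where "z \<in> R" "(w - v) \<bullet> z = 0"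
    using connected_ivt_hyperplane[of R b a "w - v" 0] a b by auto
  then have "z \<bullet> v = z \<bullet> w" by (simp add: inner_diff_left_commute)
  then have "v = w" using region_generic(2)[OF R \<open>z \<in> R\<close>] v by (auto simp: generic_def)
  then show False using less by simp
qed

text \<open>The sign of \<open>a \<bullet> v\<close> is the comparison of the two vertices
  \<open>- v\<close> and \<open>v\<close>.\<close>

lemma region_same_positive:
  assumes R: "R \<in> regions" and a: "a \<in> R" and b: "b \<in> R" and v: "v \<in> vertices" and less: "0
    < a \<bullet> v"
  shows "0 < b \<bullet> v"
  using region_same_order[OF R a b uminus_vertex[OF v] v] less by simp

lemma mem_downward_closed_iff_less_card:
  fixes K :: "nat set"
  assumes "finite K" "\<And>k l. k \<in> K \<Longrightarrow> l < k \<Longrightarrow> l \<in> K"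
  shows "k \<in> K \<longleftrightarrow> k < card K"
proof
  assume "k \<in> K"
  then have "{..k} \<subseteq> K" using assms(2) by (auto simp: le_less)
  then have "card {..k} \<le> card K" by (rule card_mono[OF assms(1)])
  then show "k < card K" by simp
next
  assume "k < card K"
  show "k \<in> K"
  proof (rule ccontr)
    assume "k \<notin> K"
    then have "K \<subseteq> {..<k}" using assms(2) by (metis lessThan_iff linorder_neqE_nat subsetI)
    then have "card K \<le> card {..<k}" by (rule card_mono[rotated]) simp
    then show False using \<open>k < card K\<close> by simp
  qed
qed

text \<open>The positions of the entries below \<open>s\<close> form an initial segment of the list,
  so membership of a position is decided by counting.\<close>

lemma sorted_list_of_set_nth_less_iff:
  fixes S :: "'a::linorder set"
  assumes "finite S" "k < card S"
  shows "sorted_list_of_set S ! k < s \<longleftrightarrow> k < card {y\<in>S. y < s}"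
proof -
  let ?xs = "sorted_list_of_set S"
  let ?K = "{k. k < length ?xs \<and> ?xs ! k < s}"
  have "bij_betw ((!) ?xs) ?K {y\<in>S. y < s}"
    unfolding bij_betw_def
  proof
    show "inj_on ((!) ?xs) ?K"
      using nth_eq_iff_index_eq[OF distinct_sorted_list_of_set] by (auto simp: inj_on_def)
    show "(!) ?xs ` ?K = {y\<in>S. y < s}"
    proof (intro set_eqI iffI)
      fix y assume "y \<in> {y\<in>S. y < s}"
      then have "y \<in> set ?xs" "y < s" using assms by auto
      then show "y \<in> (!) ?xs ` ?K" by (auto simp: in_set_conv_nth)
    next
      fix y assume "y \<in> (!) ?xs ` ?K"
      then have "y \<in> set ?xs" "y < s" by auto
      then show "y \<in> {y\<in>S. y < s}" using assms by simp
    qed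
  qed
  then have "card ?K = card {y\<in>S. y < s}" by (rule bij_betw_same_card)
  moreover have "k \<in> ?K \<longleftrightarrow> k < card ?K"
  proof (rule mem_downward_closed_iff_less_card)
    show "l \<in> ?K" if "k \<in> ?K" "l < k" for k l
      using that sorted_nth_mono[OF sorted_sorted_list_of_set, of l k S] by auto
  qed simp
  ultimately show ?thesis using assms by simp
qed

text \<open>Replaces the index \<open>j\<close> of a chamber. In \<open>chamber R j\<close> exactly
  \<open>Suc j\<close> sweep values lie below \<open>t / 2\<close>; one of them is the added 0, and
  the other \<open>j\<close> belong to distinct vertices because \<open>a\<close> is
  generic.\<close>

definition lower_vertices :: "real^4 \<Rightarrow> real \<Rightarrow> (real^4) set" where
  "lower_vertices a t = {v \<in> vertices. 0 < a \<bullet> v \<and> a \<bullet> v < t / 2}"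

definition sweep_set :: "real^4 \<Rightarrow> real set" where
  "sweep_set a = insert 0 {a \<bullet> v | v. v \<in> vertices \<and> a \<bullet> v > 0}"

lemma mem_sweep_set: "y \<in> sweep_set a \<longleftrightarrow> y = 0 \<or> (\<exists>v\<in>vertices. y = a
  \<bullet> v \<and> 0 < y)"
  by (auto simp: sweep_set_def)

lemma finite_sweep_set: "finite (sweep_set a)"
proof -
  have "{a \<bullet> v | v. v \<in> vertices \<and> a \<bullet> v > 0} \<subseteq> (\<bullet>) a `
    vertices" by auto
  then show ?thesis unfolding sweep_set_def using finite_vertices finite_subset by blast
qed

lemma card_sweep_set_less:
  assumes "generic a" "t > 0"
  shows "card {y \<in> sweep_set a. y < t / 2} = Suc (card (lower_vertices a t))"
proof -
  have "{y \<in> sweep_set a. y < t / 2} = insert 0 ((\<bullet>) a ` lower_vertices a t)"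
    using assms by (auto simp: lower_vertices_def mem_sweep_set)
  moreover have "inj_on ((\<bullet>) a) (lower_vertices a t)"
    using assms by (auto simp: inj_on_def generic_def lower_vertices_def)
  moreover have "0 \<notin> (\<bullet>) a ` lower_vertices a t" by (auto simp: lower_vertices_def)
  moreover have "finite (lower_vertices a t)" using finite_vertices by (simp add: lower_vertices_def)
  ultimately show ?thesis by (simp add: card_image)
qed

text \<open>Together with \<open>chamberI\<close> this eliminates the sorted list: a chamber point
  is described by \<open>t > 0\<close>, no vertex on the hyperplane, some vertex beyond it, and the
  number of vertices strictly between level 0 and the hyperplane.\<close>

lemma chamberD:
  assumes R: "R \<in> regions" and c: "(a, t) \<in> chamber R j"
  shows "a \<in> R" "t > 0" "\<And>v. v \<in> vertices \<Longrightarrow> a \<bullet> v \<noteq> t / 2"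
    "card (lower_vertices a t) = j"
    "\<exists>v\<in>vertices. t / 2 < a \<bullet> v"
proof -
  let ?S = "sweep_set a"
  have fin: "finite ?S" by (rule finite_sweep_set)
  have c': "a \<in> R" "Suc j < card ?S" "sorted_list_of_set ?S ! j < t / 2" "t / 2 < sorted_list_of_set ?S
    ! Suc j"
    using c by (auto simp: chamber_def sweep_values_def sweep_set_def)
  show "a \<in> R" by fact
  have mem: "sorted_list_of_set ?S ! k \<in> ?S" if "k < card ?S" for k
    using nth_mem[of k "sorted_list_of_set ?S"] that fin by simp
  show t: "t > 0"
    using mem[of j] c' by (auto simp: mem_sweep_set)
  show "\<exists>v\<in>vertices. t / 2 < a \<bullet> v"
    using mem[of "Suc j"] c' t by (auto simp: mem_sweep_set)
  show "a \<bullet> v \<noteq> t / 2" if v: "v \<in> vertices" for v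
  proof
    assume e: "a \<bullet> v = t / 2"
    then have "t / 2 \<in> ?S" using v t by (auto simp: mem_sweep_set)
    then have "t / 2 \<in> set (sorted_list_of_set ?S)" using fin by simp
    then obtain k where k: "k < card ?S" "sorted_list_of_set ?S ! k = t / 2"
      by (auto simp: in_set_conv_nth)
    show False
    proof (cases "k \<le> j")
      case True
      then show False
        using sorted_nth_mono[OF sorted_sorted_list_of_set, of k j ?S] c' k by simp
    next
      case False
      then show False
        using sorted_nth_mono[OF sorted_sorted_list_of_set, of "Suc j" k ?S] c' k by simp
    qed
  qed
  have "j < card {y \<in> ?S. y < t / 2}" "\<not> Suc j < card {y \<in> ?S. y < t / 2}"
    using c' sorted_list_of_set_nth_less_iff[OF fin, of j "t / 2"]
      sorted_list_of_set_nth_less_iff[OF fin, of "Suc j" "t / 2"] by auto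
  then show "card (lower_vertices a t) = j"
    using card_sweep_set_less[OF region_generic(2)[OF R \<open>a \<in> R\<close>] t] by simp
qed

lemma chamberI:
  assumes R: "R \<in> regions" and a: "a \<in> R" and t: "t > 0" and ne: "\<And>v. v \<in> vertices
    \<Longrightarrow> a \<bullet> v \<noteq> t / 2"
    and ex: "\<exists>v\<in>vertices. t / 2 < a \<bullet> v"
  shows "(a, t) \<in> chamber R (card (lower_vertices a t))"
proof -
  let ?S = "sweep_set a" and ?j = "card (lower_vertices a t)"
  have fin: "finite ?S" by (rule finite_sweep_set)
  have c: "card {y \<in> ?S. y < t / 2} = Suc ?j"
    by (rule card_sweep_set_less[OF region_generic(2)[OF R a] t])
  obtain v where v: "v \<in> vertices" "t / 2 < a \<bullet> v" using ex by auto
  then have "a \<bullet> v \<in> ?S - {y \<in> ?S. y < t / 2}" using t by (auto simp: mem_sweep_set)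
  then have "{y \<in> ?S. y < t / 2} \<subset> ?S" by blast
  then have len: "Suc ?j < card ?S" using psubset_card_mono[OF fin] c by metis
  then have "sorted_list_of_set ?S ! Suc ?j \<in> ?S"
    using nth_mem[of "Suc ?j" "sorted_list_of_set ?S"] fin by simp
  then have "sorted_list_of_set ?S ! Suc ?j \<noteq> t / 2" using ne t by (auto simp: mem_sweep_set)
  then show ?thesis
    using len a c sorted_list_of_set_nth_less_iff[OF fin, of ?j "t / 2"]
      sorted_list_of_set_nth_less_iff[OF fin, of "Suc ?j" "t / 2"]
    by (auto simp: chamber_def sweep_values_def sweep_set_def)
qed

text \<open>Throughout a region the positive vertex values keep their order, so the lower vertices
  at two of its points form initial segments of one chain. Having the same number \<open>j\<close>
  of elements, they are equal.\<close>

lemma chamber_same_side: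
  assumes R: "R \<in> regions" and a: "(a, t) \<in> chamber R j" and b: "(b, s) \<in> chamber R j"
    and v: "v \<in> vertices"
  shows "t / 2 < a \<bullet> v \<longleftrightarrow> s / 2 < b \<bullet> v"
proof -
  note A = chamberD[OF R a] and B = chamberD[OF R b]
  have fin: "finite (lower_vertices a t)" for a t using finite_vertices by (simp add: lower_vertices_def)
  have sub: "lower_vertices a t \<subseteq> lower_vertices b s \<or> lower_vertices b s \<subseteq>
    lower_vertices a t"
  proof (rule ccontr)
    assume "\<not> ?thesis"
    then obtain u w where u: "u \<in> lower_vertices a t" "u \<notin> lower_vertices b s"
      and w: "w \<in> lower_vertices b s" "w \<notin> lower_vertices a t" by blast
    have w': "w \<in> vertices" "0 < b \<bullet> w" "b \<bullet> w < s / 2" using w by (auto simp: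
      lower_vertices_def)
    have u': "u \<in> vertices" "0 < a \<bullet> u" "a \<bullet> u < t / 2" using u by (auto simp:
      lower_vertices_def)
    have "0 < a \<bullet> w" by (rule region_same_positive[OF R B(1) A(1) w'(1,2)])
    then have "a \<bullet> u < a \<bullet> w" using w w' u' by (auto simp: lower_vertices_def)
    then have "b \<bullet> u < b \<bullet> w" by (rule region_same_order[OF R A(1) B(1) u'(1) w'(1)])
    moreover have "0 < b \<bullet> u" by (rule region_same_positive[OF R A(1) B(1) u'(1,2)])
    ultimately show False using u u' w' by (auto simp: lower_vertices_def)
  qed
  then have eq: "lower_vertices a t = lower_vertices b s"
    using card_subset_eq[OF fin] A(4) B(4) by metis
  have pos: "0 < a \<bullet> v \<longleftrightarrow> 0 < b \<bullet> v"
    using region_same_positive[OF R A(1) B(1) v] region_same_positive[OF R B(1) A(1) v] by blast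
  have "t / 2 < a \<bullet> v \<longleftrightarrow> 0 < a \<bullet> v \<and> v \<notin> lower_vertices a t"
    using A(2) A(3)[OF v] v by (auto simp: lower_vertices_def)
  also have "\<dots> \<longleftrightarrow> s / 2 < b \<bullet> v"
    unfolding pos eq using B(2) B(3)[OF v] v by (auto simp: lower_vertices_def)
  finally show ?thesis .
qed

section \<open>Signed permutations and the sector of ordered vectors\<close>

lemma signed_permutation_comp:
  assumes "signed_permutation g" "signed_permutation h"
  shows "signed_permutation (g \<circ> h)"
proof -
  obtain \<pi> \<epsilon> where g: "\<pi> permutes UNIV" "\<And>i. \<epsilon> i \<in> {1, - 1 :: real}" "g
    = (\<lambda>a. \<chi> i. \<epsilon> i * a $ \<pi> i)"
    using assms(1) by (auto simp: signed_permutation_def)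
  obtain \<rho> \<delta> where h: "\<rho> permutes UNIV" "\<And>i. \<delta> i \<in> {1, - 1 :: real}" "h =
    (\<lambda>a. \<chi> i. \<delta> i * a $ \<rho> i)"
    using assms(2) by (auto simp: signed_permutation_def)
  have "\<epsilon> i * \<delta> (\<pi> i) \<in> {1, - 1}" for i
    using g(2)[of i] h(2)[of "\<pi> i"] by auto
  moreover have "g \<circ> h = (\<lambda>a. \<chi> i. (\<epsilon> i * \<delta> (\<pi> i)) * a $ (\<rho>
    \<circ> \<pi>) i)"
    by (simp add: g h fun_eq_iff vec_eq_iff)
  ultimately show ?thesis
    unfolding signed_permutation_def using permutes_compose[OF g(1) h(1)]
    by (intro exI[of _ "\<rho> \<circ> \<pi>"] exI[of _ "\<lambda>i. \<epsilon> i * \<delta> (\<pi> i)"]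
      conjI allI)
qed

lemma ex_signed_permutation_max_min:
  fixes b :: "real^4"
  assumes "i \<noteq> j"
  shows "\<exists>g. signed_permutation g \<and> g b $ i = max (b $ i) (b $ j) \<and> g b $ j = min (b $ i)
    (b $ j) \<and>
    (\<forall>k. k \<noteq> i \<and> k \<noteq> j \<longrightarrow> g b $ k = b $ k)"
proof (cases "b $ j \<le> b $ i")
  case True
  then show ?thesis
    using signed_permutation_id by (intro exI[of _ "\<lambda>a. a"]) (auto simp: max_def min_def)
next
  case False
  let ?g = "\<lambda>a :: real^4. \<chi> k. 1 * a $ Transposition.transpose i j k"
  have "signed_permutation ?g"
    unfolding signed_permutation_def
    by (rule exI[of _ "Transposition.transpose i j"], rule exI[of _ "\<lambda>k. 1"]) (auto intro:
      permutes_swap_id)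
  then show ?thesis
    using False assms by (intro exI[of _ ?g]) (auto simp: max_def min_def Transposition.transpose_def)
qed

text \<open>After taking absolute values, the coordinates are sorted by a network of five comparators.\<close>

lemma ex_signed_permutation_ordered:
  fixes a :: "real^4"
  shows "\<exists>g. signed_permutation g \<and> ordered (g a)"
proof -
  let ?g0 = "\<lambda>x :: real^4. \<chi> i. (if a $ i < 0 then - 1 else 1) * x $ id i"
  have g0: "signed_permutation ?g0"
    unfolding signed_permutation_def
    by (rule exI[of _ id], rule exI[of _ "\<lambda>i. if a $ i < 0 then - 1 else 1"]) auto
  define b0 where "b0 = ?g0 a"
  have nn: "b0 $ i \<ge> 0" for i by (simp add: b0_def)
  obtain g1 where g1: "signed_permutation g1" "g1 b0 $ 1 = max (b0 $ 1) (b0 $ 2)" "g1 b0 $ 2 = min (b0 $ 1)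
    (b0 $ 2)"
    "g1 b0 $ 3 = b0 $ 3" "g1 b0 $ 4 = b0 $ 4"
    using ex_signed_permutation_max_min[of 1 2 b0] by auto
  define b1 where "b1 = g1 b0"
  obtain g2 where g2: "signed_permutation g2" "g2 b1 $ 3 = max (b1 $ 3) (b1 $ 4)" "g2 b1 $ 4 = min (b1 $ 3)
    (b1 $ 4)"
    "g2 b1 $ 1 = b1 $ 1" "g2 b1 $ 2 = b1 $ 2"
    using ex_signed_permutation_max_min[of 3 4 b1] by auto
  define b2 where "b2 = g2 b1"
  obtain g3 where g3: "signed_permutation g3" "g3 b2 $ 1 = max (b2 $ 1) (b2 $ 3)" "g3 b2 $ 3 = min (b2 $ 1)
    (b2 $ 3)"
    "g3 b2 $ 2 = b2 $ 2" "g3 b2 $ 4 = b2 $ 4"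
    using ex_signed_permutation_max_min[of 1 3 b2] by auto
  define b3 where "b3 = g3 b2"
  obtain g4 where g4: "signed_permutation g4" "g4 b3 $ 2 = max (b3 $ 2) (b3 $ 4)" "g4 b3 $ 4 = min (b3 $ 2)
    (b3 $ 4)"
    "g4 b3 $ 1 = b3 $ 1" "g4 b3 $ 3 = b3 $ 3"
    using ex_signed_permutation_max_min[of 2 4 b3] by auto
  define b4 where "b4 = g4 b3"
  obtain g5 where g5: "signed_permutation g5" "g5 b4 $ 2 = max (b4 $ 2) (b4 $ 3)" "g5 b4 $ 3 = min (b4 $ 2)
    (b4 $ 3)"
    "g5 b4 $ 1 = b4 $ 1" "g5 b4 $ 4 = b4 $ 4"
    using ex_signed_permutation_max_min[of 2 3 b4] by auto
  have 1: "b1 $ 1 \<ge> b1 $ 2" "b1 $ 2 \<ge> 0" "b1 $ 3 \<ge> 0" "b1 $ 4 \<ge> 0"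
    using g1 nn unfolding b1_def by auto
  then have 2: "b2 $ 1 \<ge> b2 $ 2" "b2 $ 2 \<ge> 0" "b2 $ 3 \<ge> b2 $ 4" "b2 $ 4 \<ge> 0"
    using g2 unfolding b2_def by auto
  then have 3: "b3 $ 1 \<ge> b3 $ 2" "b3 $ 1 \<ge> b3 $ 3" "b3 $ 1 \<ge> b3 $ 4" "b3 $ 3 \<ge> min (b3 $ 2)
    (b3 $ 4)"
    "b3 $ 2 \<ge> 0" "b3 $ 4 \<ge> 0"
    using g3 unfolding b3_def by auto
  then have 4: "b4 $ 1 \<ge> b4 $ 2" "b4 $ 1 \<ge> b4 $ 3" "b4 $ 3 \<ge> b4 $ 4" "b4 $ 2 \<ge> b4 $ 4" "b4
    $ 4 \<ge> 0"
    using g4 unfolding b4_def by auto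
  then have "ordered (g5 b4)"
    using g5 unfolding ordered_def by auto
  moreover have "signed_permutation (g5 \<circ> (g4 \<circ> (g3 \<circ> (g2 \<circ> (g1 \<circ> ?g0)))))"
    using g0 g1(1) g2(1) g3(1) g4(1) g5(1) by (intro signed_permutation_comp)
  ultimately show ?thesis
    by (intro exI[of _ "g5 \<circ> (g4 \<circ> (g3 \<circ> (g2 \<circ> (g1 \<circ> ?g0))))"]) (simp add:
      b4_def b3_def b2_def b1_def b0_def)
qed

text \<open>Two vertices that differ in coordinate \<open>i\<close> alone have values that differ by
  \<open>a $ i\<close>.\<close>

lemma generic_coordinate_nonzero:
  assumes "generic a"
  shows "a $ i \<noteq> 0"
proof
  assume "a $ i = 0"
  let ?v = "\<chi> k. if k = i then - 1/2 else 1/2 :: real^4" and ?w = "\<chi> k. 1/2 :: real^4"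
  have "?v \<in> vertices" "?w \<in> vertices" "?v \<noteq> ?w"
    by (auto simp: vertices_def vec_eq_iff)
  moreover have "a \<bullet> ?v = a \<bullet> ?w"
    unfolding inner_vec_def by (rule sum.cong) (use \<open>a $ i = 0\<close> in auto)
  ultimately show False using assms by (auto simp: generic_def)
qed

lemma region_same_sign:
  assumes R: "R \<in> regions" and a: "a \<in> R" and b: "b \<in> R" and less: "0 < \<epsilon> * a $ i" and
    e: "\<epsilon> \<in> {1, - 1}"
  shows "0 < \<epsilon> * b $ i"
proof -
  let ?v = "\<chi> k. if k = i then - \<epsilon> / 2 else 1/2 :: real^4" and ?w = "\<chi> k. if k = i then
    \<epsilon> / 2 else 1/2 :: real^4"
  have vw: "?v \<in> vertices" "?w \<in> vertices"
    using e by (auto simp: vertices_def)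
  have d: "x \<bullet> ?w - x \<bullet> ?v = \<epsilon> * x $ i" for x
  proof -
    have "x \<bullet> ?w - x \<bullet> ?v = (\<Sum>k\<in>UNIV. if k = i then \<epsilon> * x $ i else 0)"
      unfolding inner_vec_def sum_subtractf[symmetric] by (rule sum.cong) (auto simp: field_simps)
    then show ?thesis by simp
  qed
  show ?thesis
    using region_same_order[OF R a b vw] less d[of a] d[of b] by linarith
qed

text \<open>The vertices whose only negative coordinate is the \<open>i\<close>-th or the
  \<open>j\<close>-th one have values that differ by \<open>a $ i - a $ j\<close>, so the order of
  the coordinates is part of the vertex order. Thus one ordered point makes the whole region
  ordered.\<close>

lemma region_ordered:
  assumes R: "R \<in> regions" and a: "a \<in> R" and b: "b \<in> R" and o: "ordered a"
  shows "ordered b"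
proof -
  have s: "b $ i \<ge> b $ j" if "a $ i \<ge> a $ j" "i \<noteq> j" for i j
  proof -
    let ?v = "\<chi> k. if k = i then - 1/2 else 1/2 :: real^4" and ?w = "\<chi> k. if k = j then - 1/2
      else 1/2 :: real^4"
    have vw: "?v \<in> vertices" "?w \<in> vertices" "?v \<noteq> ?w"
      using that(2) by (auto simp: vertices_def vec_eq_iff)
    have d: "x \<bullet> ?w - x \<bullet> ?v = x $ i - x $ j" for x
    proof -
      have "x \<bullet> ?w - x \<bullet> ?v = (\<Sum>k\<in>UNIV. (if k = i then x $ i else 0) - (if k = j
        then x $ j else 0))"
        unfolding inner_vec_def sum_subtractf[symmetric] by (rule sum.cong) (auto simp: field_simps)
      then show ?thesis by (simp add: sum_subtractf)
    qed
    have "a \<bullet> ?v \<noteq> a \<bullet> ?w" using region_generic(2)[OF R a] vw by (auto simp: generic_def)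
    then have "a \<bullet> ?v < a \<bullet> ?w" using d[of a] that by linarith
    then show ?thesis using region_same_order[OF R a b vw(1,2)] d[of b] by linarith
  qed
  have "0 < a $ 4" using o generic_coordinate_nonzero[OF region_generic(2)[OF R a], of 4]
    by (simp add: ordered_def)
  then have "0 < b $ 4" using region_same_sign[OF R a b, of 1 4] by simp
  then show ?thesis
    using o s[of 2 1] s[of 3 2] s[of 4 3] unfolding ordered_def by simp
qed

section \<open>Signs of polynomials to the right of 0, and perturbation into a chamber\<close>

lemma eventually_sgn_poly_pCons:
  fixes c :: real
  assumes "c \<noteq> 0"
  shows "\<forall>\<^sub>F e in at_right 0. sgn (poly (pCons c q) e) = sgn c"
proof -
  have "((\<lambda>e. poly (pCons c q) e) \<longlongrightarrow> poly (pCons c q) 0) (at_right 0)"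
    by (intro tendsto_intros)
  then have lim: "((\<lambda>e. poly (pCons c q) e) \<longlongrightarrow> c) (at_right 0)" by simp
  show ?thesis
  proof (cases "c > 0")
    case True
    then show ?thesis using order_tendstoD(1)[OF lim True] by (auto elim: eventually_mono)
  next
    case False
    then have "c < 0" using assms by simp
    then show ?thesis using order_tendstoD(2)[OF lim, of 0] by (auto elim: eventually_mono)
  qed
qed

lemma eventually_sgn_poly_pCons_0:
  fixes q :: "real poly"
  assumes "\<forall>\<^sub>F e in at_right 0. sgn (poly q e) = \<sigma>"
  shows "\<forall>\<^sub>F e in at_right 0. sgn (poly (pCons 0 q) e) = \<sigma>"
  using assms eventually_at_right_less[of 0] by eventually_elim (simp add: sgn_mult)

text \<open>The lowest nonvanishing coefficient decides the sign; vanishing ones are stripped off by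
  the induction.\<close>

lemma eventually_sgn_poly:
  fixes p :: "real poly"
  assumes "p \<noteq> 0"
  shows "\<exists>\<sigma>. \<sigma> \<noteq> 0 \<and> (\<forall>\<^sub>F e in at_right 0. sgn (poly p e) =
    \<sigma>)"
  using assms
proof (induction p)
  case (pCons c q)
  show ?case
  proof (cases "c = 0")
    case True
    then show ?thesis using pCons eventually_sgn_poly_pCons_0[of q] by auto
  next
    case False
    then show ?thesis using eventually_sgn_poly_pCons[of c q] by (intro exI[of _ "sgn c"]) (auto simp:
      sgn_eq_0_iff)
  qed
qed simp

lemma matches_iff_vertices:
  "matches r a t \<longleftrightarrow> (\<forall>v\<in>vertices. wins r (2 * v $ 1) (2 * v $ 2) (2 * v $ 3)
    (2 * v $ 4) \<longleftrightarrow>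
    (if v $ 1 > 0 then t \<le> 2 * (a \<bullet> v) else t < 2 * (a \<bullet> v)))"
proof (rule iffI, rule ballI)
  fix v assume m: "matches r a t" and v: "v \<in> vertices"
  have w: "2 * v $ i \<in> {1, - 1}" for i
    using v unfolding vertices_def by (auto dest!: spec[of _ i])
  have "2 * (a \<bullet> v) = 2 * v $ 1 * a $ 1 + 2 * v $ 2 * a $ 2 + 2 * v $ 3 * a $ 3 + 2 * v $ 4 * a $ 4"
    by (simp add: inner_vec_def sum_4 algebra_simps)
  moreover have "2 * v $ 1 = 1 \<longleftrightarrow> v $ 1 > 0" using w[of 1] by auto
  ultimately show "wins r (2 * v $ 1) (2 * v $ 2) (2 * v $ 3) (2 * v $ 4) \<longleftrightarrow>
    (if v $ 1 > 0 then t \<le> 2 * (a \<bullet> v) else t < 2 * (a \<bullet> v))"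
    using m w[of 1] w[of 2] w[of 3] w[of 4] unfolding matches_def by metis
next
  assume *: "\<forall>v\<in>vertices. wins r (2 * v $ 1) (2 * v $ 2) (2 * v $ 3) (2 * v $ 4)
    \<longleftrightarrow>
    (if v $ 1 > 0 then t \<le> 2 * (a \<bullet> v) else t < 2 * (a \<bullet> v))"
  show "matches r a t"
    unfolding matches_def
  proof (intro ballI)
    fix w1 w2 w3 w4 :: real
    assume w: "w1 \<in> {1, - 1}" "w2 \<in> {1, - 1}" "w3 \<in> {1, - 1}" "w4 \<in> {1, - 1}"
    let ?v = "vector [w1 / 2, w2 / 2, w3 / 2, w4 / 2] :: real^4"
    have "?v \<in> vertices"
      unfolding vertices_def mem_Collect_eq forall_4 vector_4 using w by auto
    from bspec[OF * this] show "wins r w1 w2 w3 w4 \<longleftrightarrow>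
      (if w1 = 1 then t \<le> w1 * a $ 1 + w2 * a $ 2 + w3 * a $ 3 + w4 * a $ 4
       else t < w1 * a $ 1 + w2 * a $ 2 + w3 * a $ 3 + w4 * a $ 4)"
      using w by (auto simp: inner_vec_def sum_4 algebra_simps)
  qed
qed

text \<open>The exponent 2 is left out because \<open>t\<close> is replaced by \<open>t + e\<^sup>2\<close> at the same time. As all five
  exponents differ, no relation between vertex values and \<open>t\<close> holds for all small
    \<open>e\<close>.\<close>

definition perturbed :: "real^4 \<Rightarrow> real \<Rightarrow> real^4" where
  "perturbed a e = a + e *\<^sub>R axis 1 1 + e ^ 3 *\<^sub>R axis 2 1 + e ^ 4 *\<^sub>R axis 3 1 + e ^ 5
    *\<^sub>R axis 4 1"

lemma perturbed_nth:
  "perturbed a e $ 1 = a $ 1 + e" "perturbed a e $ 2 = a $ 2 + e ^ 3"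
  "perturbed a e $ 3 = a $ 3 + e ^ 4" "perturbed a e $ 4 = a $ 4 + e ^ 5"
  by (simp_all add: perturbed_def axis_def)

lemma inner_perturbed:
  "perturbed a e \<bullet> v = a \<bullet> v + v $ 1 * e + v $ 2 * e ^ 3 + v $ 3 * e ^ 4 + v $ 4 * e ^ 5"
  by (simp add: inner_vec_def sum_4 perturbed_nth algebra_simps)

lemma ordered_perturbed:
  assumes "ordered a" "0 < e" "e < 1"
  shows "ordered (perturbed a e)"
proof -
  have "e ^ 3 \<le> e" "e ^ 4 \<le> e ^ 3" "e ^ 5 \<le> e ^ 4" "0 \<le> e ^ 5"
    using assms power_decreasing[of 1 3 e] power_decreasing[of 3 4 e] power_decreasing[of 4 5 e] by auto
  then show ?thesis
    using assms(1) unfolding ordered_def perturbed_nth by (intro conjI; linarith)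
qed

text \<open>Each coordinate has its own power of \<open>e\<close>, so the polynomial records
  \<open>v - w\<close> in its coefficients and cannot vanish. This makes the perturbed vector
  generic.\<close>

lemma eventually_sgn_perturbed_diff:
  assumes "v \<noteq> w"
  shows "\<exists>\<sigma>. \<sigma> \<noteq> 0 \<and> (\<forall>\<^sub>F e in at_right 0. sgn (perturbed a
    e \<bullet> v - perturbed a e \<bullet> w) = \<sigma>)"
proof -
  let ?p = "[: a \<bullet> v - a \<bullet> w, v $ 1 - w $ 1, 0, v $ 2 - w $ 2, v $ 3 - w $ 3, v $ 4 - w $ 4 :]"
  have "?p \<noteq> 0" using assms by (auto simp: vec_eq_iff forall_4)
  moreover have "poly ?p e = perturbed a e \<bullet> v - perturbed a e \<bullet> w" for e
    by (simp add: inner_perturbed algebra_simps eval_nat_numeral)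
  ultimately show ?thesis using eventually_sgn_poly[of ?p] by simp
qed

text \<open>In a tie the lowest surviving term is \<open>2 * v $ 1 * e\<close>, which is nonzero at
  a vertex and beats the shift of \<open>t\<close> by \<open>e\<^sup>2\<close>. This is the origin
  of the tie rule in \<open>matches\<close>.\<close>

lemma eventually_sgn_perturbed_side:
  assumes "v \<in> vertices"
  shows "\<forall>\<^sub>F e in at_right 0. sgn (2 * (perturbed a e \<bullet> v) - (t + e\<^sup>2))
    = (if 2 * (a \<bullet> v) = t then sgn (v $ 1) else sgn (2 * (a \<bullet> v) - t))"
proof -
  let ?q = "[: 2 * v $ 1, - 1, 2 * v $ 2, 2 * v $ 3, 2 * v $ 4 :]"
  let ?p = "pCons (2 * (a \<bullet> v) - t) ?q"
  have p: "poly ?p e = 2 * (perturbed a e \<bullet> v) - (t + e\<^sup>2)" for e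
    by (simp add: inner_perturbed algebra_simps eval_nat_numeral)
  show ?thesis
  proof (cases "2 * (a \<bullet> v) = t")
    case True
    have "\<forall>\<^sub>F e in at_right 0. sgn (poly ?q e) = sgn (2 * v $ 1)"
      by (rule eventually_sgn_poly_pCons) (simp add: vertex_nonzero[OF assms])
    from eventually_sgn_poly_pCons_0[OF this] show ?thesis
      using True unfolding p[symmetric] by (simp add: sgn_mult)
  next
    case False
    then show ?thesis
      using eventually_sgn_poly_pCons[of "2 * (a \<bullet> v) - t" ?q] unfolding p by simp
  qed
qed

lemma matches_scale:
  assumes "c > 0"
  shows "matches r (c *\<^sub>R a) (c * t) \<longleftrightarrow> matches r a t"
proof -
  have "c * t \<le> 2 * (c * x) \<longleftrightarrow> t \<le> 2 * x" "c * t < 2 * (c * x)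
    \<longleftrightarrow> t < 2 * x" for x
    using mult_le_cancel_left_pos[OF assms, of t "2 * x"] mult_less_cancel_left_pos[OF assms, of t "2 * x"]
    by (simp_all add: mult_ac)
  then show ?thesis unfolding matches_iff_vertices by simp
qed

lemma ordered_scale: "c > 0 \<Longrightarrow> ordered (c *\<^sub>R a) \<longleftrightarrow> ordered a"
  by (simp add: ordered_def zero_le_mult_iff)

text \<open>On a short initial piece of the perturbation curve all comparisons have constant signs.
  The curve is connected, hence stays in one region, and its lower vertices do not change, so it
  stays in one chamber. Letting \<open>e\<close> tend to 0 puts \<open>(a, t)\<close> into the
  closure, and \<open>region_ordered\<close> makes the whole chamber ordered.\<close>

lemma ex_ordered_chamber:
  assumes n: "norm a = 1" and o: "ordered a" and t: "t \<ge> 0" and r: "r \<in> references" and m: "matches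
    r a t"
  shows "\<exists>C\<in>ordered_chambers. (a, t) \<in> closure C \<and> (\<exists>(b, s)\<in>C. matches r b s)"
proof -
  \<comment> \<open>One sign per pair of vertices, fixed independently of \<open>e\<close>, so that
    finitely many eventual statements combine into a single threshold
    \<open>\<delta>\<close>.\<close>
  define \<sigma> where "\<sigma> = (\<lambda>(v, w). SOME \<sigma>. \<sigma> \<noteq> 0 \<and>
    (\<forall>\<^sub>F e in at_right 0. sgn (perturbed a e \<bullet> v - perturbed a e \<bullet> w) =
      \<sigma>))"
  have \<sigma>: "\<sigma> (v, w) \<noteq> 0" "\<forall>\<^sub>F e in at_right 0. sgn (perturbed a e
    \<bullet> v - perturbed a e \<bullet> w) = \<sigma> (v, w)"
    if "v \<noteq> w" for v w
    using someI_ex[OF eventually_sgn_perturbed_diff[OF that, of a]] by (simp_all add: \<sigma>_def)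
  define \<rho> where "\<rho> v = (if 2 * (a \<bullet> v) = t then sgn (v $ 1) else sgn (2 * (a \<bullet>
    v) - t))" for v
  have "\<forall>\<^sub>F e in at_right (0::real). e < 1"
    using eventually_at_right_real[of 0 1] by (auto elim: eventually_mono)
  moreover have "\<forall>\<^sub>F e in at_right 0. \<forall>v\<in>vertices. \<forall>w\<in>vertices - {v}.
      sgn (perturbed a e \<bullet> v - perturbed a e \<bullet> w) = \<sigma> (v, w)"
    using finite_vertices by (intro eventually_ball_finite ballI \<sigma>) auto
  moreover have "\<forall>\<^sub>F e in at_right 0. \<forall>v\<in>vertices. sgn (2 * (perturbed a e
    \<bullet> v) - (t + e\<^sup>2)) = \<rho> v"
    unfolding \<rho>_def by (intro eventually_ball_finite finite_vertices ballI eventually_sgn_perturbed_side)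
  moreover define good where "good e \<longleftrightarrow> e < 1 \<and> (\<forall>v\<in>vertices.
    \<forall>w\<in>vertices - {v}.
      sgn (perturbed a e \<bullet> v - perturbed a e \<bullet> w) = \<sigma> (v, w)) \<and>
      (\<forall>v\<in>vertices. sgn (2 * (perturbed a e \<bullet> v) - (t + e\<^sup>2)) = \<rho> v)" for e
  ultimately have "eventually good (at_right 0)"
    unfolding good_def by (intro eventually_conj)
  then obtain \<delta> where "\<delta> > 0" and good: "\<And>e. 0 < e \<Longrightarrow> e < \<delta>
    \<Longrightarrow> good e"
    unfolding eventually_at_right_field by blast
  have \<delta>: "\<And>e. 0 < e \<Longrightarrow> e < \<delta> \<Longrightarrow> e < 1"
    "\<And>e v w. 0 < e \<Longrightarrow> e < \<delta> \<Longrightarrow> v \<in> vertices \<Longrightarrow>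
      w \<in> vertices \<Longrightarrow> v \<noteq> w \<Longrightarrow>
      sgn (perturbed a e \<bullet> v - perturbed a e \<bullet> w) = \<sigma> (v, w)"
    "\<And>e v. 0 < e \<Longrightarrow> e < \<delta> \<Longrightarrow> v \<in> vertices \<Longrightarrow>
      sgn (2 * (perturbed a e \<bullet> v) - (t + e\<^sup>2)) = \<rho> v"
    using good unfolding good_def by auto
  \<comment> \<open>Rescaling puts the perturbed vector back on the sphere; \<open>t\<close> is
    scaled along with it, which preserves every comparison.\<close>
  define c where "c e = inverse (norm (perturbed a e))" for e
  define b where "b e = c e *\<^sub>R perturbed a e" for e
  define s where "s e = c e * (t + e\<^sup>2)" for e
  have a1: "a $ 1 \<ge> 0" using o by (simp add: ordered_def)
  have nz: "norm (perturbed a e) > 0" if "0 < e" for e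
    using that a1 perturbed_nth(1)[of a e] by auto
  have c: "c e > 0" if "0 < e" for e using nz[OF that] by (simp add: c_def)
  have nb: "norm (b e) = 1" if "0 < e" for e
    using nz[OF that] by (simp add: b_def c_def)
  have gen: "generic (b e)" if e: "0 < e" "e < \<delta>" for e
    unfolding generic_def
  proof (intro ballI impI)
    fix v w assume "v \<in> vertices" "w \<in> vertices" "v \<noteq> w"
    then have "sgn (perturbed a e \<bullet> v - perturbed a e \<bullet> w) \<noteq> 0"
      using \<delta>(2) \<sigma>(1) e by simp
    then show "b e \<bullet> v \<noteq> b e \<bullet> w" using c[OF e(1)] by (auto simp: b_def)
  qed
  let ?X = "{a :: real^4. norm a = 1 \<and> generic a}"
  let ?R = "connected_component_set ?X (b (\<delta> / 2))"
  have "connected (b ` {0<..<\<delta>})"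
  proof (rule connected_continuous_image)
    have "continuous_on {0<..<\<delta>} (perturbed a)"
      unfolding perturbed_def by (intro continuous_intros)
    then show "continuous_on {0<..<\<delta>} b"
      unfolding b_def c_def using nz by (intro continuous_intros) auto
  qed simp
  moreover have half: "\<delta> / 2 \<in> {0<..<\<delta>}" using \<open>\<delta> > 0\<close> by simp
  moreover have "b ` {0<..<\<delta>} \<subseteq> ?X" using nb gen by auto
  ultimately have bR: "b ` {0<..<\<delta>} \<subseteq> ?R"
    by (intro connected_component_maximal) auto
  have R: "?R \<in> regions"
    unfolding regions_eq using nb gen half by (intro componentsI) auto
  have side: "sgn (2 * (b e \<bullet> v) - s e) = \<rho> v" if e: "0 < e" "e < \<delta>" and v: "v \<in>
    vertices" for e v
  proof -
    have "2 * (b e \<bullet> v) - s e = c e * (2 * (perturbed a e \<bullet> v) - (t + e\<^sup>2))"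
      by (simp add: b_def s_def algebra_simps)
    then show ?thesis using \<delta>(3)[OF e v] c[OF e(1)] by (simp add: sgn_mult)
  qed
  have \<rho>: "\<rho> v = 1 \<or> \<rho> v = - 1" "wins r (2 * v $ 1) (2 * v $ 2) (2 * v $ 3) (2 * v $ 4)
    \<longleftrightarrow> \<rho> v = 1"
    if v: "v \<in> vertices" for v
    using m v vertex_nonzero[OF v, of 1] unfolding matches_iff_vertices \<rho>_def by (auto simp: sgn_if
      split: if_splits)
  have less: "s e / 2 < b e \<bullet> v \<longleftrightarrow> \<rho> v = 1" "b e \<bullet> v < s e / 2
    \<longleftrightarrow> \<rho> v = - 1"
    if "0 < e" "e < \<delta>" "v \<in> vertices" for e v
    using side[OF that] \<rho>(1)[OF that(3)] by (auto simp: sgn_if split: if_splits)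
  have mb: "matches r (b e) (s e)" if e: "0 < e" "e < \<delta>" for e
    unfolding matches_iff_vertices
  proof
    fix v assume v: "v \<in> vertices"
    show "wins r (2 * v $ 1) (2 * v $ 2) (2 * v $ 3) (2 * v $ 4) \<longleftrightarrow>
      (if v $ 1 > 0 then s e \<le> 2 * (b e \<bullet> v) else s e < 2 * (b e \<bullet> v))"
      using less[OF e v] \<rho>[OF v] by auto
  qed
  \<comment> \<open>The sign \<open>\<sigma> (v, - v)\<close> is that of the perturbed value of
    \<open>v\<close> itself, so the right-hand side does not mention \<open>e\<close>: the chamber
    index is constant along the curve.\<close>
  define L where "L = {v \<in> vertices. \<sigma> (v, - v) = 1 \<and> \<rho> v = - 1}"
  have L: "lower_vertices (b e) (s e) = L" if e: "0 < e" "e < \<delta>" for e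
  proof -
    have "0 < b e \<bullet> v \<longleftrightarrow> \<sigma> (v, - v) = 1" if v: "v \<in> vertices" for v
    proof -
      have "v $ 1 \<noteq> (- v) $ 1" using vertex_nonzero[OF v, of 1] by simp
      then have "v \<noteq> - v" by metis
      then have "sgn (2 * (perturbed a e \<bullet> v)) = \<sigma> (v, - v)"
        using \<delta>(2)[OF e v uminus_vertex[OF v]] by simp
      moreover have "0 < b e \<bullet> v \<longleftrightarrow> 0 < perturbed a e \<bullet> v"
        using c[OF e(1)] by (simp add: b_def zero_less_mult_iff)
      ultimately show ?thesis by (auto simp: sgn_if split: if_splits)
    qed
    then show ?thesis using less[OF e] by (auto simp: L_def lower_vertices_def)
  qed
  let ?C = "chamber ?R (card L)"
  have inC: "(b e, s e) \<in> ?C" if e: "0 < e" "e < \<delta>" for e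
  proof -
    have "(b e, s e) \<in> chamber ?R (card (lower_vertices (b e) (s e)))"
    proof (rule chamberI[OF R])
      show "b e \<in> ?R" by (rule subsetD[OF bR]) (use e in auto)
      \<comment> \<open>The shift by \<open>e\<^sup>2\<close> is needed at \<open>t = 0\<close>,
        because chambers contain only positive \<open>t\<close>.\<close>
      show "s e > 0" unfolding s_def using c[OF e(1)] t e by (intro mult_pos_pos add_nonneg_pos) auto
      show "b e \<bullet> v \<noteq> s e / 2" if "v \<in> vertices" for v
        using less[OF e that] \<rho>(1)[OF that] by auto
      let ?v = "\<chi> i. 1/2 :: real^4"
      have v: "?v \<in> vertices" by (simp add: vertices_def)
      \<comment> \<open>Every type cuts off the vertex with all coordinates 1/2, so \<open>t\<close>
        stays below the largest vertex value, as membership in a chamber requires.\<close>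
      have "wins r 1 1 1 1" using r by (auto simp: references_def wins_def)
      then show "\<exists>v\<in>vertices. s e / 2 < b e \<bullet> v"
        using less(1)[OF e v] \<rho>(2)[OF v] v by auto
    qed
    then show ?thesis using L[OF e] by simp
  qed
  have "?C \<in> ordered_chambers"
  proof -
    have "?C \<noteq> {}" using inC[of "\<delta> / 2"] half by fastforce
    then have "?C \<in> chambers" unfolding chambers_def using R by blast
    moreover have "?C \<subseteq> parameters"
    proof
      fix x assume "x \<in> ?C"
      then obtain a' t' where x: "x = (a', t')" "(a', t') \<in> ?C" by (cases x) auto
      note D = chamberD[OF R x(2)]
      have e: "0 < \<delta> / 2" "\<delta> / 2 < \<delta>" using half by auto
      have "ordered (b (\<delta> / 2))"
        unfolding b_def using ordered_scale[OF c[OF e(1)]] ordered_perturbed[OF o e(1) \<delta>(1)[OF e]]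
          by simp
      then have "ordered a'" using region_ordered[OF R _ D(1)] bR half by blast
      then show "x \<in> parameters"
        using x(1) D(2) region_generic(1)[OF R D(1)] by (simp add: parameters_def)
    qed
    ultimately show ?thesis by (simp add: ordered_chambers_def)
  qed
  moreover have "(a, t) \<in> closure ?C"
  proof (rule Lim_in_closed_set[OF closed_closure, of "\<lambda>e. (b e, s e)" _ "at_right 0"])
    have "\<forall>\<^sub>F e in at_right 0. e \<in> {0<..<\<delta>}" by (rule eventually_at_right_real[OF
      \<open>\<delta> > 0\<close>])
    then show "\<forall>\<^sub>F e in at_right 0. (b e, s e) \<in> closure ?C"
      by eventually_elim (use inC closure_subset in force)
    have "(perturbed a \<longlongrightarrow> perturbed a 0) (at_right 0)"
      unfolding perturbed_def by (intro tendsto_intros)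
    then have p: "(perturbed a \<longlongrightarrow> a) (at_right 0)" by (simp add: perturbed_def)
    then have cl: "(c \<longlongrightarrow> inverse (norm a)) (at_right 0)"
      unfolding c_def using n by (intro tendsto_intros) auto
    then have "(b \<longlongrightarrow> inverse (norm a) *\<^sub>R a) (at_right 0)"
      unfolding b_def by (intro tendsto_intros p)
    moreover have "(s \<longlongrightarrow> inverse (norm a) * (t + 0\<^sup>2)) (at_right 0)"
      unfolding s_def by (intro tendsto_intros cl)
    ultimately show "((\<lambda>e. (b e, s e)) \<longlongrightarrow> (a, t)) (at_right 0)"
      using n by (intro tendsto_Pair) simp_all
  qed simp
  moreover have "\<exists>(b, s)\<in>?C. matches r b s"
    using inC[of "\<delta> / 2"] mb[of "\<delta> / 2"] half by auto
  ultimately show ?thesis by blast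
qed

lemma real_polynomial_function_signed_diff:
  assumes "\<And>w. real_polynomial_function (f w)"
  shows "real_polynomial_function (\<lambda>x. (\<nabla>w. f w x))"
  unfolding signed_diff_def by (intro real_polynomial_function_diff assms)

lemma real_polynomial_function_if_zero:
  "real_polynomial_function f \<Longrightarrow> real_polynomial_function (\<lambda>x. if P then f x else 0)"
  by (cases P) (auto intro: real_polynomial_function.intros)

lemma real_polynomial_function_coordinates:
  "real_polynomial_function (\<lambda>x. fst x $ i :: real)" "real_polynomial_function (\<lambda>x. snd x
    :: real)"
proof -
  have "bounded_linear ((\<lambda>a. a $ i) \<circ> fst)"
    by (intro bounded_linear_compose[unfolded o_def[symmetric]] bounded_linear_vec_nth bounded_linear_fst)
  then show "real_polynomial_function (\<lambda>x. fst x $ i :: real)"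
    by (auto simp: o_def intro: real_polynomial_function.intros)
qed (intro real_polynomial_function.intros bounded_linear_snd)

lemmas real_polynomial_function_intros = real_polynomial_function_signed_diff real_polynomial_function_if_zero
  real_polynomial_function_coordinates real_polynomial_function_diff real_polynomial_function_power
  real_polynomial_function.intros(2-4)

lemma ordered_imp_nonneg: "ordered a \<Longrightarrow> 0 \<le> a $ i"
  using exhaust_4[of i] by (auto simp: ordered_def)

lemma ordered_imp_first_pos:
  assumes "norm a = 1" "ordered a"
  shows "a $ 1 > 0"
proof (rule ccontr)
  assume "\<not> a $ 1 > 0"
  then have "a $ i = 0" for i
    using assms(2) exhaust_4[of i] by (auto simp: ordered_def)
  then have "a = 0" by (simp add: vec_eq_iff)
  then show False using assms(1) by simp
qed

section \<open>From one point of a chamber to its closure\<close>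

definition weakly_matches :: "real \<times> real \<times> real \<times> real \<times> real \<Rightarrow>
  real^4 \<Rightarrow> real \<Rightarrow> bool" where
  "weakly_matches r a t \<longleftrightarrow> (\<forall>v\<in>vertices.
    (if wins r (2 * v $ 1) (2 * v $ 2) (2 * v $ 3) (2 * v $ 4) then t \<le> 2 * (a \<bullet> v) else 2 * (a
      \<bullet> v) \<le> t))"

lemma weakly_matches_imp_compatible:
  assumes "weakly_matches r a t"
  shows "compatible (wins r) (a $ 1) (a $ 2) (a $ 3) (a $ 4) t"
  unfolding compatible_def
proof (intro ballI)
  fix w1 w2 w3 w4 :: real
  assume w: "w1 \<in> {1, - 1}" "w2 \<in> {1, - 1}" "w3 \<in> {1, - 1}" "w4 \<in> {1, - 1}"
  let ?v = "vector [w1 / 2, w2 / 2, w3 / 2, w4 / 2] :: real^4"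
  have "?v \<in> vertices"
    unfolding vertices_def mem_Collect_eq forall_4 vector_4 using w by auto
  moreover have "2 * (a \<bullet> ?v) = w1 * a $ 1 + w2 * a $ 2 + w3 * a $ 3 + w4 * a $ 4"
    by (simp add: inner_vec_def sum_4 algebra_simps)
  ultimately show "(t < w1 * a $ 1 + w2 * a $ 2 + w3 * a $ 3 + w4 * a $ 4 \<longrightarrow> wins r w1 w2 w3
    w4) \<and>
    (w1 * a $ 1 + w2 * a $ 2 + w3 * a $ 3 + w4 * a $ 4 < t \<longrightarrow> \<not> wins r w1 w2 w3 w4)"
    using assms unfolding weakly_matches_def by (auto dest!: bspec[of _ _ ?v] split: if_splits)
qed

lemma matches_imp_weakly_matches: "matches r a t \<Longrightarrow> weakly_matches r a t"
  unfolding matches_iff_vertices weakly_matches_def by (auto split: if_splits)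

text \<open>The four conclusions together define a closed set, so it suffices to have them on the
  chamber. There they are inherited from the single point \<open>(a0, t0)\<close>: the sides by
  \<open>chamber_same_side\<close>, the signs of the coordinates by \<open>region_same_sign\<close>.
  The map \<open>g\<close> carries the chamber to the ordered sector.\<close>

lemma weakly_matches_closure_chamber:
  assumes C: "C \<in> chambers" and p: "(a0, t0) \<in> C" and g: "signed_permutation g"
    and nn: "\<And>i. 0 \<le> g a0 $ i" and m: "matches r (g a0) t0" and x: "(a, t) \<in> closure C"
  shows "norm a = 1" "t \<ge> 0" "\<And>i. 0 \<le> g a $ i" "weakly_matches r (g a) t"
proof -
  obtain R j where R: "R \<in> regions" and Cj: "C = chamber R j"
    using C by (auto simp: chambers_def)
  have o: "orthogonal_transformation g" by (rule signed_permutation_orthogonal[OF g])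
  have i: "g x \<bullet> g y = x \<bullet> y" for x y
    using o by (auto simp: orthogonal_transformation_def)
  have p': "(a0, t0) \<in> chamber R j" using p Cj by simp
  note P = chamberD[OF R p']
  obtain \<pi> \<epsilon> where \<epsilon>: "\<And>i. \<epsilon> i \<in> {1, - 1 :: real}" and geq: "g =
    (\<lambda>a. \<chi> i. \<epsilon> i * a $ \<pi> i)"
    using g by (auto simp: signed_permutation_def)
  let ?T = "{x. norm (fst x) = 1 \<and> 0 \<le> snd x \<and> (\<forall>i. 0 \<le> g (fst x) $ i) \<and>
    (\<forall>v\<in>vertices. if wins r (2 * v $ 1) (2 * v $ 2) (2 * v $ 3) (2 * v $ 4) then snd x \<le> 2
      * (g (fst x) \<bullet> v)
      else 2 * (g (fst x) \<bullet> v) \<le> snd x)}"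
  have "C \<subseteq> ?T"
  proof
    fix x assume "x \<in> C"
    then obtain b s where x: "x = (b, s)" "(b, s) \<in> chamber R j" using Cj by (cases x) auto
    note D = chamberD[OF R x(2)]
    have "0 \<le> g b $ i" for i
    proof -
      have "a0 $ \<pi> i \<noteq> 0" by (rule generic_coordinate_nonzero[OF region_generic(2)[OF R P(1)]])
      moreover have "\<epsilon> i \<noteq> 0" using \<epsilon>[of i] by auto
      ultimately have "0 < \<epsilon> i * a0 $ \<pi> i" using nn[of i] by (simp add: geq less_le)
      then show ?thesis using region_same_sign[OF R P(1) D(1) _ \<epsilon>] by (simp add: geq less_imp_le)
    qed
    moreover have "if wins r (2 * v $ 1) (2 * v $ 2) (2 * v $ 3) (2 * v $ 4) then s \<le> 2 * (g b \<bullet> v)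
      else 2 * (g b \<bullet> v) \<le> s" if v: "v \<in> vertices" for v
    proof -
      obtain u where u: "u \<in> vertices" "v = g u"
        using bij_betw_imp_surj_on[OF signed_permutation_vertices[OF g]] v by blast
      have "wins r (2 * v $ 1) (2 * v $ 2) (2 * v $ 3) (2 * v $ 4) \<longleftrightarrow> t0 / 2 < a0
        \<bullet> u"
      proof -
        \<comment> \<open>No vertex lies on the hyperplane of a chamber point, so the strict and the
          weak reading in \<open>matches\<close> agree.\<close>
        have "2 * (a0 \<bullet> u) \<noteq> t0" using P(3)[OF u(1)] by linarith
        moreover have "wins r (2 * v $ 1) (2 * v $ 2) (2 * v $ 3) (2 * v $ 4) \<longleftrightarrow>
          (if v $ 1 > 0 then t0 \<le> 2 * (a0 \<bullet> u) else t0 < 2 * (a0 \<bullet> u))"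
          using m v i[of a0 u] u(2) unfolding matches_iff_vertices by metis
        ultimately show ?thesis by (cases "v $ 1 > 0"; auto)
      qed
      also have "\<dots> \<longleftrightarrow> s / 2 < b \<bullet> u" by (rule chamber_same_side[OF R p'
        x(2) u(1)])
      finally show ?thesis using i[of b u] u(2) by simp
    qed
    ultimately show "x \<in> ?T"
      using x(1) D(2) region_generic(1)[OF R D(1)] by simp
  qed
  moreover have "closed ?T"
  proof -
    have "continuous_on UNIV (\<lambda>x :: (real^4) \<times> real. g (fst x))"
      unfolding geq by (intro continuous_intros)
    note c = this
    have if_le: "closed {x. if P then f x \<le> h x else h x \<le> f x}"
      if "continuous_on UNIV f" "continuous_on UNIV h" for P and f h :: "(real^4) \<times> real
        \<Rightarrow> real"
      using that by (cases P) (auto intro: closed_Collect_le)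
    show ?thesis
      unfolding Ball_def
      by (intro closed_Collect_conj closed_Collect_all closed_Collect_imp open_Collect_const if_le
          closed_Collect_eq closed_Collect_le continuous_intros c)
  qed
  ultimately have "closure C \<subseteq> ?T" by (rule closure_minimal)
  then have "(a, t) \<in> ?T" using x by blast
  then show "norm a = 1" "t \<ge> 0" "\<And>i. 0 \<le> g a $ i" "weakly_matches r (g a) t"
    by (auto simp: weakly_matches_def)
qed

lemma half_vertex: "(\<chi> i. 1/2) \<in> vertices"
  by (simp add: vertices_def)

lemma inner_vertex_le_half_sum_abs:
  assumes "v \<in> vertices"
  shows "2 * (a \<bullet> v) \<le> (\<Sum>i\<in>UNIV. \<bar>a $ i\<bar>)"
proof -
  have "\<bar>v $ i\<bar> \<le> 1/2" for i
    using assms unfolding vertices_def by (auto dest!: spec[of _ i])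
  then show ?thesis using inner_le_half_sum_abs[of v a] by (simp add: cube_iff)
qed

lemma sum_abs_eq_inner_half_vertex:
  assumes "\<And>i. 0 \<le> a $ i"
  shows "(\<Sum>i\<in>UNIV. \<bar>a $ i\<bar>) = 2 * (a \<bullet> (\<chi> i. 1/2))"
  using assms by (simp add: inner_vec_def sum_divide_distrib[symmetric])

lemma chamber_less_sum_abs:
  assumes "C \<in> chambers" "(a, t) \<in> C"
  shows "norm a = 1" "0 < t" "t < (\<Sum>i\<in>UNIV. \<bar>a $ i\<bar>)"
proof -
  obtain R j where R: "R \<in> regions" "(a, t) \<in> chamber R j"
    using assms by (auto simp: chambers_def)
  show "norm a = 1" "0 < t"
    using region_generic(1)[OF R(1)] chamberD(1,2)[OF R] by auto
  obtain v where "v \<in> vertices" "t / 2 < a \<bullet> v" using chamberD(5)[OF R] by auto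
  then show "t < (\<Sum>i\<in>UNIV. \<bar>a $ i\<bar>)" using inner_vertex_le_half_sum_abs[of v a] by auto
qed

lemma sum_abs_signed_permutation:
  assumes "signed_permutation g"
  shows "(\<Sum>i\<in>UNIV. \<bar>g a $ i\<bar>) = (\<Sum>i\<in>UNIV. \<bar>a $ i\<bar>)"
proof -
  obtain \<pi> \<epsilon> where \<pi>: "\<pi> permutes UNIV" and \<epsilon>: "\<And>i. \<epsilon> i \<in>
    {1, - 1 :: real}"
    and g: "g = (\<lambda>a. \<chi> i. \<epsilon> i * a $ \<pi> i)"
    using assms by (auto simp: signed_permutation_def)
  have "\<bar>\<epsilon> i\<bar> = 1" for i using \<epsilon>[of i] by auto
  then have "(\<Sum>i\<in>UNIV. \<bar>g a $ i\<bar>) = (\<Sum>i\<in>UNIV. \<bar>a $ \<pi> i\<bar>)"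
    by (simp add: g abs_mult)
  also have "\<dots> = (\<Sum>i\<in>UNIV. \<bar>a $ i\<bar>)"
    using sum.permute[OF \<pi>, of "\<lambda>i. \<bar>a $ i\<bar>"] by (simp add: o_def)
  finally show ?thesis .
qed

lemma signed_permutation_nonzero:
  assumes "signed_permutation g" "\<And>i. a $ i \<noteq> 0"
  shows "g a $ i \<noteq> 0"
proof -
  obtain \<pi> \<epsilon> where \<epsilon>: "\<And>i. \<epsilon> i \<in> {1, - 1 :: real}" and g: "g =
    (\<lambda>a. \<chi> i. \<epsilon> i * a $ \<pi> i)"
    using assms(1) by (auto simp: signed_permutation_def)
  show ?thesis using \<epsilon>[of i] assms(2)[of "\<pi> i"] by (auto simp: g)
qed

text \<open>Each reference realises its own type, after scaling to the sphere. The integers are such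
  that \<open>c \<bullet> w\<close> and \<open>\<theta>\<close> have opposite parity, so no tie
  occurs.\<close>

lemma ex_reference_point:
  assumes "r \<in> references"
  shows "\<exists>a t. norm a = 1 \<and> ordered a \<and> 0 \<le> t \<and> matches r a t"
proof -
  obtain c1 c2 c3 c4 \<theta> where r: "r = (c1, c2, c3, c4, \<theta>)" by (metis prod_cases5)
  let ?c = "vector [c1, c2, c3, c4] :: real^4"
  have o: "ordered ?c" "0 \<le> \<theta>" "c1 \<noteq> 0"
    using assms unfolding r references_def by (auto simp: ordered_def)
  have "matches r ?c \<theta>"
    using assms unfolding r references_def matches_def wins_def by auto
  have "?c \<noteq> 0" using o(3) by (auto simp: vec_eq_iff forall_4)
  then have pos: "0 < inverse (norm ?c)" by simp
  have "norm (inverse (norm ?c) *\<^sub>R ?c) = 1" using \<open>?c \<noteq> 0\<close> by simp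
  moreover have "ordered (inverse (norm ?c) *\<^sub>R ?c)"
    using ordered_scale[OF pos] o by simp
  moreover have "matches r (inverse (norm ?c) *\<^sub>R ?c) (inverse (norm ?c) * \<theta>)"
    using matches_scale[OF pos] \<open>matches r ?c \<theta>\<close> by simp
  moreover have "0 \<le> inverse (norm ?c) * \<theta>" using o by simp
  ultimately show ?thesis by blast
qed

text \<open>The pieces are the cells on which all members of \<open>H\<close> have prescribed signs;
  there are at most three choices per member. A negative sign is expressed as positivity of the
  negated polynomial, which makes each cell basic semialgebraic.\<close>

lemma piecewise_rational_onI:
  assumes fin: "finite H" and poly: "\<And>h. h \<in> H \<Longrightarrow> real_polynomial_function h"
    and cell: "\<And>x. x \<in> D \<Longrightarrow> \<exists>r. rational_fraction r \<and>
      (\<forall>y\<in>D. (\<forall>h\<in>H. sgn (h y) = sgn (h x)) \<longrightarrow> snd r y \<noteq> 0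
        \<and> f y = fst r y / snd r y)"
  shows "piecewise_rational_on D f"
proof -
  define cl where "cl x = {y. \<forall>h\<in>H. sgn (h y) = sgn (h x)}" for x :: "(real^4) \<times> real"
  have "cl ` D \<subseteq> (\<lambda>\<phi>. {y. \<forall>h\<in>H. sgn (h y) = \<phi> h}) ` (H
    \<rightarrow>\<^sub>E {- 1, 0, 1})"
  proof
    fix S assume "S \<in> cl ` D"
    then obtain x where x: "S = cl x" by auto
    show "S \<in> (\<lambda>\<phi>. {y. \<forall>h\<in>H. sgn (h y) = \<phi> h}) ` (H \<rightarrow>\<^sub>E
      {- 1, 0, 1})"
      by (rule image_eqI[where x = "restrict (\<lambda>h. sgn (h x)) H"]) (auto simp: x cl_def sgn_if)
  qed
  then have "finite (cl ` D)"
    by (rule finite_subset) (intro finite_imageI finite_PiE fin, simp)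
  moreover have "D \<subseteq> \<Union> (cl ` D)" by (auto simp: cl_def)
  moreover have "basic_semialgebraic (cl x)" for x
  proof -
    let ?E = "{h \<in> H. h x = 0}" and ?P = "{h \<in> H. h x > 0} \<union> (\<lambda>h y. - h y) ` {h
      \<in> H. h x < 0}"
    have eq: "cl x = {y. (\<forall>h\<in>?E. h y = 0) \<and> (\<forall>h\<in>?P. h y > 0)}"
    proof (intro set_eqI iffI)
      fix y assume "y \<in> cl x"
      then have "sgn (h y) = sgn (h x)" if "h \<in> H" for h using that by (auto simp: cl_def)
      then have "h y = 0 \<longleftrightarrow> h x = 0" "h y > 0 \<longleftrightarrow> h x > 0" "h y < 0
        \<longleftrightarrow> h x < 0" if "h \<in> H" for h
        using that by (metis sgn_eq_0_iff, metis sgn_greater, metis sgn_less)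
      then show "y \<in> {y. (\<forall>h\<in>?E. h y = 0) \<and> (\<forall>h\<in>?P. h y > 0)}" by auto
    next
      fix y assume y: "y \<in> {y. (\<forall>h\<in>?E. h y = 0) \<and> (\<forall>h\<in>?P. h y > 0)}"
      have "sgn (h y) = sgn (h x)" if h: "h \<in> H" for h
      proof (cases "h x" "0::real" rule: linorder_cases)
        case less
        then have "(\<lambda>y. - h y) \<in> ?P" using h by blast
        moreover have "\<forall>h\<in>?P. h y > 0" using y unfolding mem_Collect_eq by (rule conjunct2)
        ultimately have "- h y > 0" by (rule bspec[rotated])
        then show ?thesis using less by simp
      qed (use y h in auto)
      then show "y \<in> cl x" by (simp add: cl_def)
    qed
    have p: "real_polynomial_function h" if "h \<in> ?E \<union> ?P" for h
      using that poly by (auto intro!: real_polynomial_function_minus)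
    have "finite ?E" "finite ?P" using fin by auto
    then show ?thesis
      unfolding basic_semialgebraic_def
      by (intro exI[of _ ?E] exI[of _ ?P] conjI ballI p eq)
  qed
  moreover have "\<exists>r. rational_fraction r \<and> (\<forall>y \<in> cl x \<inter> D. snd r y \<noteq>
    0 \<and> f y = fst r y / snd r y)" if "x \<in> D" for x
    using cell[OF that] by (auto simp: cl_def)
  ultimately show ?thesis
    unfolding piecewise_rational_on_def by (intro exI[of _ "cl ` D"]) blast
qed

section \<open>The common argument for slices and slabs\<close>

locale volume_formula =
  fixes frac :: "real \<times> real \<times> real \<times> real \<times> real \<Rightarrow> fraction"
    and f :: "(real^4) \<times> real \<Rightarrow> real" and k :: real
  assumes correct: "\<And>r a t. r \<in> references \<Longrightarrow> norm a = 1 \<Longrightarrow>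
    (\<And>i. a $ i \<ge> 0) \<Longrightarrow> t \<ge> 0 \<Longrightarrow>
      compatible (wins r) (a $ 1) (a $ 2) (a $ 3) (a $ 4) t \<Longrightarrow> snd (frac r) (a, t) \<noteq>
        0 \<Longrightarrow>
      f (a, t) = fst (frac r) (a, t) / snd (frac r) (a, t)"
    and invariant: "\<And>g a t. signed_permutation g \<Longrightarrow> norm a = 1 \<Longrightarrow> f (g
      a, t) = f (a, t)"
    and nonzero: "\<And>r a t. (\<And>i. a $ i \<noteq> 0) \<Longrightarrow> snd (frac r) (a, t) \<noteq> 0"
    and supports: "\<And>r a t. r \<in> references \<Longrightarrow> supports a r \<Longrightarrow> snd
      (frac r) (a, t) \<noteq> 0"
    and polynomial: "\<And>r. real_polynomial_function (fst (frac r))" "\<And>r. real_polynomial_function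
      (snd (frac r))"
    and distinct: "\<And>r s g. r \<in> references \<Longrightarrow> s \<in> references \<Longrightarrow> r
      \<noteq> s \<Longrightarrow> signed_permutation g \<Longrightarrow>
      \<not> same_rational (substitute g (frac r)) (frac s)"
    and beyond: "\<And>a t. (\<Sum>i\<in>UNIV. \<bar>a $ i\<bar>) < t \<Longrightarrow> f (a, t) = k"
begin

lemma rational: "rational_fraction (frac r)"
  unfolding rational_fraction_def
proof (intro conjI polynomial bexI)
  show "snd (frac r) ((\<chi> i. 1/2), 0) \<noteq> 0" by (rule nonzero) simp
  show "((\<chi> i. 1/2) :: real^4, 0 :: real) \<in> sphere 0 1 \<times> UNIV" using norm_vertex[OF
    half_vertex] by simp
qed

text \<open>The closed form holds at \<open>g a\<close>, whose coordinates are nonnegative, and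
  invariance of the volume carries it back to \<open>a\<close>.\<close>

lemma represents_closure:
  assumes C: "C \<in> chambers" and p: "(a0, t0) \<in> C" and g: "signed_permutation g"
    and o: "ordered (g a0)" and r: "r \<in> references" and m: "matches r (g a0) t0"
  shows "represents (substitute g (frac r)) f (closure C)"
  unfolding represents_def
proof (intro conjI ballI)
  fix x assume x: "x \<in> closure C"
  obtain a t where at: "x = (a, t)" by (cases x)
  note W = weakly_matches_closure_chamber[OF C p g ordered_imp_nonneg[OF o] m, of a t]
  have cl: "(a, t) \<in> closure C" using x at by simp
  have n: "norm (g a) = 1"
    using W(1)[OF cl] signed_permutation_orthogonal[OF g] by (simp add: orthogonal_transformation_norm)
  show "snd (substitute g (frac r)) x \<noteq> 0 \<longrightarrow> f x = fst (substitute g (frac r)) x /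
    snd (substitute g (frac r)) x"
    using correct[OF r n W(3)[OF cl] W(2)[OF cl] weakly_matches_imp_compatible[OF W(4)[OF cl]]]
      invariant[OF g W(1)[OF cl]] by (simp add: at substitute_def)
next
  fix x assume "x \<in> closure C"
  show "case x of (a, t) \<Rightarrow> (\<forall>i. a $ i \<noteq> 0) \<longrightarrow> snd (substitute g
    (frac r)) (a, t) \<noteq> 0"
    using nonzero[OF signed_permutation_nonzero[OF g]] by (auto simp: substitute_def)
qed

lemma represents_closure_ordered:
  assumes C: "C \<in> ordered_chambers" and p: "(a0, t0) \<in> C" and r: "r \<in> references" and m:
    "matches r a0 t0"
  shows "represents (frac r) f (closure C)"
proof -
  have "C \<in> chambers" "ordered a0" using C p by (auto simp: ordered_chambers_def parameters_def)
  then show ?thesis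
    using represents_closure[OF _ p signed_permutation_id _ r] m by (simp add: substitute_id)
qed

lemma chamber_represented:
  assumes C: "C \<in> chambers" and p: "(a0, t0) \<in> C" and g: "signed_permutation g" and o: "ordered (g a0)"
  shows "\<exists>r\<in>references. represents (substitute g (frac r)) f (closure C)"
proof -
  note S = chamber_less_sum_abs[OF C p]
  have "norm (g a0) = 1"
    using S(1) signed_permutation_orthogonal[OF g] by (simp add: orthogonal_transformation_norm)
  moreover have "t0 \<le> g a0 $ 1 + g a0 $ 2 + g a0 $ 3 + g a0 $ 4"
    using S(3) sum_abs_signed_permutation[OF g, of a0] ordered_imp_nonneg[OF o] by (simp add: sum_4)
  ultimately obtain r where "r \<in> references" "matches r (g a0) t0"
    using ex_matching_reference[OF o ordered_imp_first_pos] o S(2) by (metis less_imp_le)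
  then show ?thesis using represents_closure[OF C p g o] by blast
qed

text \<open>The fraction is chosen first, from the point, so that \<open>supports\<close> makes its
  denominator nonzero; only then does the perturbation find a chamber of this type whose closure
  contains the point.\<close>

lemma parameters_represented:
  assumes n: "norm a = 1" and o: "ordered a" and t: "0 \<le> t" and v: "v \<in> vertices" "t / 2 \<le> a
    \<bullet> v"
  shows "\<exists>C\<in>ordered_chambers. \<exists>r\<in>references. (a, t) \<in> closure C \<and>
    represents (frac r) f (closure C) \<and>
    snd (frac r) (a, t) \<noteq> 0"
proof -
  have "t \<le> a $ 1 + a $ 2 + a $ 3 + a $ 4"
    using inner_vertex_le_half_sum_abs[OF v(1), of a] v(2) ordered_imp_nonneg[OF o] by (simp add: sum_4)
  then obtain r where r: "r \<in> references" "matches r a t" "supports a r"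
    using ex_matching_reference[OF o ordered_imp_first_pos[OF n o] t] by blast
  obtain C where C: "C \<in> ordered_chambers" "(a, t) \<in> closure C" "\<exists>(b, s)\<in>C. matches r b s"
    using ex_ordered_chamber[OF n o t r(1,2)] by blast
  then have "represents (frac r) f (closure C)"
    using represents_closure_ordered[OF C(1) _ r(1)] by blast
  then show ?thesis using C r supports by blast
qed

lemma chamberwise: "chamberwise_representation (frac ` references) f"
  unfolding chamberwise_representation_def
proof (intro conjI)
  show "\<forall>r\<in>frac ` references. rational_fraction r \<and> (\<exists>C\<in>ordered_chambers.
    represents r f (closure C))"
  proof (rule ballI, elim imageE, hypsubst, intro conjI rational)
    fix r assume r: "r \<in> references"
    obtain a t where "norm a = 1" "ordered a" "0 \<le> t" "matches r a t"
      using ex_reference_point[OF r] by blast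
    from ex_ordered_chamber[OF this(1-3) r this(4)] obtain C b s
      where "C \<in> ordered_chambers" "(b, s) \<in> C" "matches r b s" by blast
    then show "\<exists>C\<in>ordered_chambers. represents (frac r) f (closure C)"
      using represents_closure_ordered[OF _ _ r] by blast
  qed
  show "\<forall>C\<in>ordered_chambers. \<exists>r\<in>frac ` references. represents r f (closure C)"
  proof
    fix C assume C: "C \<in> ordered_chambers"
    then obtain a t where p: "(a, t) \<in> C" by (force simp: ordered_chambers_def chambers_def)
    have "C \<in> chambers" "ordered a" using C p by (auto simp: ordered_chambers_def parameters_def)
    from chamber_represented[OF this(1) p signed_permutation_id this(2)]
    show "\<exists>r\<in>frac ` references. represents r f (closure C)" by (simp add: substitute_id)
  qed
  show "\<forall>C\<in>chambers. \<exists>r\<in>frac ` references. \<exists>g. signed_permutation g \<and>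
    represents (substitute g r) f (closure C)"
  proof
    fix C assume C: "C \<in> chambers"
    then obtain a t where p: "(a, t) \<in> C" by (force simp: chambers_def)
    obtain g where g: "signed_permutation g" "ordered (g a)" using ex_signed_permutation_ordered by blast
    from chamber_represented[OF C p g] g(1)
    show "\<exists>r\<in>frac ` references. \<exists>g. signed_permutation g \<and> represents (substitute
      g r) f (closure C)" by blast
  qed
  show "\<forall>r\<in>frac ` references. \<forall>s\<in>frac ` references. \<forall>g. r \<noteq> s
    \<longrightarrow> signed_permutation g \<longrightarrow>
    \<not> same_rational (substitute g r) s"
    using distinct by blast
  show "\<forall>(a, t)\<in>parameters. (\<exists>v\<in>vertices. t / 2 \<le> a \<bullet> v) \<longrightarrow>
    (\<exists>C\<in>ordered_chambers. \<exists>r\<in>frac ` references. (a, t) \<in> closure C \<and>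
       represents r f (closure C) \<and> snd r (a, t) \<noteq> 0)"
    unfolding parameters_def using parameters_represented by fastforce
qed

text \<open>The polynomials \<open>?H1\<close> fix the side of every vertex, ties included, and
  \<open>?H2\<close> fixes which coordinates vanish. Hence \<open>matches\<close> and
  \<open>supports\<close> are constant on a cell, and one fraction without poles serves all of
  it.\<close>

lemma piecewise_rational: "piecewise_rational_on parameters f"
proof (rule piecewise_rational_onI)
  let ?H1 = "(\<lambda>v x. 2 * (fst x \<bullet> v) - snd x) ` vertices :: ((real^4) \<times> real
    \<Rightarrow> real) set"
  let ?H2 = "range (\<lambda>i x. fst x $ i) :: ((real^4) \<times> real \<Rightarrow> real) set"
  show "finite (?H1 \<union> ?H2)" using finite_vertices by simp
  have "real_polynomial_function (\<lambda>x :: (real^4) \<times> real. fst x \<bullet> v)" for v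
    by (intro real_polynomial_function.intros bounded_linear_inner_left_comp bounded_linear_fst)
  then show "real_polynomial_function h" if "h \<in> ?H1 \<union> ?H2" for h
    using that by (auto intro!: real_polynomial_function_intros)
  fix x assume "x \<in> parameters"
  then obtain a t where x: "x = (a, t)" and n: "norm a = 1" and o: "ordered a" and t: "0 \<le> t"
    by (auto simp: parameters_def)
  have side: "sgn (2 * (b \<bullet> v) - s) = sgn (2 * (a \<bullet> v) - t)"
    if "\<forall>h\<in>?H1 \<union> ?H2. sgn (h (b, s)) = sgn (h x)" "v \<in> vertices" for b s v
    using bspec[OF that(1), of "\<lambda>x. 2 * (fst x \<bullet> v) - snd x"] that(2) by (simp add: x)
  have coord: "sgn (b $ i) = sgn (a $ i)"
    if "\<forall>h\<in>?H1 \<union> ?H2. sgn (h (b, s)) = sgn (h x)" for b s i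
    using bspec[OF that(1), of "\<lambda>x. fst x $ i"] by (simp add: x)
  have sgn: "t \<le> y \<longleftrightarrow> s \<le> z" "t < y \<longleftrightarrow> s < z" if "sgn (z - s)
    = sgn (y - t)" for y z s t :: real
    using that by (auto simp: sgn_if split: if_splits)
  show "\<exists>r. rational_fraction r \<and> (\<forall>y\<in>parameters. (\<forall>h\<in>?H1 \<union>
    ?H2. sgn (h y) = sgn (h x)) \<longrightarrow>
    snd r y \<noteq> 0 \<and> f y = fst r y / snd r y)"
  proof (cases "t \<le> a $ 1 + a $ 2 + a $ 3 + a $ 4")
    case True
    then obtain r where r: "r \<in> references" "matches r a t" "supports a r"
      using ex_matching_reference[OF o ordered_imp_first_pos[OF n o] t] by blast
    have "snd (frac r) y \<noteq> 0 \<and> f y = fst (frac r) y / snd (frac r) y"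
      if y: "y \<in> parameters" and h: "\<forall>h\<in>?H1 \<union> ?H2. sgn (h y) = sgn (h x)" for y
    proof -
      obtain b s where bs: "y = (b, s)" "norm b = 1" "ordered b" "0 \<le> s"
        using y by (auto simp: parameters_def)
      have h': "\<forall>h\<in>?H1 \<union> ?H2. sgn (h (b, s)) = sgn (h x)" using h bs by simp
      have "matches r b s"
        using r(2) sgn[OF side[OF h']] unfolding matches_iff_vertices by simp
      moreover have "b $ i > 0 \<longleftrightarrow> a $ i > 0" for i
        using coord[OF h', of i] by (auto simp: sgn_if split: if_splits)
      then have "supports b r" using r(3) by (simp add: supports_def split: prod.splits)
      ultimately show ?thesis
        using supports[OF r(1)] correct[OF r(1) bs(2) ordered_imp_nonneg[OF bs(3)] bs(4)]
          weakly_matches_imp_compatible[OF matches_imp_weakly_matches] bs(1) by blast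
    qed
    then show ?thesis using rational by blast
  next
    \<comment> \<open>Above the largest vertex value the hyperplane misses the cube and the slab is
      the whole cube, so the volume is the constant \<open>k\<close>, namely 0 or 1.\<close>
    case False
    have "f y = k"
      if y: "y \<in> parameters" and h: "\<forall>h\<in>?H1 \<union> ?H2. sgn (h y) = sgn (h x)" for y
    proof -
      obtain b s where bs: "y = (b, s)" "ordered b"
        using y by (auto simp: parameters_def)
      have h': "\<forall>h\<in>?H1 \<union> ?H2. sgn (h (b, s)) = sgn (h x)" using h bs by simp
      have "2 * (a \<bullet> (\<chi> i. 1/2)) < t"
        using False by (simp add: inner_vec_def sum_4)
      then have "2 * (b \<bullet> (\<chi> i. 1/2)) < s"
        using sgn(1)[OF side[OF h' half_vertex]] by (simp add: not_le[symmetric])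
      then show ?thesis
        using beyond sum_abs_eq_inner_half_vertex[OF ordered_imp_nonneg[OF bs(2)]] bs(1) by simp
    qed
    moreover have "rational_fraction (\<lambda>_. k, \<lambda>_. 1)"
      using norm_vertex[OF half_vertex]
      by (auto simp: rational_fraction_def intro!: real_polynomial_function_intros bexI[of _ "((\<chi> i.
        1/2), 0)"])
    ultimately show ?thesis by (intro exI[of _ "(\<lambda>_. k, \<lambda>_. 1)"]) auto
  qed
qed

end

lemma real_polynomial_function_fractions:
  "real_polynomial_function (fst (slice_fraction r))" "real_polynomial_function (snd (slice_fraction r))"
  "real_polynomial_function (fst (slab_fraction r))" "real_polynomial_function (snd (slab_fraction r))"
  unfolding slice_fraction_def slab_fraction_def case_prod_unfold
  by (auto intro!: real_polynomial_function_intros)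

interpretation slice: volume_formula slice_fraction slice_volume 0
proof
  show "slice_volume (a, t) = fst (slice_fraction r) (a, t) / snd (slice_fraction r) (a, t)"
    if "r \<in> references" "norm a = 1" "\<And>i. a $ i \<ge> 0" "t \<ge> 0"
      "compatible (wins r) (a $ 1) (a $ 2) (a $ 3) (a $ 4) t" "snd (slice_fraction r) (a, t) \<noteq> 0"
        for r a t
    using slice_fraction_correct that by blast
  show "slice_volume (g a, t) = slice_volume (a, t)" if "signed_permutation g" "norm a = 1" for g a t
    using slice_volume_signed_permutation that by blast
  show "snd (slice_fraction r) (a, t) \<noteq> 0" if "\<And>i. a $ i \<noteq> 0" for r a t
    using nonzero_imp_denominator(1) that by blast
  show "snd (slice_fraction r) (a, t) \<noteq> 0" if "r \<in> references" "supports a r" for r a t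
    using supports_imp_denominator(1) that by blast
  show "slice_volume (a, t) = 0" if "(\<Sum>i\<in>UNIV. \<bar>a $ i\<bar>) < t" for a t
    using that by (rule slice_volume_eq_0)
qed (use slice_fraction_not_same_rational in \<open>auto intro: real_polynomial_function_fractions\<close>)

interpretation slab: volume_formula slab_fraction slab_volume 1
proof
  show "slab_volume (a, t) = fst (slab_fraction r) (a, t) / snd (slab_fraction r) (a, t)"
    if "r \<in> references" "norm a = 1" "\<And>i. a $ i \<ge> 0" "t \<ge> 0"
      "compatible (wins r) (a $ 1) (a $ 2) (a $ 3) (a $ 4) t" "snd (slab_fraction r) (a, t) \<noteq> 0" for
        r a t
    using slab_fraction_correct that by blast
  show "slab_volume (g a, t) = slab_volume (a, t)" if "signed_permutation g" "norm a = 1" for g a t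
    using slab_volume_signed_permutation that by blast
  show "snd (slab_fraction r) (a, t) \<noteq> 0" if "\<And>i. a $ i \<noteq> 0" for r a t
    using nonzero_imp_denominator(2) that by blast
  show "snd (slab_fraction r) (a, t) \<noteq> 0" if "r \<in> references" "supports a r" for r a t
    using supports_imp_denominator(2) that by blast
  show "slab_volume (a, t) = 1" if "(\<Sum>i\<in>UNIV. \<bar>a $ i\<bar>) < t" for a t
    using that by (rule slab_volume_eq_1[OF less_imp_le])
qed (use slab_fraction_not_same_rational in \<open>auto intro: real_polynomial_function_fractions\<close>)

theorem theorem1p2:
  shows "piecewise_rational_on parameters slice_volume \<and>
         piecewise_rational_on parameters slab_volume \<and>
         (\<exists>F. card F = 14 \<and> chamberwise_representation F slice_volume) \<and>
         (\<exists>F. card F = 14 \<and> chamberwise_representation F slab_volume)"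
  using slice.piecewise_rational slab.piecewise_rational slice.chamberwise slab.chamberwise card_fractions
  by blast

end
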